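(* Let $\boldsymbol{X}$ be a Poisson process with unknown intensity $s$ with respect to Lebesgue measure on $[0,1]^l$. Assume that $\sqrt{s}$ belongs to some Besov space $B_{p,\infty}^\alpha([0,1]^l)$ for some unknown values of $p>0$, $\alpha>l(1/p-1/2)_+$ and of the semi-norm $|\sqrt{s}|_{B_{p,\infty}^\alpha}$. One can build a T-estimator $\hat s(\boldsymbol{X})$ (not depending on $s$ or on these unknown values) such that $$\mathbb{E}_s\left[H^2(s,\hat s)\right]\le C(\alpha,p,l)\left[|\sqrt{s}|_{B_{p,\infty}^\alpha}\vee1\right]^{2l/(2\alpha+l)},$$ where $C(\alpha,p,l)$ depends only on $\alpha,p,l$.
   Context: Poisson processes and loss. Let $\lambda$ be Lebesgue measure on $\mathcal{X}=[0,1]^l$, $\mathbb{L}_1^+(\lambda)$ the nonnegative elements of $\mathbb{L}_1(\lambda)$. A Poisson process with intensity $s\in\mathbb{L}_1^+(\lambda)$ is a point process $\boldsymbol{X}=\{X_1,\dots,X_N\}$ with $N$ Poisson with parameter $\int s\,d\lambda$ and, conditionally on $N$, the $X_i$ i.i.d. with density $s/\int s\,d\lambda$; $\mathbb{E}_s$ is the corresponding expectation. More generally $\mathbb{P}_\mu$ refers to a Poisson process with finite mean measure $\mu$. For finite measures, $H^2(\mu,\mu')=\frac12\int(\sqrt{d\mu/d\nu}-\sqrt{d\mu'/d\nu})^2d\nu$ ($\nu$ any dominating measure); $\mu_t=t\cdot\lambda$ and $H(t,u)=H(\mu_t,\mu_u)=2^{-1/2}\|\sqrt t-\sqrt u\|_2$.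 $a\vee b=\max(a,b)$, $x_+=\max(x,0)$. Besov spaces. Given a suitable wavelet basis $\{\varphi_{j,\boldsymbol{k}}, j\ge-1,\boldsymbol{k}\in\Lambda(j)\}$ of $\mathbb{L}_2([0,1]^l,dx)$ (suitable meaning regular enough for the smoothness $\alpha$ considered, so that the characterization below of the Besov space holds), with $|\Lambda(-1)|\le\Gamma$ and $2^{jl}\le|\Lambda(j)|\le\Gamma2^{jl}$ for $j\ge0$, any $f\in\mathbb{L}_2$ is written $f=\sum_{j\ge-1}\sum_{\boldsymbol{k}\in\Lambda(j)}\beta_{j,\boldsymbol{k}}\varphi_{j,\boldsymbol{k}}$, and $f\in B_{p,\infty}^\alpha([0,1]^l)$ if and only if $$|f|_{B_{p,\infty}^\alpha}=\sup_{j\ge0}2^{j(\alpha+\frac l2-\frac lp)}\Big(\sum_{\boldsymbol{k}\in\Lambda(j)}|\beta_{j,\boldsymbol{k}}|^p\Big)^{1/p}<+\infty.$$ T-estimators. A subset $S'$ of a metric space $(M,d)$ is a D-model with parameters $\eta,D,B'>0$ if $|S'\cap\mathcal{B}(t,x\eta)|\le B'\exp[Dx^2]$ for all $x\ge2$, $t\in M$ (open balls). Take a countable family of D-models $S_m$ in $(\mathbb{L}_1^+(\lambda),H)$ with parameters $\eta_m,D_m,B'$ such that $D_m\ge1/2$, $\eta_m^2\ge84D_m/5$ and $\sum_m\exp[-\eta_m^2/84]<\infty$; let $S=\bigcup_mS_m$, $\eta(t)=\inf\{\eta_m : S_m\ni t\}$. For each pair of distinct $t,u\in S$ take a test $\psi_{t,u}(\boldsymbol{X})\in\{t,u\}$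 with $\mathbb{P}_\mu[\psi_{t,u}=u]\le\exp[-(H^2(t,u)-\eta^2(t)+\eta^2(u))/4]$ whenever $H(\mu,\mu_t)\le H(t,u)/4$, $\mathbb{P}_\mu[\psi_{t,u}=t]\le\exp[-(H^2(t,u)-\eta^2(u)+\eta^2(t))/4]$ whenever $H(\mu,\mu_u)\le H(t,u)/4$, and $\mathbb{P}_\mu[\psi_{t,u}=u]\le\exp[(16H^2(\mu,\mu_t)+\eta^2(t)-\eta^2(u))/4]$ for all finite measures $\mu$ (such tests exist). A T-estimator is a measurable minimizer over $t\in S$ of $\mathcal{D}_{\boldsymbol{X}}(t)=\sup\{H(t,u) : u\in S,u\ne t,\psi_{t,u}(\boldsymbol{X})=u\}$ ($\sup\emptyset=0$). *)

theory Defs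
  imports "HOL-Probability.Probability"
begin

section \<open>Poisson processes\<close>

text \<open>
  A realisation of a finite point process on \<open>M\<close> is a finite multiset of points: the mean measure
  may have atoms, so points may be repeated.
  The \<open>\<sigma>\<close>-algebra is generated by the numbers of points in measurable sets.
\<close>

definition config_space :: "'a measure \<Rightarrow> 'a multiset measure" where
  "config_space M = sigma {X. set_mset X \<subseteq> space M}
     {{X. set_mset X \<subseteq> space M \<and> size (filter_mset (\<lambda>x. x \<in> B) X) = k} | B k. B \<in> sets M}"

text \<open>
  The law of \<open>{x\<^sub>0, \<dots>, x\<^sub>N\<^sub>-\<^sub>1}\<close>, where \<open>N\<close> is Poisson with parameter \<open>\<mu>(space \<mu>)\<close> and
  independent of the i.i.d. sequence \<open>x\<close> with distribution \<open>\<mu>/\<mu>(space \<mu>)\<close>.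
  A process with mean measure 0 has no points; this case is separate since
  \<^const>\<open>poisson_pmf\<close> needs a positive rate.
\<close>

definition poisson_law :: "'a measure \<Rightarrow> 'a multiset measure" where
  "poisson_law \<mu> =
     (if measure \<mu> (space \<mu>) = 0 then return (config_space \<mu>) {#}
      else distr (measure_pmf (poisson_pmf (measure \<mu> (space \<mu>))) \<Otimes>\<^sub>M
                  (\<Pi>\<^sub>M i\<in>(UNIV :: nat set). scale_measure (1 / emeasure \<mu> (space \<mu>)) \<mu>))
             (config_space \<mu>) (\<lambda>(n, x). image_mset x (mset_set {..<n})))"

lemma config_space_generators:
  "{{X. set_mset X \<subseteq> space M \<and> size (filter_mset (\<lambda>x. x \<in> B) X) = k} | B k. B \<in> sets M}
     \<subseteq> Pow {X. set_mset X \<subseteq> space M}"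
  by auto

lemma space_config_space: "space (config_space M) = {X. set_mset X \<subseteq> space M}"
  unfolding config_space_def using config_space_generators by (rule space_measure_of)

lemma measurable_poisson_construction:
  assumes "sets N = sets M"
  shows "(\<lambda>(n, x). image_mset x (mset_set {..<n}))
    \<in> measurable (measure_pmf p \<Otimes>\<^sub>M (\<Pi>\<^sub>M i\<in>(UNIV :: nat set). N)) (config_space M)"
    (is "?f \<in> measurable ?P _")
  unfolding config_space_def
proof (rule measurable_measure_of[OF config_space_generators])
  have sp: "space N = space M" using assms by (rule sets_eq_imp_space_eq)
  show f_space: "?f \<in> space ?P \<rightarrow> {X. set_mset X \<subseteq> space M}"
    by (auto simp: space_pair_measure space_PiM sp PiE_iff)
  fix A assume "A \<in> {{X. set_mset X \<subseteq> space M \<and> size (filter_mset (\<lambda>x. x \<in> B) X) = k} | B k. B \<in> sets M}"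
  then obtain B k where B: "B \<in> sets M"
    and A: "A = {X. set_mset X \<subseteq> space M \<and> size (filter_mset (\<lambda>x. x \<in> B) X) = k}"
    by blast
  have [measurable]: "B \<in> sets N" using B assms by simp
  have cnt: "size (filter_mset (\<lambda>x. x \<in> B) (image_mset x (mset_set {..<n})))
      = (\<Sum>i<n. if x i \<in> B then 1 else 0)" for x :: "nat \<Rightarrow> 'a" and n :: nat
    by (induction n) (simp_all add: lessThan_Suc)
  have "?f -` A \<inter> space ?P
      = {\<omega> \<in> space ?P. (\<Sum>i<fst \<omega>. if snd \<omega> i \<in> B then 1 else 0) = k}"
  proof (intro set_eqI iffI)
    fix \<omega> assume "\<omega> \<in> ?f -` A \<inter> space ?P"
    then show "\<omega> \<in> {\<omega> \<in> space ?P. (\<Sum>i<fst \<omega>. if snd \<omega> i \<in> B then 1 else 0) = k}"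
      by (simp add: A cnt split_beta)
  next
    fix \<omega> assume \<omega>: "\<omega> \<in> {\<omega> \<in> space ?P. (\<Sum>i<fst \<omega>. if snd \<omega> i \<in> B then 1 else 0) = k}"
    then have "?f \<omega> \<in> {X. set_mset X \<subseteq> space M}" using f_space by blast
    with \<omega> show "\<omega> \<in> ?f -` A \<inter> space ?P" by (simp add: A cnt split_beta)
  qed
  also have "\<dots> \<in> sets ?P"
  proof -
    let ?E = "\<lambda>n. {\<omega> \<in> space ?P. fst \<omega> = n \<and> (\<Sum>i<n. if snd \<omega> i \<in> B then 1 else (0::nat)) = k}"
    have E: "?E n \<in> sets ?P" for n
    proof -
      have [measurable]: "(\<lambda>\<omega>. \<Sum>i<n. if snd \<omega> i \<in> B then 1 else (0::nat)) \<in> borel_measurable ?P"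
        by (intro borel_measurable_sum) measurable
      show ?thesis by measurable
    qed
    have "{\<omega> \<in> space ?P. (\<Sum>i<fst \<omega>. if snd \<omega> i \<in> B then 1 else 0) = k} = (\<Union>n. ?E n)"
      by auto
    then show ?thesis using E by (simp add: sets.countable_UN image_subset_iff)
  qed
  finally show "?f -` A \<inter> space ?P \<in> sets ?P" .
qed

lemma prob_space_poisson_law:
  assumes "finite_measure \<mu>"
  shows "prob_space (poisson_law \<mu>)"
proof (cases "measure \<mu> (space \<mu>) = 0")
  case True
  then show ?thesis
    by (auto simp: poisson_law_def space_config_space intro!: prob_space_return)
next
  case False
  interpret finite_measure \<mu> by fact
  let ?N = "scale_measure (1 / emeasure \<mu> (space \<mu>)) \<mu>"
  let ?p = "poisson_pmf (measure \<mu> (space \<mu>))"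
  have em: "emeasure \<mu> (space \<mu>) \<noteq> 0" "emeasure \<mu> (space \<mu>) \<noteq> \<infinity>"
    using False by (auto simp: measure_def)
  have "1 / emeasure \<mu> (space \<mu>) * emeasure \<mu> (space \<mu>) = 1"
    using em by (simp add: ennreal_divide_times ennreal_divide_self less_top[symmetric])
  then have N: "prob_space ?N"
    by (intro prob_spaceI) (simp add: space_scale_measure)
  then have "prob_space (measure_pmf ?p \<Otimes>\<^sub>M (\<Pi>\<^sub>M i\<in>(UNIV :: nat set). ?N))"
    by (intro prob_space_pair prob_space_PiM prob_space_measure_pmf)
  then have "prob_space (distr (measure_pmf ?p \<Otimes>\<^sub>M (\<Pi>\<^sub>M i\<in>(UNIV :: nat set). ?N))
      (config_space \<mu>) (\<lambda>(n, x). image_mset x (mset_set {..<n})))"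
    by (rule prob_space.prob_space_distr) (rule measurable_poisson_construction, simp)
  then show ?thesis using False by (simp add: poisson_law_def)
qed

section \<open>Hellinger distance\<close>

definition sum_measure :: "'a measure \<Rightarrow> 'a measure \<Rightarrow> 'a measure" where
  "sum_measure \<mu> \<mu>' = measure_of (space \<mu>) (sets \<mu>) (\<lambda>A. emeasure \<mu> A + emeasure \<mu>' A)"

definition hellinger_wrt :: "'a measure \<Rightarrow> 'a measure \<Rightarrow> 'a measure \<Rightarrow> real" where
  "hellinger_wrt \<nu> \<mu> \<mu>' =
     sqrt (1 / 2 * (\<integral>x. (sqrt (enn2real (RN_deriv \<nu> \<mu> x)) - sqrt (enn2real (RN_deriv \<nu> \<mu>' x)))\<^sup>2 \<partial>\<nu>))"

text \<open>
  For finite measures the value does not depend on the dominating measure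
  (see \<open>hellinger_eq_wrt\<close> below), so \<open>\<mu> + \<mu>'\<close> is used.
\<close>

definition hellinger :: "'a measure \<Rightarrow> 'a measure \<Rightarrow> real" where
  "hellinger \<mu> \<mu>' = hellinger_wrt (sum_measure \<mu> \<mu>') \<mu> \<mu>'"

definition L1_plus :: "'a measure \<Rightarrow> ('a \<Rightarrow> real) set" where
  "L1_plus M = {f. integrable M f \<and> (AE x in M. 0 \<le> f x)}"

definition intensity_measure :: "'a measure \<Rightarrow> ('a \<Rightarrow> real) \<Rightarrow> 'a measure" where
  "intensity_measure M t = density M (\<lambda>x. ennreal (t x))"

definition hellinger_fun :: "'a measure \<Rightarrow> ('a \<Rightarrow> real) \<Rightarrow> ('a \<Rightarrow> real) \<Rightarrow> real" where
  "hellinger_fun M t u = hellinger (intensity_measure M t) (intensity_measure M u)"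

subsection \<open>Independence of the dominating measure\<close>

lemma sets_sum_measure [simp]: "sets (sum_measure \<mu> \<mu>') = sets \<mu>"
  and space_sum_measure [simp]: "space (sum_measure \<mu> \<mu>') = space \<mu>"
  by (simp_all add: sum_measure_def)

lemma emeasure_sum_measure:
  assumes "sets \<mu>' = sets \<mu>" "A \<in> sets \<mu>"
  shows "emeasure (sum_measure \<mu> \<mu>') A = emeasure \<mu> A + emeasure \<mu>' A"
  unfolding sum_measure_def
proof (rule emeasure_measure_of_sigma)
  show "sigma_algebra (space \<mu>) (sets \<mu>)" by (rule sets.sigma_algebra_axioms)
  show "positive (sets \<mu>) (\<lambda>A. emeasure \<mu> A + emeasure \<mu>' A)"
    by (simp add: positive_def)
  show "countably_additive (sets \<mu>) (\<lambda>A. emeasure \<mu> A + emeasure \<mu>' A)"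
  proof (rule countably_additiveI)
    fix A :: "nat \<Rightarrow> 'a set"
    assume A: "range A \<subseteq> sets \<mu>" "disjoint_family A"
    then show "(\<Sum>i. emeasure \<mu> (A i) + emeasure \<mu>' (A i))
        = emeasure \<mu> (\<Union> (range A)) + emeasure \<mu>' (\<Union> (range A))"
      using suminf_emeasure[of A \<mu>] suminf_emeasure[of A \<mu>'] assms(1)
      by (simp add: suminf_add[symmetric])
  qed
qed fact

lemma hellinger_wrt_density:
  assumes "sigma_finite_measure \<nu>"
    and f: "f \<in> borel_measurable \<nu>" and g: "g \<in> borel_measurable \<nu>"
  shows "hellinger_wrt \<nu> (density \<nu> f) (density \<nu> g)
    = sqrt (1 / 2 * (\<integral>x. (sqrt (enn2real (f x)) - sqrt (enn2real (g x)))\<^sup>2 \<partial>\<nu>))"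
proof -
  interpret sigma_finite_measure \<nu> by fact
  have "AE x in \<nu>. f x = RN_deriv \<nu> (density \<nu> f) x" "AE x in \<nu>. g x = RN_deriv \<nu> (density \<nu> g) x"
    using f g by (auto intro!: RN_deriv_unique)
  then have "AE x in \<nu>.
      (sqrt (enn2real (RN_deriv \<nu> (density \<nu> f) x)) - sqrt (enn2real (RN_deriv \<nu> (density \<nu> g) x)))\<^sup>2
    = (sqrt (enn2real (f x)) - sqrt (enn2real (g x)))\<^sup>2"
    by eventually_elim simp
  then show ?thesis
    unfolding hellinger_wrt_def using f g by (subst integral_cong_AE) (auto)
qed

lemma hellinger_eq_wrt:
  assumes \<nu>: "sigma_finite_measure \<nu>"
    and fin: "finite_measure \<mu>" "finite_measure \<mu>'"
    and sets: "sets \<mu> = sets \<nu>" "sets \<mu>' = sets \<nu>"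
    and ac: "absolutely_continuous \<nu> \<mu>" "absolutely_continuous \<nu> \<mu>'"
  shows "hellinger \<mu> \<mu>' = hellinger_wrt \<nu> \<mu> \<mu>'"
proof -
  define \<sigma> where "\<sigma> = sum_measure \<mu> \<mu>'"
  interpret \<nu>: sigma_finite_measure \<nu> by fact
  interpret \<mu>: finite_measure \<mu> by fact
  interpret \<mu>': finite_measure \<mu>' by fact
  have sets_\<sigma>: "sets \<sigma> = sets \<nu>" by (simp add: \<sigma>_def sets)
  have em: "emeasure \<sigma> A = emeasure \<mu> A + emeasure \<mu>' A" if "A \<in> sets \<nu>" for A
    using that sets by (simp add: \<sigma>_def emeasure_sum_measure)
  have space_eq: "space \<mu> = space \<nu>" "space \<mu>' = space \<nu>" "space \<sigma> = space \<nu>"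
    using sets sets_\<sigma> by (auto dest: sets_eq_imp_space_eq)
  interpret \<sigma>: finite_measure \<sigma>
  proof (rule finite_measureI)
    show "emeasure \<sigma> (space \<sigma>) \<noteq> \<infinity>"
      using em[of "space \<nu>"] \<mu>.emeasure_finite \<mu>'.emeasure_finite by (simp add: space_eq)
  qed
  have ac_\<sigma>: "absolutely_continuous \<sigma> \<mu>" "absolutely_continuous \<sigma> \<mu>'"
    using em sets sets_\<sigma> by (auto simp: absolutely_continuous_def null_sets_def)
  have ac_\<nu>: "absolutely_continuous \<nu> \<sigma>"
    using ac em sets sets_\<sigma> by (auto simp: absolutely_continuous_def null_sets_def subset_iff)
  define f where "f = RN_deriv \<sigma> \<mu>"
  define g where "g = RN_deriv \<sigma> \<mu>'"
  define h where "h = RN_deriv \<nu> \<sigma>"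
  have [measurable]: "f \<in> borel_measurable \<nu>" "g \<in> borel_measurable \<nu>" "h \<in> borel_measurable \<nu>"
    using borel_measurable_RN_deriv[of \<sigma> \<mu>] borel_measurable_RN_deriv[of \<sigma> \<mu>']
      borel_measurable_RN_deriv[of \<nu> \<sigma>]
    unfolding f_def[symmetric] g_def[symmetric] h_def[symmetric] measurable_cong_sets[OF sets_\<sigma> refl]
    by simp_all
  have \<sigma>: "\<sigma> = density \<nu> h"
    using \<nu>.density_RN_deriv[OF ac_\<nu> sets_\<sigma>] by (simp add: h_def)
  have \<mu>_\<sigma>: "\<mu> = density \<sigma> f" "\<mu>' = density \<sigma> g"
    using \<sigma>.density_RN_deriv[OF ac_\<sigma>(1)] \<sigma>.density_RN_deriv[OF ac_\<sigma>(2)] sets sets_\<sigma>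
    by (simp_all add: f_def g_def)
  have \<mu>_\<nu>: "\<mu> = density \<nu> (\<lambda>x. h x * f x)" "\<mu>' = density \<nu> (\<lambda>x. h x * g x)"
    using \<mu>_\<sigma> by (simp_all add: \<sigma> density_density_eq)
  have h_fin: "AE x in \<nu>. h x \<noteq> \<infinity>"
    unfolding h_def
    by (rule \<nu>.RN_deriv_finite[OF _ ac_\<nu> sets_\<sigma>]) (rule \<sigma>.sigma_finite_measure_axioms)
  have "hellinger \<mu> \<mu>' = hellinger_wrt \<sigma> (density \<sigma> f) (density \<sigma> g)"
    unfolding \<mu>_\<sigma>[symmetric] hellinger_def \<sigma>_def[symmetric] ..
  also have "\<dots> = sqrt (1 / 2 * (\<integral>x. (sqrt (enn2real (f x)) - sqrt (enn2real (g x)))\<^sup>2 \<partial>\<sigma>))"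
    by (rule hellinger_wrt_density)
       (simp_all add: f_def g_def \<sigma>.sigma_finite_measure_axioms)
  also have "(\<integral>x. (sqrt (enn2real (f x)) - sqrt (enn2real (g x)))\<^sup>2 \<partial>\<sigma>)
      = (\<integral>x. (sqrt (enn2real (f x)) - sqrt (enn2real (g x)))\<^sup>2 \<partial>density \<nu> (\<lambda>x. ennreal (enn2real (h x))))"
  proof -
    have "density \<nu> h = density \<nu> (\<lambda>x. ennreal (enn2real (h x)))"
      by (rule density_cong) (use h_fin in \<open>auto simp: less_top\<close>)
    then show ?thesis using \<sigma> by simp
  qed
  also have "\<dots> = (\<integral>x. enn2real (h x) * (sqrt (enn2real (f x)) - sqrt (enn2real (g x)))\<^sup>2 \<partial>\<nu>)"
    by (subst integral_density) auto
  also have "\<dots> = (\<integral>x. (sqrt (enn2real (h x * f x)) - sqrt (enn2real (h x * g x)))\<^sup>2 \<partial>\<nu>)"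
  proof (rule Bochner_Integration.integral_cong[OF refl])
    fix x
    have "(sqrt (enn2real (h x)) * (sqrt (enn2real (f x)) - sqrt (enn2real (g x))))\<^sup>2
        = enn2real (h x) * (sqrt (enn2real (f x)) - sqrt (enn2real (g x)))\<^sup>2"
      by (simp add: power_mult_distrib)
    then show "enn2real (h x) * (sqrt (enn2real (f x)) - sqrt (enn2real (g x)))\<^sup>2
        = (sqrt (enn2real (h x * f x)) - sqrt (enn2real (h x * g x)))\<^sup>2"
      by (simp add: enn2real_mult real_sqrt_mult right_diff_distrib)
  qed
  also have "sqrt (1 / 2 * \<dots>)
      = hellinger_wrt \<nu> (density \<nu> (\<lambda>x. h x * f x)) (density \<nu> (\<lambda>x. h x * g x))"
    by (rule hellinger_wrt_density[symmetric]) (auto intro: \<nu>)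
  finally show ?thesis using \<mu>_\<nu> by simp
qed

lemma hellinger_fun_eq:
  assumes "sigma_finite_measure M" "t \<in> L1_plus M" "u \<in> L1_plus M"
  shows "hellinger_fun M t u = sqrt (1 / 2 * (\<integral>x. (sqrt (t x) - sqrt (u x))\<^sup>2 \<partial>M))"
proof -
  have int: "integrable M t" "integrable M u" and
    nn: "AE x in M. 0 \<le> t x" "AE x in M. 0 \<le> u x"
    using assms by (auto simp: L1_plus_def)
  have meas [measurable]: "t \<in> borel_measurable M" "u \<in> borel_measurable M"
    using int by auto
  have fin: "finite_measure (density M (\<lambda>x. ennreal (v x)))" if "integrable M v" for v
  proof (rule finite_measureI)
    have [measurable]: "v \<in> borel_measurable M" using that by auto
    have "(\<integral>\<^sup>+x. ennreal (v x) \<partial>M) \<le> (\<integral>\<^sup>+x. ennreal (norm (v x)) \<partial>M)"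
      by (intro nn_integral_mono ennreal_leI) simp
    also have "\<dots> < \<infinity>" using that by (simp add: integrable_iff_bounded)
    finally show "emeasure (density M (\<lambda>x. ennreal (v x))) (space (density M (\<lambda>x. ennreal (v x)))) \<noteq> \<infinity>"
      by (simp add: emeasure_density cong: nn_integral_cong)
  qed
  have "hellinger_fun M t u = hellinger_wrt M (intensity_measure M t) (intensity_measure M u)"
    unfolding hellinger_fun_def intensity_measure_def
    by (rule hellinger_eq_wrt) (use assms int fin in \<open>auto intro!: absolutely_continuousI_density\<close>)
  also have "\<dots> = sqrt (1 / 2 * (\<integral>x. (sqrt (enn2real (ennreal (t x)))
      - sqrt (enn2real (ennreal (u x))))\<^sup>2 \<partial>M))"
    unfolding intensity_measure_def by (rule hellinger_wrt_density) (use assms in auto)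
  also have "(\<integral>x. (sqrt (enn2real (ennreal (t x))) - sqrt (enn2real (ennreal (u x))))\<^sup>2 \<partial>M)
      = (\<integral>x. (sqrt (t x) - sqrt (u x))\<^sup>2 \<partial>M)"
    by (rule integral_cong_AE) (use nn in auto)
  finally show ?thesis .
qed

section \<open>T-estimators\<close>

text \<open>
  Elements of \<open>L\<^sub>1\<close> are represented by functions. A subset of \<open>L\<^sub>1\<close> is represented by a set that
  contains at most one function from each class, so that cardinalities and distinctness mean what
  they should.
\<close>

definition distinct_classes :: "'a measure \<Rightarrow> ('a \<Rightarrow> real) set \<Rightarrow> bool" where
  "distinct_classes M S \<longleftrightarrow> (\<forall>t\<in>S. \<forall>u\<in>S. (AE x in M. t x = u x) \<longrightarrow> t = u)"

definition D_model :: "'a measure \<Rightarrow> real \<Rightarrow> real \<Rightarrow> real \<Rightarrow> ('a \<Rightarrow> real) set \<Rightarrow> bool" where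
  "D_model M \<eta> D B S \<longleftrightarrow>
     0 < \<eta> \<and> 0 < D \<and> 0 < B \<and> S \<subseteq> L1_plus M \<and> distinct_classes M S \<and>
     (\<forall>x\<ge>2. \<forall>t\<in>L1_plus M.
        finite {u \<in> S. hellinger_fun M t u < x * \<eta>} \<and>
        real (card {u \<in> S. hellinger_fun M t u < x * \<eta>}) \<le> B * exp (D * x\<^sup>2))"

definition model_family ::
  "'a measure \<Rightarrow> nat set \<Rightarrow> (nat \<Rightarrow> ('a \<Rightarrow> real) set) \<Rightarrow> (nat \<Rightarrow> real) \<Rightarrow> bool" where
  "model_family M I Sm \<eta> \<longleftrightarrow>
     (\<exists>D B. \<forall>m\<in>I. D_model M (\<eta> m) (D m) B (Sm m) \<and> 1 / 2 \<le> D m \<and> 84 * D m / 5 \<le> (\<eta> m)\<^sup>2) \<and>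
     (\<lambda>m. exp (- (\<eta> m)\<^sup>2 / 84)) summable_on I \<and>
     distinct_classes M (\<Union>m\<in>I. Sm m)"

definition model_weight ::
  "nat set \<Rightarrow> (nat \<Rightarrow> ('a \<Rightarrow> real) set) \<Rightarrow> (nat \<Rightarrow> real) \<Rightarrow> ('a \<Rightarrow> real) \<Rightarrow> real" where
  "model_weight I Sm \<eta> t = Inf {\<eta> m | m. m \<in> I \<and> t \<in> Sm m}"

text \<open>
  There is one test for each unordered pair, whence the symmetry of \<open>\<psi>\<close>; with it, the second error
  bound is the first one with the roles of \<open>t\<close> and \<open>u\<close> exchanged, and the third one holds in both
  directions.
\<close>

definition test_family ::
  "'a measure \<Rightarrow> ('a \<Rightarrow> real) set \<Rightarrow> (('a \<Rightarrow> real) \<Rightarrow> real) \<Rightarrow>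
   (('a \<Rightarrow> real) \<Rightarrow> ('a \<Rightarrow> real) \<Rightarrow> 'a multiset \<Rightarrow> ('a \<Rightarrow> real)) \<Rightarrow> bool" where
  "test_family M S w \<psi> \<longleftrightarrow>
     (\<forall>t\<in>S. \<forall>u\<in>S. t \<noteq> u \<longrightarrow>
        \<psi> t u = \<psi> u t \<and>
        (\<forall>X\<in>space (config_space M). \<psi> t u X \<in> {t, u}) \<and>
        {X \<in> space (config_space M). \<psi> t u X = u} \<in> sets (config_space M) \<and>
        (\<forall>\<mu>. finite_measure \<mu> \<and> sets \<mu> = sets M \<longrightarrow>
           (hellinger \<mu> (intensity_measure M t) \<le> hellinger_fun M t u / 4 \<longrightarrow>
              measure (poisson_law \<mu>) {X \<in> space (config_space M). \<psi> t u X = u}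
                \<le> exp (- ((hellinger_fun M t u)\<^sup>2 - (w t)\<^sup>2 + (w u)\<^sup>2) / 4)) \<and>
           (hellinger \<mu> (intensity_measure M u) \<le> hellinger_fun M t u / 4 \<longrightarrow>
              measure (poisson_law \<mu>) {X \<in> space (config_space M). \<psi> t u X = t}
                \<le> exp (- ((hellinger_fun M t u)\<^sup>2 - (w u)\<^sup>2 + (w t)\<^sup>2) / 4)) \<and>
           measure (poisson_law \<mu>) {X \<in> space (config_space M). \<psi> t u X = u}
             \<le> exp ((16 * (hellinger \<mu> (intensity_measure M t))\<^sup>2 + (w t)\<^sup>2 - (w u)\<^sup>2) / 4)))"

definition test_crit ::
  "'a measure \<Rightarrow> ('a \<Rightarrow> real) set \<Rightarrow>
   (('a \<Rightarrow> real) \<Rightarrow> ('a \<Rightarrow> real) \<Rightarrow> 'a multiset \<Rightarrow> ('a \<Rightarrow> real)) \<Rightarrow>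
   'a multiset \<Rightarrow> ('a \<Rightarrow> real) \<Rightarrow> ennreal" where
  "test_crit M S \<psi> X t = Sup {ennreal (hellinger_fun M t u) | u. u \<in> S \<and> u \<noteq> t \<and> \<psi> t u X = u}"

text \<open>
  The set \<open>S\<close> is countable and represents distinct classes, so measurability for its discrete
  \<open>\<sigma>\<close>-algebra is measurability for the Borel sets of \<open>(S, H)\<close>.
\<close>

definition T_estimator :: "'a measure \<Rightarrow> ('a multiset \<Rightarrow> ('a \<Rightarrow> real)) \<Rightarrow> bool" where
  "T_estimator M est \<longleftrightarrow>
     (\<exists>I Sm \<eta> S \<psi>.
        model_family M I Sm \<eta> \<and> S = (\<Union>m\<in>I. Sm m) \<and>
        test_family M S (model_weight I Sm \<eta>) \<psi> \<and>
        est \<in> measurable (config_space M) (count_space S) \<and>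
        (\<forall>X\<in>space (config_space M). \<forall>t\<in>S. test_crit M S \<psi> X (est X) \<le> test_crit M S \<psi> X t))"

section \<open>Besov spaces on the unit cube\<close>

definition cube_measure :: "(real ^ 'n) measure" where
  "cube_measure = restrict_space lborel (cbox 0 1)"

definition square_integrable :: "(real ^ 'n \<Rightarrow> real) \<Rightarrow> bool" where
  "square_integrable f \<longleftrightarrow>
     f \<in> borel_measurable cube_measure \<and> integrable cube_measure (\<lambda>x. (f x)\<^sup>2)"

definition finite_difference :: "nat \<Rightarrow> real ^ 'n \<Rightarrow> (real ^ 'n \<Rightarrow> real) \<Rightarrow> real ^ 'n \<Rightarrow> real" where
  "finite_difference r h f x = (\<Sum>i\<le>r. (-1) ^ (r - i) * real (r choose i) * f (x + real i *\<^sub>R h))"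

text \<open>
  The Besov space is defined intrinsically, for \<open>0 < p < \<infinity>\<close>, by \<open>\<omega>\<^sub>r(f, \<delta>)\<^sub>p = O(\<delta>\<^sup>\<alpha>)\<close> with
  \<open>r = \<lfloor>\<alpha>\<rfloor> + 1\<close>; \<open>modulus_powr\<close> is the \<open>p\<close>-th power of the modulus of smoothness \<open>\<omega>\<^sub>r(f, \<delta>)\<^sub>p\<close>.
\<close>

definition modulus_powr :: "nat \<Rightarrow> real \<Rightarrow> (real ^ 'n \<Rightarrow> real) \<Rightarrow> real \<Rightarrow> ennreal" where
  "modulus_powr r p f \<delta> =
     (SUP h\<in>cball 0 \<delta>. \<integral>\<^sup>+x\<in>{x. x + real r *\<^sub>R h \<in> cbox 0 1}.
        ennreal (\<bar>finite_difference r h f x\<bar> powr p) \<partial>cube_measure)"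

definition besov_space :: "real \<Rightarrow> real \<Rightarrow> (real ^ 'n \<Rightarrow> real) set" where
  "besov_space \<alpha> p =
     {f \<in> borel_measurable cube_measure.
        integrable cube_measure (\<lambda>x. \<bar>f x\<bar> powr p) \<and>
        (\<exists>K::real. \<forall>\<delta>>0. modulus_powr (nat \<lfloor>\<alpha>\<rfloor> + 1) p f \<delta> \<le> ennreal (K * \<delta> powr (\<alpha> * p)))}"

definition coeff :: "(int \<Rightarrow> 'k \<Rightarrow> real ^ 'n \<Rightarrow> real) \<Rightarrow> (real ^ 'n \<Rightarrow> real) \<Rightarrow> int \<Rightarrow> 'k \<Rightarrow> real" where
  "coeff \<phi> f j k = (\<integral>x. f x * \<phi> j k x \<partial>cube_measure)"

text \<open>
  Orthonormal bases of \<open>L\<^sub>2([0,1]\<^sup>l)\<close> with the index structure of a wavelet basis. The regularity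
  enters only through \<open>characterizes_besov\<close> below. As a basis may be suitable only up to some
  smoothness, an estimator that adapts to every \<open>\<alpha>\<close> needs a sequence of bases, the one of index
  \<open>\<lfloor>\<alpha>\<rfloor>\<close> being used for smoothness \<open>\<alpha>\<close>; a constant sequence is allowed.
\<close>

definition wavelet_basis ::
  "real \<Rightarrow> (int \<Rightarrow> 'k set) \<Rightarrow> (int \<Rightarrow> 'k \<Rightarrow> real ^ 'n \<Rightarrow> real) \<Rightarrow> bool" where
  "wavelet_basis \<Gamma> \<Lambda> \<phi> \<longleftrightarrow>
     (\<forall>j\<ge>-1. finite (\<Lambda> j)) \<and>
     real (card (\<Lambda> (-1))) \<le> \<Gamma> \<and>
     (\<forall>j::nat. 2 ^ (j * CARD('n)) \<le> real (card (\<Lambda> (int j))) \<and>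
               real (card (\<Lambda> (int j))) \<le> \<Gamma> * 2 ^ (j * CARD('n))) \<and>
     (\<forall>j\<ge>-1. \<forall>k\<in>\<Lambda> j. square_integrable (\<phi> j k)) \<and>
     (\<forall>j\<ge>-1. \<forall>k\<in>\<Lambda> j. \<forall>j'\<ge>-1. \<forall>k'\<in>\<Lambda> j'.
        (\<integral>x. \<phi> j k x * \<phi> j' k' x \<partial>cube_measure) = (if j = j' \<and> k = k' then 1 else 0)) \<and>
     (\<forall>f. square_integrable f \<longrightarrow>
        (\<lambda>J::nat. \<integral>x. (f x - (\<Sum>j\<in>{-1..int J}. \<Sum>k\<in>\<Lambda> j. coeff \<phi> f j k * \<phi> j k x))\<^sup>2 \<partial>cube_measure)
          \<longlonglongrightarrow> 0)"

definition besov_seminorm ::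
  "(int \<Rightarrow> 'k set) \<Rightarrow> (int \<Rightarrow> 'k \<Rightarrow> real ^ 'n \<Rightarrow> real) \<Rightarrow> real \<Rightarrow> real \<Rightarrow> (real ^ 'n \<Rightarrow> real) \<Rightarrow> ennreal"
where
  "besov_seminorm \<Lambda> \<phi> \<alpha> p f =
     (SUP j::nat. ennreal (2 powr (real j * (\<alpha> + real CARD('n) / 2 - real CARD('n) / p)) *
                           (\<Sum>k\<in>\<Lambda> (int j). \<bar>coeff \<phi> f (int j) k\<bar> powr p) powr (1 / p)))"

definition characterizes_besov ::
  "(int \<Rightarrow> 'k set) \<Rightarrow> (int \<Rightarrow> 'k \<Rightarrow> real ^ 'n \<Rightarrow> real) \<Rightarrow> real \<Rightarrow> real \<Rightarrow> bool" where
  "characterizes_besov \<Lambda> \<phi> \<alpha> p \<longleftrightarrow>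
     (\<forall>f. square_integrable f \<longrightarrow> (f \<in> besov_space \<alpha> p \<longleftrightarrow> besov_seminorm \<Lambda> \<phi> \<alpha> p f < \<infinity>))"

end

theory Submission
  imports Defs
begin

text \<open>
  On square roots of intensities the Hellinger distance is a multiple of the \<open>L\<^sub>2\<close> distance, and the
  Laplace functional of a Poisson process turns the test of the likelihood ratio of two points of the
  segment from \<open>\<surd>t\<close> to \<open>\<surd>u\<close>, at one quarter and at three quarters of its length, into
  the required robust test. If \<open>t\<close> is an element of \<open>S\<close> close to \<open>s\<close>, the distance
  from \<open>t\<close> to the estimator is at most the criterion at \<open>t\<close>, which is bounded by summing
  the errors of the tests of \<open>t\<close> against all far elements of \<open>S\<close>.

  The models are made of the functions \<open>12 \<Sum> n\<^sub>i \<phi>\<^sub>i\<close> with integers \<open>n\<^sub>i\<close>: all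
  indices up to level \<open>J\<close> are allowed for free, and a nonzero coefficient at level \<open>j > J\<close> costs
  \<open>(l + 1) (j - J)\<close>, the total cost being at most \<open>2\<^sup>J\<^sup>l\<close>. The cost outweighs the number
  of indices at level \<open>j\<close>, so that the metric dimension is of order \<open>2\<^sup>J\<^sup>l\<close>. With
  \<open>q = min p 2\<close> and \<open>\<kappa> = q (\<alpha> + l / 2) - l > 0\<close>, the Besov condition bounds
  \<open>\<Sum>\<^sub>k |\<beta>\<^sub>j\<^sub>,\<^sub>k|\<^sup>q\<close> by \<open>2\<^sup>J\<^sup>l 2\<^bsup>- (j - J) \<kappa>\<^esup>\<close> up to a constant as soon as
  \<open>2\<^sup>J\<^sup>l\<close> is of order \<open>R\<^bsup>2 l / (2 \<alpha> + l)\<^esup>\<close>; rounding the coefficients to the lattice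
  then gives an error and a cost of order \<open>2\<^sup>J\<^sup>l\<close>, without logarithmic loss because the
  threshold is the same at all levels.
\<close>

section \<open>The Laplace functional of a Poisson process\<close>

text \<open>Moving in from both ends of the segment keeps the ratio of the two roots between 1/3 and
  3 everywhere, even where \<open>t\<close> or \<open>u\<close> vanishes. So exponential moments
  exist for every finite mean measure, and one error bound, \<open>lr_test_error\<close>, implies
  the three bounds of \<open>test_family\<close>. Moreover a given configuration bounds the
  statistics of all pairs at once. This overcomes an obstacle of infinite \<open>S\<close>: a
  minimizer must exist for every configuration. The thresholds grow with weight and integral, so
  only finitely many points can beat a given one.

  Lattice functions may be negative and are then not roots of intensities. Passing to positive parts
  could bring many of them into one small ball, so those with a large negative part are discarded.

  The constants 84 and 5 of a model family fix the others: the mesh 12 lets the entropy of a ball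
  fit into \<open>5 / 84 * x\<^sup>2 * \<eta>\<^sup>2\<close>, and the error exponent is shared out
  in units of 1/84. Since the basis varies with the smoothness, the models of all bases are used
  together; radii growing with the index of the basis keep the sum over models below an absolute
  constant.\<close>

lemma space_config_space_iff: "X \<in> space (config_space M) \<longleftrightarrow> set_mset X \<subseteq> space M"
  by (simp add: space_config_space)

lemma config_space_cong:
  assumes "sets N = sets M"
  shows "config_space N = config_space M"
  unfolding config_space_def using assms sets_eq_imp_space_eq[OF assms] by simp

lemma sets_poisson_law:
  "sets (poisson_law \<mu>) = sets (config_space \<mu>)"
  by (simp add: poisson_law_def)

lemma measurable_size_filter [measurable]:
  assumes "B \<in> sets M"
  shows "(\<lambda>X. size (filter_mset (\<lambda>x. x \<in> B) X)) \<in> measurable (config_space M) (count_space UNIV)"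
proof (rule measurableI)
  fix A :: "nat set"
  have "(\<lambda>X. size (filter_mset (\<lambda>x. x \<in> B) X)) -` A \<inter> space (config_space M) =
    (\<Union>k\<in>A. {X. set_mset X \<subseteq> space M \<and> size (filter_mset (\<lambda>x. x \<in> B) X) = k})"
    by (auto simp: space_config_space)
  also have "\<dots> \<in> sets (config_space M)"
  proof (rule sets.countable_UN'')
    fix k
    show "{X. set_mset X \<subseteq> space M \<and> size (filter_mset (\<lambda>x. x \<in> B) X) = k} \<in> sets (config_space M)"
      unfolding config_space_def using assms
      by (subst sets_measure_of[OF config_space_generators]) (auto intro: sigma_sets.Basic)
  qed simp
  finally show "(\<lambda>X. size (filter_mset (\<lambda>x. x \<in> B) X)) -` A \<inter> space (config_space M)
    \<in> sets (config_space M)" .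
qed simp

text \<open>For indicators the sum is a number of points, measurable by the choice of the
  \<sigma>-algebra; monotone approximation does the rest.\<close>

lemma borel_measurable_sum_mset_nonneg:
  fixes f :: "'a \<Rightarrow> real"
  assumes "f \<in> borel_measurable M" "\<And>x. 0 \<le> f x"
  shows "(\<lambda>X. \<Sum>x\<in>#X. f x) \<in> borel_measurable (config_space M)"
  using assms
proof (induction rule: borel_measurable_induct_real)
  case (set A)
  have "(\<Sum>x\<in>#X. indicator A x) = real (size (filter_mset (\<lambda>x. x \<in> A) X))" for X
    by (induction X) (auto simp: indicator_def)
  then show ?case using set by simp
next
  case (mult u c)
  then show ?case by (simp add: sum_mset_distrib_left[symmetric])
next
  case (add u v)
  then show ?case by (simp add: sum_mset.distrib)
next
  case (seq U)
  show ?case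
  proof (rule borel_measurable_LIMSEQ_real)
    show "(\<lambda>X. \<Sum>x\<in>#X. U i x) \<in> borel_measurable (config_space M)" for i by (rule seq.IH)
    fix X assume "X \<in> space (config_space M)"
    then have "\<forall>x\<in>#X. (\<lambda>i. U i x) \<longlonglongrightarrow> f x"
      using seq by (auto simp: space_config_space_iff)
    then show "(\<lambda>i. \<Sum>x\<in>#X. U i x) \<longlonglongrightarrow> (\<Sum>x\<in>#X. f x)"
      by (induction X) (auto intro!: tendsto_intros)
  qed
qed

lemma borel_measurable_sum_mset:
  fixes f :: "'a \<Rightarrow> real"
  assumes [measurable]: "f \<in> borel_measurable M"
  shows "(\<lambda>X. \<Sum>x\<in>#X. f x) \<in> borel_measurable (config_space M)"
proof -
  have "(\<Sum>x\<in>#X. f x) = (\<Sum>x\<in>#X. max 0 (f x)) - (\<Sum>x\<in>#X. max 0 (- f x))" for X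
    by (induction X) auto
  then show ?thesis
    by (simp, intro borel_measurable_diff borel_measurable_sum_mset_nonneg) auto
qed

text \<open>Only the first \<open>n\<close> coordinates enter, so the infinite product may be
  replaced by its marginal on \<open>{..<n}\<close>, where Fubini's theorem for finite products
  applies.\<close>

lemma nn_integral_PiM_prod:
  assumes N: "prob_space N" and g: "g \<in> borel_measurable N"
  shows "(\<integral>\<^sup>+x. (\<Prod>i<n. g (x i)) \<partial>(\<Pi>\<^sub>M i\<in>(UNIV :: nat set). N)) = (\<integral>\<^sup>+x. g x \<partial>N) ^ n"
proof -
  interpret N: prob_space N by fact
  interpret P: product_prob_space "\<lambda>_. N" "UNIV :: nat set" by standard
  have "(\<integral>\<^sup>+x. (\<Prod>i<n. g (x i)) \<partial>(\<Pi>\<^sub>M i\<in>(UNIV :: nat set). N))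
      = (\<integral>\<^sup>+x. (\<Prod>i<n. g (restrict x {..<n} i)) \<partial>(\<Pi>\<^sub>M i\<in>(UNIV :: nat set). N))"
    by (intro nn_integral_cong prod.cong) auto
  also have "\<dots> = (\<integral>\<^sup>+x. (\<Prod>i<n. g (x i)) \<partial>distr (\<Pi>\<^sub>M i\<in>(UNIV :: nat set). N)
      (\<Pi>\<^sub>M i\<in>{..<n}. N) (\<lambda>x. restrict x {..<n}))"
    using g by (subst nn_integral_distr) (auto intro!: measurable_restrict_subset)
  also have "distr (\<Pi>\<^sub>M i\<in>(UNIV :: nat set). N) (\<Pi>\<^sub>M i\<in>{..<n}. N) (\<lambda>x. restrict x {..<n})
      = (\<Pi>\<^sub>M i\<in>{..<n}. N)"
    by (rule P.distr_PiM_restrict_finite) auto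
  also have "(\<integral>\<^sup>+x. (\<Prod>i<n. g (x i)) \<partial>(\<Pi>\<^sub>M i\<in>{..<n}. N)) = (\<Prod>i<n. \<integral>\<^sup>+x. g x \<partial>N)"
    using g by (intro P.product_nn_integral_prod) auto
  finally show ?thesis by simp
qed

text \<open>The probability generating function of the Poisson distribution.\<close>

lemma nn_integral_poisson_power:
  assumes "0 < l" "0 \<le> c"
  shows "(\<integral>\<^sup>+n. ennreal c ^ n \<partial>measure_pmf (poisson_pmf l)) = ennreal (exp (l * c - l))"
proof -
  have s: "(\<lambda>n. (l * c) ^ n / fact n * exp (- l)) sums (exp (l * c) * exp (- l))"
    using exp_converges[of "l * c"] by (intro sums_mult2) (simp add: scaleR_conv_of_real divide_inverse mult.commute)
  have "(\<integral>\<^sup>+n. ennreal c ^ n \<partial>measure_pmf (poisson_pmf l))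
      = (\<Sum>n. ennreal (pmf (poisson_pmf l) n) * ennreal c ^ n)"
    by (simp add: nn_integral_measure_pmf nn_integral_count_space_nat)
  also have "\<dots> = (\<Sum>n. ennreal ((l * c) ^ n / fact n * exp (- l)))"
    using assms by (intro suminf_cong)
      (simp add: ennreal_power ennreal_mult[symmetric] power_mult_distrib field_simps)
  also have "\<dots> = ennreal (exp (l * c) * exp (- l))"
    using s assms by (intro suminf_ennreal_eq) auto
  finally show ?thesis by (simp add: exp_add[symmetric])
qed

text \<open>Given the number of points, the integrand is a product of independent factors with the
  same mean, so its integral is a power; the generating function of the Poisson distribution then
  sums over the number of points.\<close>

lemma poisson_law_exp_sum:
  fixes f :: "'a \<Rightarrow> real"
  assumes "finite_measure \<mu>" and [measurable]: "f \<in> borel_measurable \<mu>"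
    and int: "integrable \<mu> (\<lambda>x. exp (f x))"
  shows "(\<integral>\<^sup>+X. ennreal (exp (\<Sum>x\<in>#X. f x)) \<partial>poisson_law \<mu>) = ennreal (exp (\<integral>x. exp (f x) - 1 \<partial>\<mu>))"
proof -
  interpret finite_measure \<mu> by fact
  have m: "(\<lambda>X. ennreal (exp (\<Sum>x\<in>#X. f x))) \<in> borel_measurable (config_space \<mu>)"
    using borel_measurable_sum_mset[OF assms(2)] by measurable
  have I: "(\<integral>x. exp (f x) - 1 \<partial>\<mu>) = (\<integral>x. exp (f x) \<partial>\<mu>) - measure \<mu> (space \<mu>)"
    using int by (subst Bochner_Integration.integral_diff) auto
  show ?thesis
  proof (cases "measure \<mu> (space \<mu>) = 0")
    case True
    then have "space \<mu> \<in> null_sets \<mu>" by (auto simp: emeasure_eq_measure)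
    then have "AE x in \<mu>. exp (f x) - 1 = 0" by (rule AE_I') auto
    then have "(\<integral>x. exp (f x) - 1 \<partial>\<mu>) = 0" by (rule integral_eq_zero_AE)
    moreover have "(\<integral>\<^sup>+X. ennreal (exp (\<Sum>x\<in>#X. f x)) \<partial>poisson_law \<mu>) = 1"
      using True m by (simp add: poisson_law_def nn_integral_return space_config_space)
    ultimately show ?thesis by simp
  next
    case False
    define l where "l = measure \<mu> (space \<mu>)"
    have l: "0 < l" using False by (simp add: l_def less_le)
    define N where "N = scale_measure (1 / emeasure \<mu> (space \<mu>)) \<mu>"
    have em: "emeasure \<mu> (space \<mu>) = ennreal l" by (simp add: l_def emeasure_eq_measure)
    then have inv: "1 / emeasure \<mu> (space \<mu>) = ennreal (1 / l)"
      using l by (simp add: divide_ennreal ennreal_1[symmetric] del: ennreal_1)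
    have N: "prob_space N"
      using l by (intro prob_spaceI) (simp add: N_def space_scale_measure em inv[unfolded em] ennreal_mult[symmetric])
    have sN: "sets N = sets \<mu>" by (simp add: N_def)
    let ?p = "measure_pmf (poisson_pmf l)"
    let ?Q = "\<Pi>\<^sub>M i\<in>(UNIV :: nat set). N"
    interpret Q: prob_space ?Q using N by (intro prob_space_PiM)
    have fN [measurable]: "f \<in> borel_measurable N" using sN by simp
    have "(\<integral>\<^sup>+X. ennreal (exp (\<Sum>x\<in>#X. f x)) \<partial>poisson_law \<mu>)
       = (\<integral>\<^sup>+z. ennreal (exp (\<Sum>x\<in>#(case z of (n, x) \<Rightarrow> image_mset x (mset_set {..<n})). f x)) \<partial>(?p \<Otimes>\<^sub>M ?Q))"
      using False unfolding poisson_law_def N_def[symmetric] l_def[symmetric]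
      using m measurable_poisson_construction[OF sN]
      by (simp, subst nn_integral_distr) auto
    also have "\<dots> = (\<integral>\<^sup>+z. ennreal (exp (\<Sum>i<fst z. f (snd z i))) \<partial>(?p \<Otimes>\<^sub>M ?Q))"
      by (simp add: case_prod_beta sum_unfold_sum_mset multiset.map_comp comp_def)
    also have "\<dots> = (\<integral>\<^sup>+n. \<integral>\<^sup>+x. ennreal (exp (\<Sum>i<n. f (x i))) \<partial>?Q \<partial>?p)"
    proof (subst Q.nn_integral_fst[symmetric])
      have "(\<lambda>z. ennreal (exp (\<Sum>x\<in>#(case z of (n, x) \<Rightarrow> image_mset x (mset_set {..<n})). f x)))
          \<in> borel_measurable (?p \<Otimes>\<^sub>M ?Q)"
        by (rule measurable_compose[OF measurable_poisson_construction[OF sN] m])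
      then show "(\<lambda>z. ennreal (exp (\<Sum>i<fst z. f (snd z i)))) \<in> borel_measurable (?p \<Otimes>\<^sub>M ?Q)"
        by (simp add: case_prod_beta sum_unfold_sum_mset multiset.map_comp comp_def)
    qed simp
    also have "\<dots> = (\<integral>\<^sup>+n. (\<integral>\<^sup>+x. ennreal (exp (f x)) \<partial>N) ^ n \<partial>?p)"
      by (intro nn_integral_cong, subst nn_integral_PiM_prod[OF N, symmetric])
         (simp_all add: exp_sum prod_ennreal)
    also have "(\<integral>\<^sup>+x. ennreal (exp (f x)) \<partial>N) = ennreal ((\<integral>x. exp (f x) \<partial>\<mu>) / l)"
    proof -
      have "(\<integral>\<^sup>+x. ennreal (exp (f x)) \<partial>N) = ennreal (1 / l) * (\<integral>\<^sup>+x. ennreal (exp (f x)) \<partial>\<mu>)"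
        unfolding N_def inv by (subst nn_integral_scale_measure) auto
      also have "(\<integral>\<^sup>+x. ennreal (exp (f x)) \<partial>\<mu>) = ennreal (\<integral>x. exp (f x) \<partial>\<mu>)"
        using int by (intro nn_integral_eq_integral) auto
      finally show ?thesis using l by (simp add: ennreal_mult[symmetric])
    qed
    also have "(\<integral>\<^sup>+n. ennreal ((\<integral>x. exp (f x) \<partial>\<mu>) / l) ^ n \<partial>?p)
        = ennreal (exp (l * ((\<integral>x. exp (f x) \<partial>\<mu>) / l) - l))"
      using l by (intro nn_integral_poisson_power) auto
    finally show ?thesis using l unfolding I l_def[symmetric] by simp
  qed
qed

section \<open>Robust tests\<close>

text \<open>Elements of \<open>L1_plus\<close> are nonnegative only almost everywhere, and
  \<open>sqrt\<close> of a negative number is negative. The truncation makes pointwise bounds such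
  as \<open>lr_ratio_bounds\<close> hold without exceptional set.\<close>

definition pos_root :: "('a \<Rightarrow> real) \<Rightarrow> 'a \<Rightarrow> real" where
  "pos_root t x = sqrt (max (t x) 0)"

lemma pos_root_nonneg [simp]: "0 \<le> pos_root t x"
  by (simp add: pos_root_def)

lemma borel_measurable_pos_root [measurable]:
  assumes [measurable]: "t \<in> borel_measurable M"
  shows "pos_root t \<in> borel_measurable M"
  unfolding pos_root_def by measurable

lemma pos_root_power2: "(pos_root t x)\<^sup>2 = max (t x) 0"
  by (simp add: pos_root_def)

lemma L1_plusD:
  assumes "t \<in> L1_plus M"
  shows "integrable M t" "t \<in> borel_measurable M" "AE x in M. 0 \<le> t x"
  using assms by (auto simp: L1_plus_def)

lemma pos_root_power2_AE:
  assumes "t \<in> L1_plus M"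
  shows "AE x in M. (pos_root t x)\<^sup>2 = t x"
  using L1_plusD(3)[OF assms] by eventually_elim (simp add: pos_root_power2)

lemma integrable_pos_root_power2:
  assumes "t \<in> L1_plus M"
  shows "integrable M (\<lambda>x. (pos_root t x)\<^sup>2)"
proof -
  note [measurable] = L1_plusD(2)[OF assms]
  show ?thesis
    by (rule integrable_cong_AE_imp[OF L1_plusD(1)[OF assms]])
       (use pos_root_power2_AE[OF assms] in \<open>auto simp: eq_commute\<close>)
qed

lemma integral_pos_root_power2:
  assumes "t \<in> L1_plus M"
  shows "(\<integral>x. (pos_root t x)\<^sup>2 \<partial>M) = (\<integral>x. t x \<partial>M)"
proof -
  note [measurable] = L1_plusD(2)[OF assms]
  show ?thesis by (rule integral_cong_AE) (use pos_root_power2_AE[OF assms] in auto)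
qed

lemma hellinger_fun_power2:
  assumes "sigma_finite_measure M" "t \<in> L1_plus M" "u \<in> L1_plus M"
  shows "(hellinger_fun M t u)\<^sup>2 = (\<integral>x. (pos_root t x - pos_root u x)\<^sup>2 \<partial>M) / 2"
proof -
  note [measurable] = L1_plusD(2)[OF assms(2)] L1_plusD(2)[OF assms(3)]
  have "(\<integral>x. (sqrt (t x) - sqrt (u x))\<^sup>2 \<partial>M) = (\<integral>x. (pos_root t x - pos_root u x)\<^sup>2 \<partial>M)"
  proof (rule integral_cong_AE)
    show "AE x in M. (sqrt (t x) - sqrt (u x))\<^sup>2 = (pos_root t x - pos_root u x)\<^sup>2"
      using L1_plusD(3)[OF assms(2)] L1_plusD(3)[OF assms(3)]
      by eventually_elim (simp add: pos_root_def)
  qed auto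
  then show ?thesis by (simp add: hellinger_fun_eq[OF assms])
qed

lemma hellinger_fun_nonneg [simp]: "0 \<le> hellinger_fun M t u"
  by (simp add: hellinger_fun_def hellinger_def hellinger_wrt_def)

lemma hellinger_fun_commute:
  assumes "sigma_finite_measure M" "t \<in> L1_plus M" "u \<in> L1_plus M"
  shows "hellinger_fun M t u = hellinger_fun M u t"
proof (rule power2_eq_imp_eq)
  show "(hellinger_fun M t u)\<^sup>2 = (hellinger_fun M u t)\<^sup>2"
    by (simp only: hellinger_fun_power2[OF assms] hellinger_fun_power2[OF assms(1,3,2)]
        power2_commute[of "pos_root t _"])
qed simp_all

lemma finite_measure_intensity_measure:
  assumes "t \<in> L1_plus M"
  shows "finite_measure (intensity_measure M t)"
proof (rule finite_measureI)
  note [measurable] = L1_plusD(2)[OF assms]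
  have "(\<integral>\<^sup>+x. ennreal (t x) \<partial>M) = ennreal (\<integral>x. t x \<partial>M)"
    using L1_plusD[OF assms] by (intro nn_integral_eq_integral) auto
  then have "(\<integral>\<^sup>+x. ennreal (t x) * indicator (space M) x \<partial>M) = ennreal (\<integral>x. t x \<partial>M)"
    by (simp cong: nn_integral_cong)
  then show "emeasure (intensity_measure M t) (space (intensity_measure M t)) \<noteq> \<infinity>"
    by (simp add: intensity_measure_def emeasure_density)
qed

lemma sets_intensity_measure [simp]: "sets (intensity_measure M t) = sets M"
  by (simp add: intensity_measure_def)

text \<open>The ratio of the points \<open>(a + 3 b) / 4\<close> and \<open>(3 a + b) / 4\<close> of the segment from \<open>a\<close> to \<open>b\<close>.\<close>

definition test_ratio :: "real \<Rightarrow> real \<Rightarrow> real" where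
  "test_ratio a b = (if a + b = 0 then 1 else (a + 3 * b) / (3 * a + b))"

lemma test_ratio_bounds:
  assumes "0 \<le> a" "0 \<le> b"
  shows "1 / 3 \<le> test_ratio a b" "test_ratio a b \<le> 3" "0 < test_ratio a b"
proof -
  show "test_ratio a b \<le> 3" using assms by (auto simp: test_ratio_def divide_simps)
  show *: "1 / 3 \<le> test_ratio a b" using assms by (auto simp: test_ratio_def divide_simps)
  show "0 < test_ratio a b" using * by linarith
qed

text \<open>Makes \<open>lr_stat\<close> antisymmetric; the default value 1 is its own
  inverse.\<close>

lemma test_ratio_swap:
  assumes "0 \<le> a" "0 \<le> b"
  shows "test_ratio b a = inverse (test_ratio a b)"
  using assms by (auto simp: test_ratio_def add.commute)

text \<open>The difference of the two sides is \<open>(3 - test_ratio a b) (q - \<rho> (3 a + b) / 4)\<^sup>2\<close>.\<close>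

lemma test_ratio_pointwise:
  assumes "0 \<le> a" "0 \<le> b"
  shows "(test_ratio a b - 1) * q\<^sup>2 - \<rho>\<^sup>2 * (b\<^sup>2 - a\<^sup>2) / 4 \<le> 2 * (q - \<rho> * a)\<^sup>2 - \<rho>\<^sup>2 * (b - a)\<^sup>2 / 4"
proof (cases "a + b = 0")
  case True
  then have "a = 0" "b = 0" using assms by auto
  then show ?thesis by (simp add: test_ratio_def)
next
  case False
  then have p: "3 * a + b \<noteq> 0" using assms by auto
  define g where "g = test_ratio a b"
  have g: "g * (3 * a + b) = a + 3 * b" using p False by (simp add: g_def test_ratio_def)
  \<comment> \<open>The last summand is the defining relation of \<open>g\<close> times a
    polynomial. It vanishes by \<open>g\<close>, and with it the identity is polynomial and needs no
    division.\<close>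
  have "2 * (q - \<rho> * a)\<^sup>2 - \<rho>\<^sup>2 * (b - a)\<^sup>2 / 4 - ((g - 1) * q\<^sup>2 - \<rho>\<^sup>2 * (b\<^sup>2 - a\<^sup>2) / 4)
      = (3 - g) * (q - \<rho> * (3 * a + b) / 4)\<^sup>2
        + (g * (3 * a + b) - (a + 3 * b)) * (\<rho>\<^sup>2 * (3 * a + b) / 16 - \<rho> * q / 2)"
    by (simp add: power2_eq_square field_simps)
  also have "\<dots> = (3 - g) * (q - \<rho> * (3 * a + b) / 4)\<^sup>2" by (simp add: g)
  also have "\<dots> \<ge> 0" using test_ratio_bounds(2)[OF assms] by (simp add: g_def)
  finally show ?thesis by (simp add: g_def)
qed

definition lr_ratio :: "('a \<Rightarrow> real) \<Rightarrow> ('a \<Rightarrow> real) \<Rightarrow> 'a \<Rightarrow> real" where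
  "lr_ratio t u x = test_ratio (pos_root t x) (pos_root u x)"

lemma lr_ratio_bounds: "1 / 3 \<le> lr_ratio t u x" "lr_ratio t u x \<le> 3" "0 < lr_ratio t u x"
  unfolding lr_ratio_def by (rule test_ratio_bounds; simp)+

lemma borel_measurable_lr_ratio [measurable]:
  assumes [measurable]: "t \<in> borel_measurable M" "u \<in> borel_measurable M"
  shows "lr_ratio t u \<in> borel_measurable M"
  unfolding lr_ratio_def test_ratio_def by measurable

section \<open>Exponential moment of the likelihood ratio under any finite mean measure\<close>

lemma ex_real_density:
  assumes "sigma_finite_measure \<nu>" "finite_measure \<mu>" "absolutely_continuous \<nu> \<mu>" "sets \<mu> = sets \<nu>"
  obtains k where "k \<in> borel_measurable \<nu>" "\<And>x. 0 \<le> k x" "\<mu> = density \<nu> (\<lambda>x. ennreal (k x))"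
proof -
  interpret \<nu>: sigma_finite_measure \<nu> by fact
  obtain k where k: "k \<in> borel_measurable \<nu>" "AE x in \<nu>. RN_deriv \<nu> \<mu> x = ennreal (k x)" "\<And>x. 0 \<le> k x"
    using \<nu>.real_RN_deriv[OF assms(2-4)] by metis
  note [measurable] = k(1)
  have "\<mu> = density \<nu> (RN_deriv \<nu> \<mu>)"
    using \<nu>.density_RN_deriv[OF assms(3,4)] by simp
  also have "\<dots> = density \<nu> (\<lambda>x. ennreal (k x))"
    using k(2) by (intro density_cong) auto
  finally show ?thesis using that k by blast
qed

lemma integrable_square_diff:
  fixes f g :: "'a \<Rightarrow> real"
  assumes [measurable]: "f \<in> borel_measurable M" "g \<in> borel_measurable M"
    and "integrable M (\<lambda>x. (f x)\<^sup>2)" "integrable M (\<lambda>x. (g x)\<^sup>2)"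
  shows "integrable M (\<lambda>x. (f x - g x)\<^sup>2)"
proof (rule Bochner_Integration.integrable_bound)
  show "integrable M (\<lambda>x. 2 * (f x)\<^sup>2 + 2 * (g x)\<^sup>2)" using assms by auto
  have "(a - b)\<^sup>2 \<le> 2 * a\<^sup>2 + 2 * b\<^sup>2" for a b :: real
    using zero_le_power2[of "a + b"] by (simp add: power2_eq_square algebra_simps)
  then show "AE x in M. norm ((f x - g x)\<^sup>2) \<le> norm (2 * (f x)\<^sup>2 + 2 * (g x)\<^sup>2)"
    by (intro AE_I2) simp
qed simp

text \<open>By the Laplace functional the left side is the logarithm of the exponential moment of
  \<open>lr_stat\<close>; the bound is \<open>test_ratio_pointwise\<close> integrated.\<close>

lemma integral_lr_ratio_le:
  assumes M: "finite_measure M" and t: "t \<in> L1_plus M" and u: "u \<in> L1_plus M"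
    and \<mu>: "finite_measure \<mu>" "sets \<mu> = sets M"
  shows "(\<integral>x. lr_ratio t u x - 1 \<partial>\<mu>) \<le>
    4 * (hellinger \<mu> (intensity_measure M t))\<^sup>2 - (hellinger_fun M t u)\<^sup>2 / 2
      + ((\<integral>x. u x \<partial>M) - (\<integral>x. t x \<partial>M)) / 4"
proof -
  interpret M: finite_measure M by fact
  interpret \<mu>: finite_measure \<mu> by fact
  \<comment> \<open>As \<open>\<mu>\<close> may be singular to \<open>M\<close>, both are written as
    densities with respect to their sum. The roots of these densities, \<open>sqrt (k x)\<close> and
    \<open>sqrt (h x)\<close>, are the \<open>q\<close> and \<open>\<rho>\<close> of
    \<open>test_ratio_pointwise\<close>.\<close>
  define \<nu> where "\<nu> = sum_measure \<mu> M"
  have s\<nu>: "sets \<nu> = sets M" by (simp add: \<nu>_def \<mu>)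
  have em: "emeasure \<nu> A = emeasure \<mu> A + emeasure M A" if "A \<in> sets M" for A
    using that \<mu> by (simp add: \<nu>_def emeasure_sum_measure)
  interpret \<nu>: finite_measure \<nu>
  proof (rule finite_measureI)
    show "emeasure \<nu> (space \<nu>) \<noteq> \<infinity>"
      using em[of "space M"] M.emeasure_finite \<mu>.emeasure_finite
        sets_eq_imp_space_eq[OF s\<nu>] sets_eq_imp_space_eq[OF \<mu>(2)] by simp
  qed
  have ac: "absolutely_continuous \<nu> \<mu>" "absolutely_continuous \<nu> M"
    using em s\<nu> \<mu> by (auto simp: absolutely_continuous_def null_sets_def)
  obtain k where [measurable]: "k \<in> borel_measurable \<nu>" and k0: "\<And>x. 0 \<le> k x"
    and k: "\<mu> = density \<nu> (\<lambda>x. ennreal (k x))"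
    by (rule ex_real_density[OF \<nu>.sigma_finite_measure_axioms \<mu>(1) ac(1)]) (use \<mu> s\<nu> in auto)
  obtain h where [measurable]: "h \<in> borel_measurable \<nu>" and h0: "\<And>x. 0 \<le> h x"
    and h: "M = density \<nu> (\<lambda>x. ennreal (h x))"
    by (rule ex_real_density[OF \<nu>.sigma_finite_measure_axioms M ac(2)]) (use s\<nu> in auto)
  define a where "a = pos_root t"
  define b where "b = pos_root u"
  have tM [measurable]: "t \<in> borel_measurable M" "u \<in> borel_measurable M"
    using t u by (auto dest: L1_plusD)
  have tn [measurable]: "t \<in> borel_measurable \<nu>" "u \<in> borel_measurable \<nu>"
    using tM by (simp_all add: measurable_cong_sets[OF s\<nu>])
  have ab [measurable]: "a \<in> borel_measurable M" "b \<in> borel_measurable M"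
    "a \<in> borel_measurable \<nu>" "b \<in> borel_measurable \<nu>"
    by (auto simp: a_def b_def)
  have a2: "integrable M (\<lambda>x. (a x)\<^sup>2)" and b2: "integrable M (\<lambda>x. (b x)\<^sup>2)"
    using t u by (auto simp: a_def b_def integrable_pos_root_power2)
  have toM: "integrable M f \<longleftrightarrow> integrable \<nu> (\<lambda>x. h x * f x)"
      "(\<integral>x. f x \<partial>M) = (\<integral>x. h x * f x \<partial>\<nu>)" if "f \<in> borel_measurable \<nu>" for f
    using that h0 by (subst h, subst integrable_density integral_density; simp)+
  have to\<mu>: "integrable \<mu> f \<longleftrightarrow> integrable \<nu> (\<lambda>x. k x * f x)"
      "(\<integral>x. f x \<partial>\<mu>) = (\<integral>x. k x * f x \<partial>\<nu>)" if "f \<in> borel_measurable \<nu>" for f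
    using that k0 by (subst k, subst integrable_density integral_density; simp)+
  have mt: "intensity_measure M t = density \<nu> (\<lambda>x. ennreal (h x) * ennreal (t x))"
    unfolding intensity_measure_def by (subst h, subst density_density_eq) auto
  have "(hellinger \<mu> (intensity_measure M t))\<^sup>2 = (hellinger_wrt \<nu> \<mu> (intensity_measure M t))\<^sup>2"
    by (subst hellinger_eq_wrt[of \<nu>])
       (use \<mu> s\<nu> ac finite_measure_intensity_measure[OF t, unfolded mt] in \<open>auto simp: \<nu>.sigma_finite_measure_axioms mt
          intro!: absolutely_continuousI_density\<close>)
  also have "\<dots> = (\<integral>x. (sqrt (enn2real (ennreal (k x))) - sqrt (enn2real (ennreal (h x) * ennreal (t x))))\<^sup>2 \<partial>\<nu>) / 2"
    unfolding mt by (subst k, subst hellinger_wrt_density) (auto simp: \<nu>.sigma_finite_measure_axioms)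
  also have "(\<integral>x. (sqrt (enn2real (ennreal (k x))) - sqrt (enn2real (ennreal (h x) * ennreal (t x))))\<^sup>2 \<partial>\<nu>)
      = (\<integral>x. (sqrt (k x) - sqrt (h x) * a x)\<^sup>2 \<partial>\<nu>)"
  proof (rule Bochner_Integration.integral_cong[OF refl])
    fix x
    have "enn2real (ennreal (t x)) = max (t x) 0" by (simp add: max_def ennreal_neg)
    then show "(sqrt (enn2real (ennreal (k x))) - sqrt (enn2real (ennreal (h x) * ennreal (t x))))\<^sup>2
        = (sqrt (k x) - sqrt (h x) * a x)\<^sup>2"
      using k0 h0 by (simp add: enn2real_mult real_sqrt_mult a_def pos_root_def)
  qed
  finally have H\<mu>: "(hellinger \<mu> (intensity_measure M t))\<^sup>2 = (\<integral>x. (sqrt (k x) - sqrt (h x) * a x)\<^sup>2 \<partial>\<nu>) / 2" .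
  have Htu: "(hellinger_fun M t u)\<^sup>2 = (\<integral>x. h x * (b x - a x)\<^sup>2 \<partial>\<nu>) / 2"
    using hellinger_fun_power2[OF M.sigma_finite_measure_axioms t u]
    by (simp add: toM(2) a_def b_def power2_commute)
  have It: "(\<integral>x. u x \<partial>M) - (\<integral>x. t x \<partial>M) = (\<integral>x. h x * ((b x)\<^sup>2 - (a x)\<^sup>2) \<partial>\<nu>)"
  proof -
    have "(\<integral>x. u x \<partial>M) - (\<integral>x. t x \<partial>M) = (\<integral>x. (b x)\<^sup>2 - (a x)\<^sup>2 \<partial>M)"
      using a2 b2 t u by (simp add: a_def b_def integral_pos_root_power2)
    then show ?thesis by (simp add: toM(2))
  qed
  have ik: "integrable \<nu> k"
    using to\<mu>(1)[of "\<lambda>_. 1"] by simp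
  have i1: "integrable \<nu> (\<lambda>x. k x * (lr_ratio t u x - 1))"
  proof (rule Bochner_Integration.integrable_bound)
    show "integrable \<nu> (\<lambda>x. k x * 3)" using ik by simp
    have "\<bar>lr_ratio t u x - 1\<bar> \<le> 3" for x using lr_ratio_bounds[of t u x] by linarith
    then show "AE x in \<nu>. norm (k x * (lr_ratio t u x - 1)) \<le> norm (k x * 3)"
      using k0 by (auto simp: abs_mult intro!: AE_I2 mult_left_mono)
  qed simp
  have ia: "integrable \<nu> (\<lambda>x. h x * (a x)\<^sup>2)" "integrable \<nu> (\<lambda>x. h x * (b x)\<^sup>2)"
    using a2 b2 by (simp_all add: toM(1))
  have i2: "integrable \<nu> (\<lambda>x. h x * ((b x)\<^sup>2 - (a x)\<^sup>2))"
    using ia by (simp add: right_diff_distrib)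
  have i3: "integrable \<nu> (\<lambda>x. (sqrt (k x) - sqrt (h x) * a x)\<^sup>2)"
    by (rule integrable_square_diff) (use ik ia k0 h0 in \<open>auto simp: power_mult_distrib\<close>)
  have i4: "integrable \<nu> (\<lambda>x. h x * (b x - a x)\<^sup>2)"
    using integrable_square_diff[OF ab(2,1) b2 a2] by (simp add: toM(1))
  have "(\<integral>x. k x * (lr_ratio t u x - 1) - h x * ((b x)\<^sup>2 - (a x)\<^sup>2) / 4 \<partial>\<nu>)
      \<le> (\<integral>x. 2 * (sqrt (k x) - sqrt (h x) * a x)\<^sup>2 - h x * (b x - a x)\<^sup>2 / 4 \<partial>\<nu>)"
  proof (rule integral_mono)
    fix x
    show "k x * (lr_ratio t u x - 1) - h x * ((b x)\<^sup>2 - (a x)\<^sup>2) / 4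
        \<le> 2 * (sqrt (k x) - sqrt (h x) * a x)\<^sup>2 - h x * (b x - a x)\<^sup>2 / 4"
      using test_ratio_pointwise[of "a x" "b x" "sqrt (k x)" "sqrt (h x)"] k0[of x] h0[of x]
      by (simp add: lr_ratio_def a_def b_def mult.commute)
  qed (use i1 i2 i3 i4 in auto)
  then have "(\<integral>x. k x * (lr_ratio t u x - 1) \<partial>\<nu>) - (\<integral>x. h x * ((b x)\<^sup>2 - (a x)\<^sup>2) \<partial>\<nu>) / 4
      \<le> 2 * (\<integral>x. (sqrt (k x) - sqrt (h x) * a x)\<^sup>2 \<partial>\<nu>) - (\<integral>x. h x * (b x - a x)\<^sup>2 \<partial>\<nu>) / 4"
    using i1 i2 i3 i4 by simp
  then show ?thesis
    unfolding H\<mu> Htu It by (subst to\<mu>(2)) auto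
qed

text \<open>With \<open>a = pos_root t\<close> and \<open>b = pos_root u\<close>, half the
  log-likelihood ratio between the intensities \<open>((a + 3 * b) / 4)\<^sup>2\<close> and
  \<open>((3 * a + b) / 4)\<^sup>2\<close>, without its deterministic compensator, which is a
  quarter of the difference of the integrals of \<open>u\<close> and \<open>t\<close>.\<close>

definition lr_stat :: "('a \<Rightarrow> real) \<Rightarrow> ('a \<Rightarrow> real) \<Rightarrow> 'a multiset \<Rightarrow> real" where
  "lr_stat t u X = (\<Sum>x\<in>#X. ln (lr_ratio t u x))"

lemma lr_stat_swap: "lr_stat u t X = - lr_stat t u X"
proof -
  have "ln (lr_ratio u t x) = - ln (lr_ratio t u x)" for x
    using lr_ratio_bounds(3)[of t u x]
    by (simp add: lr_ratio_def test_ratio_swap[of "pos_root t x" "pos_root u x"] ln_inverse)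
  then show ?thesis unfolding lr_stat_def by (induction X) auto
qed

text \<open>Uniform in \<open>t\<close> and \<open>u\<close>: this is what makes the set of points
  preferred to a given one finite.\<close>

lemma lr_stat_le: "lr_stat t u X \<le> real (size X) * ln 3"
proof -
  have "ln (lr_ratio t u x) \<le> ln 3" for x
    using lr_ratio_bounds[of t u x] by simp
  then show ?thesis unfolding lr_stat_def
    by (induction X) (auto simp: algebra_simps add_mono)
qed

lemma borel_measurable_lr_stat [measurable]:
  assumes [measurable]: "t \<in> borel_measurable M" "u \<in> borel_measurable M"
  shows "lr_stat t u \<in> borel_measurable (config_space M)"
  unfolding lr_stat_def by (rule borel_measurable_sum_mset) measurable

text \<open>Markov's inequality for \<open>exp (lr_stat t u X)\<close>. The compensator in the event
  cancels the difference of the integrals in \<open>integral_lr_ratio_le\<close>.\<close>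

lemma lr_stat_tail:
  assumes M: "finite_measure M" and t: "t \<in> L1_plus M" and u: "u \<in> L1_plus M"
    and \<mu>: "finite_measure \<mu>" "sets \<mu> = sets M"
  shows "measure (poisson_law \<mu>)
      {X \<in> space (config_space M). c + ((\<integral>x. u x \<partial>M) - (\<integral>x. t x \<partial>M)) / 4 \<le> lr_stat t u X}
    \<le> exp (4 * (hellinger \<mu> (intensity_measure M t))\<^sup>2 - (hellinger_fun M t u)\<^sup>2 / 2 - c)"
    (is "measure _ ?A \<le> exp ?e")
proof -
  interpret \<mu>: finite_measure \<mu> by fact
  interpret P: prob_space "poisson_law \<mu>" by (rule prob_space_poisson_law) fact
  define d where "d = c + ((\<integral>x. u x \<partial>M) - (\<integral>x. t x \<partial>M)) / 4"
  have tM [measurable]: "t \<in> borel_measurable M" "u \<in> borel_measurable M"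
    using t u by (auto dest: L1_plusD)
  have sP: "sets (poisson_law \<mu>) = sets (config_space M)"
    using config_space_cong[OF \<mu>(2)] by (simp add: sets_poisson_law)
  have A: "?A \<in> sets (config_space M)" by measurable
  have r [measurable]: "lr_ratio t u \<in> borel_measurable \<mu>"
    using borel_measurable_lr_ratio[OF tM] by (simp add: measurable_cong_sets[OF \<mu>(2)])
  have L [measurable]: "lr_stat t u \<in> borel_measurable (poisson_law \<mu>)"
    using borel_measurable_lr_stat[OF tM] by (simp add: measurable_cong_sets[OF sP])
  have i: "integrable \<mu> (lr_ratio t u)"
  proof (rule \<mu>.integrable_const_bound)
    show "AE x in \<mu>. norm (lr_ratio t u x) \<le> 3"
      using lr_ratio_bounds[of t u] by (intro AE_I2) (simp add: less_imp_le)
  qed simp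
  have "(\<integral>\<^sup>+X. ennreal (exp (lr_stat t u X)) \<partial>poisson_law \<mu>) = ennreal (exp (\<integral>x. lr_ratio t u x - 1 \<partial>\<mu>))"
    using poisson_law_exp_sum[OF \<mu>(1), of "\<lambda>x. ln (lr_ratio t u x)"] i lr_ratio_bounds(3)[of t u]
    by (simp add: lr_stat_def)
  also have "\<dots> \<le> ennreal (exp (?e + d))"
    using integral_lr_ratio_le[OF M t u \<mu>] by (intro ennreal_leI) (simp add: d_def)
  finally have E: "(\<integral>\<^sup>+X. ennreal (exp (lr_stat t u X)) \<partial>poisson_law \<mu>) \<le> ennreal (exp (?e + d))" .
  have "emeasure (poisson_law \<mu>) ?A \<le> (\<integral>\<^sup>+X. ennreal (exp (lr_stat t u X - d)) \<partial>poisson_law \<mu>)"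
  proof -
    have "emeasure (poisson_law \<mu>) ?A = (\<integral>\<^sup>+X. indicator ?A X \<partial>poisson_law \<mu>)"
      using A sP by simp
    also have "\<dots> \<le> (\<integral>\<^sup>+X. ennreal (exp (lr_stat t u X - d)) \<partial>poisson_law \<mu>)"
      by (intro nn_integral_mono) (auto simp: indicator_def d_def ennreal_1[symmetric] simp del: ennreal_1)
    finally show ?thesis .
  qed
  also have "\<dots> = ennreal (exp (- d)) * (\<integral>\<^sup>+X. ennreal (exp (lr_stat t u X)) \<partial>poisson_law \<mu>)"
    by (subst nn_integral_cmult[symmetric]) (auto simp: ennreal_mult[symmetric] exp_add[symmetric])
  also have "\<dots> \<le> ennreal (exp (- d)) * ennreal (exp (?e + d))"
    using E by (rule mult_left_mono) simp
  also have "\<dots> = ennreal (exp ?e)"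
    by (simp add: ennreal_mult[symmetric] exp_add[symmetric])
  finally show ?thesis by (simp add: P.emeasure_eq_measure)
qed

text \<open>The second term is the compensator left out of \<open>lr_stat\<close>; the first favours
  the point of smaller weight.\<close>

definition lr_threshold :: "'a measure \<Rightarrow> (('a \<Rightarrow> real) \<Rightarrow> real) \<Rightarrow> ('a \<Rightarrow> real) \<Rightarrow> ('a \<Rightarrow> real) \<Rightarrow> real" where
  "lr_threshold M w t u = ((w u)\<^sup>2 - (w t)\<^sup>2) / 4 + ((\<integral>x. u x \<partial>M) - (\<integral>x. t x \<partial>M)) / 4"

lemma if_not_P_swap: "(if \<not> P then y else x) = (if P then x else y)"
  by simp

text \<open>Ties are decided by the enumeration of \<open>S\<close>, so that exchanging the two
  points yields the same test.\<close>

definition lr_test ::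
  "'a measure \<Rightarrow> ('a \<Rightarrow> real) set \<Rightarrow> (('a \<Rightarrow> real) \<Rightarrow> real) \<Rightarrow>
   ('a \<Rightarrow> real) \<Rightarrow> ('a \<Rightarrow> real) \<Rightarrow> 'a multiset \<Rightarrow> ('a \<Rightarrow> real)" where
  "lr_test M S w t u X =
     (if lr_threshold M w t u < lr_stat t u X \<or>
         lr_threshold M w t u = lr_stat t u X \<and> to_nat_on S u \<le> to_nat_on S t then u else t)"

lemma lr_test_swap:
  assumes "countable S" "t \<in> S" "u \<in> S" "t \<noteq> u"
  shows "lr_test M S w u t = lr_test M S w t u"
proof -
  have e: "to_nat_on S t \<noteq> to_nat_on S u"
    using assms inj_on_to_nat_on[OF assms(1)] by (auto dest: inj_onD)
  have "lr_threshold M w u t = - lr_threshold M w t u"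
    by (simp add: lr_threshold_def field_simps)
  then have "lr_test M S w u t X = lr_test M S w t u X" for X
    unfolding lr_test_def \<open>lr_threshold M w u t = _\<close> lr_stat_swap[of u t X]
    using e by (intro trans[OF if_cong[OF _ refl refl] if_not_P_swap]) linarith
  then show ?thesis by (rule ext)
qed

lemma lr_test_eq_imp:
  assumes "t \<noteq> u" "lr_test M S w t u X = u"
  shows "lr_threshold M w t u \<le> lr_stat t u X"
  using assms by (auto simp: lr_test_def split: if_splits)

lemma measurable_lr_test:
  assumes [measurable]: "t \<in> borel_measurable M" "u \<in> borel_measurable M" and "t \<noteq> u"
  shows "{X \<in> space (config_space M). lr_test M S w t u X = u} \<in> sets (config_space M)"
proof -
  have "{X \<in> space (config_space M). lr_test M S w t u X = u} =
    {X \<in> space (config_space M). lr_threshold M w t u < lr_stat t u X \<or>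
         lr_threshold M w t u = lr_stat t u X \<and> to_nat_on S u \<le> to_nat_on S t}"
    using assms by (auto simp: lr_test_def)
  then show ?thesis by simp
qed

text \<open>Source of all three bounds in \<open>test_family\<close>: if \<open>\<mu>\<close> is
  within a quarter of the distance from \<open>t\<close> to \<open>u\<close>, the first term uses up
  half of the second; in general the second is dropped. The risk bound uses this stronger form
  directly.\<close>

lemma lr_test_error:
  assumes M: "finite_measure M" and t: "t \<in> L1_plus M" and u: "u \<in> L1_plus M" and "t \<noteq> u"
    and \<mu>: "finite_measure \<mu>" "sets \<mu> = sets M"
  shows "measure (poisson_law \<mu>) {X \<in> space (config_space M). lr_test M S w t u X = u}
    \<le> exp (4 * (hellinger \<mu> (intensity_measure M t))\<^sup>2 - (hellinger_fun M t u)\<^sup>2 / 2 - ((w u)\<^sup>2 - (w t)\<^sup>2) / 4)"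
proof -
  interpret P: prob_space "poisson_law \<mu>" by (rule prob_space_poisson_law) fact
  have tM [measurable]: "t \<in> borel_measurable M" "u \<in> borel_measurable M"
    using t u by (auto dest: L1_plusD)
  have sP: "sets (poisson_law \<mu>) = sets (config_space M)"
    using config_space_cong[OF \<mu>(2)] by (simp add: sets_poisson_law)
  have "{X \<in> space (config_space M). ((w u)\<^sup>2 - (w t)\<^sup>2) / 4 + ((\<integral>x. u x \<partial>M) - (\<integral>x. t x \<partial>M)) / 4
      \<le> lr_stat t u X} \<in> sets (config_space M)"
    by measurable
  then have "measure (poisson_law \<mu>) {X \<in> space (config_space M). lr_test M S w t u X = u}
    \<le> measure (poisson_law \<mu>) {X \<in> space (config_space M).
        ((w u)\<^sup>2 - (w t)\<^sup>2) / 4 + ((\<integral>x. u x \<partial>M) - (\<integral>x. t x \<partial>M)) / 4 \<le> lr_stat t u X}"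
    using lr_test_eq_imp[OF assms(4)]
    by (intro P.finite_measure_mono) (auto simp: sP lr_threshold_def)
  also note lr_stat_tail[OF M t u \<mu>]
  finally show ?thesis .
qed

lemma hellinger_nonneg [simp]: "0 \<le> hellinger \<mu> \<nu>"
  by (simp add: hellinger_def hellinger_wrt_def)

lemma test_family_lr_test:
  assumes M: "finite_measure M" and S: "S \<subseteq> L1_plus M" "countable S"
  shows "test_family M S w (lr_test M S w)"
  unfolding test_family_def
proof (intro ballI impI conjI allI; (elim conjE)?)
  fix t u assume tu: "t \<in> S" "u \<in> S" "t \<noteq> u"
  then have L: "t \<in> L1_plus M" "u \<in> L1_plus M" using S by auto
  have sw: "lr_test M S w t u = lr_test M S w u t" using lr_test_swap[OF S(2)] tu by metis
  show "lr_test M S w t u = lr_test M S w u t" by (rule sw)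
  show "lr_test M S w t u X \<in> {t, u}" for X by (simp add: lr_test_def)
  show "{X \<in> space (config_space M). lr_test M S w t u X = u} \<in> sets (config_space M)"
    using L tu by (intro measurable_lr_test) (auto dest: L1_plusD)
  have quarter: "4 * x\<^sup>2 - h\<^sup>2 / 2 \<le> - h\<^sup>2 / 4" if "x \<le> h / 4" "0 \<le> x" for x h :: real
    using power_mono[OF that, of 2] by (simp add: power_divide)
  fix \<mu> assume \<mu>: "finite_measure \<mu>" "sets \<mu> = sets M"
  let ?H = "hellinger_fun M t u"
  note e = lr_test_error[OF M L tu(3) \<mu>, of S w]
  show "measure (poisson_law \<mu>) {X \<in> space (config_space M). lr_test M S w t u X = u}
      \<le> exp (- (?H\<^sup>2 - (w t)\<^sup>2 + (w u)\<^sup>2) / 4)"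
    if "hellinger \<mu> (intensity_measure M t) \<le> ?H / 4"
    by (rule order_trans[OF e]) (use quarter[OF that] in \<open>simp add: field_simps\<close>)
  have H: "hellinger_fun M u t = ?H"
    using L M by (intro hellinger_fun_commute) (auto simp: finite_measure.axioms)
  show "measure (poisson_law \<mu>) {X \<in> space (config_space M). lr_test M S w t u X = t}
      \<le> exp (- (?H\<^sup>2 - (w u)\<^sup>2 + (w t)\<^sup>2) / 4)"
    if "hellinger \<mu> (intensity_measure M u) \<le> ?H / 4"
    unfolding sw
    by (rule order_trans[OF lr_test_error[OF M L(2,1) tu(3)[symmetric] \<mu>]])
       (use quarter[OF that] H in \<open>simp add: field_simps\<close>)
  show "measure (poisson_law \<mu>) {X \<in> space (config_space M). lr_test M S w t u X = u}
      \<le> exp ((16 * (hellinger \<mu> (intensity_measure M t))\<^sup>2 + (w t)\<^sup>2 - (w u)\<^sup>2) / 4)"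
    by (rule order_trans[OF e]) (simp add: field_simps)
qed

section \<open>Existence and risk of T-estimators\<close>

lemma square_add_le:
  fixes a b :: real
  shows "(a + b)\<^sup>2 \<le> 2 * a\<^sup>2 + 2 * b\<^sup>2"
  using zero_le_power2[of "a - b"] by (simp add: power2_eq_square algebra_simps)

lemma hellinger_fun_triangle:
  assumes M: "sigma_finite_measure M" and t: "t \<in> L1_plus M" and u: "u \<in> L1_plus M" and v: "v \<in> L1_plus M"
  shows "(hellinger_fun M t u)\<^sup>2 \<le> 2 * (hellinger_fun M t v)\<^sup>2 + 2 * (hellinger_fun M v u)\<^sup>2"
proof -
  note [measurable] = L1_plusD(2)[OF t] L1_plusD(2)[OF u] L1_plusD(2)[OF v]
  have i: "integrable M (\<lambda>x. (pos_root f x - pos_root g x)\<^sup>2)" if "f \<in> L1_plus M" "g \<in> L1_plus M" for f g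
    using that L1_plusD(2)[OF that(1)] L1_plusD(2)[OF that(2)]
    by (intro integrable_square_diff integrable_pos_root_power2) auto
  have "(\<integral>x. (pos_root t x - pos_root u x)\<^sup>2 \<partial>M)
      \<le> (\<integral>x. 2 * (pos_root t x - pos_root v x)\<^sup>2 + 2 * (pos_root v x - pos_root u x)\<^sup>2 \<partial>M)"
  proof (rule integral_mono)
    show "(pos_root t x - pos_root u x)\<^sup>2 \<le> 2 * (pos_root t x - pos_root v x)\<^sup>2 + 2 * (pos_root v x - pos_root u x)\<^sup>2" for x
      using square_add_le[of "pos_root t x - pos_root v x" "pos_root v x - pos_root u x"] by simp
  qed (use i t u v in auto)
  also have "\<dots> = 2 * (\<integral>x. (pos_root t x - pos_root v x)\<^sup>2 \<partial>M) + 2 * (\<integral>x. (pos_root v x - pos_root u x)\<^sup>2 \<partial>M)"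
    using i t u v by simp
  finally show ?thesis
    by (simp add: hellinger_fun_power2[OF M] t u v)
qed

lemma hellinger_fun_le_integrals:
  assumes M: "sigma_finite_measure M" and t: "t \<in> L1_plus M" and u: "u \<in> L1_plus M"
  shows "(hellinger_fun M t u)\<^sup>2 \<le> (\<integral>x. t x \<partial>M) + (\<integral>x. u x \<partial>M)"
proof -
  note [measurable] = L1_plusD(2)[OF t] L1_plusD(2)[OF u]
  note i = integrable_pos_root_power2[OF t] integrable_pos_root_power2[OF u]
  have "(\<integral>x. (pos_root t x - pos_root u x)\<^sup>2 \<partial>M) \<le> (\<integral>x. 2 * (pos_root t x)\<^sup>2 + 2 * (pos_root u x)\<^sup>2 \<partial>M)"
  proof (rule integral_mono)
    show "(pos_root t x - pos_root u x)\<^sup>2 \<le> 2 * (pos_root t x)\<^sup>2 + 2 * (pos_root u x)\<^sup>2" for x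
      using square_add_le[of "pos_root t x" "- pos_root u x"] by simp
  qed (use i in \<open>auto intro!: integrable_square_diff\<close>)
  also have "\<dots> = 2 * (\<integral>x. t x \<partial>M) + 2 * (\<integral>x. u x \<partial>M)"
    using i by (simp add: integral_pos_root_power2 t u)
  finally show ?thesis by (simp add: hellinger_fun_power2[OF M] t u)
qed

lemma borel_measurable_nn_integral_count_space:
  assumes S: "countable S" and f: "\<And>u. u \<in> S \<Longrightarrow> f u \<in> borel_measurable M"
  shows "(\<lambda>x. \<integral>\<^sup>+u. f u x \<partial>count_space S) \<in> borel_measurable M"
proof (cases "finite S")
  case True
  then show ?thesis using f by (simp add: nn_integral_count_space_finite)
next
  case False
  note bij = bij_betw_from_nat_into[OF S False]
  have "(\<integral>\<^sup>+u. f u x \<partial>count_space S) = (\<Sum>n. f (from_nat_into S n) x)" for x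
    by (simp add: nn_integral_bij_count_space[OF bij, symmetric] nn_integral_count_space_nat)
  moreover have "from_nat_into S n \<in> S" for n using False by (intro from_nat_into) auto
  ultimately show ?thesis using f by simp
qed

text \<open>The bounds \<open>B\<close> and \<open>Z\<close> are parameters, so that the risk
  constant is common to all families sharing them. By \<open>unbounded\<close> there are points
  arbitrarily far apart, from which the existence of a minimizer is derived.\<close>

locale models = finite_measure M
  for M :: "'a measure" and I :: "nat set" and Sm :: "nat \<Rightarrow> ('a \<Rightarrow> real) set" and \<eta> :: "nat \<Rightarrow> real" +
  fixes D :: "nat \<Rightarrow> real" and B Z :: real
  assumes D_model: "m \<in> I \<Longrightarrow> D_model M (\<eta> m) (D m) B (Sm m)"
    and D_ge: "m \<in> I \<Longrightarrow> 1 / 2 \<le> D m"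
    and D_le: "m \<in> I \<Longrightarrow> 84 * D m / 5 \<le> (\<eta> m)\<^sup>2"
    and summable: "(\<lambda>m. exp (- (\<eta> m)\<^sup>2 / 84)) summable_on I"
    and Z: "(\<integral>\<^sup>+m. ennreal (exp (- (\<eta> m)\<^sup>2 / 84)) \<partial>count_space I) \<le> ennreal Z" "0 \<le> Z"
    and distinct: "distinct_classes M (\<Union>m\<in>I. Sm m)"
    and unbounded: "\<exists>t\<in>\<Union>m\<in>I. Sm m. \<exists>u\<in>\<Union>m\<in>I. Sm m. K \<le> hellinger_fun M t u"
begin

abbreviation H :: "('a \<Rightarrow> real) \<Rightarrow> ('a \<Rightarrow> real) \<Rightarrow> real" where "H \<equiv> hellinger_fun M"

definition S where "S = (\<Union>m\<in>I. Sm m)"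
definition w where "w = model_weight I Sm \<eta>"
definition \<psi> where "\<psi> = lr_test M S w"
definition crit where "crit = test_crit M S \<psi>"

section \<open>Balls, weights and finiteness\<close>

lemma model_family: "model_family M I Sm \<eta>"
  unfolding model_family_def using D_model D_ge D_le summable distinct by blast

lemma \<eta>_pos: "m \<in> I \<Longrightarrow> 0 < \<eta> m"
  and B_pos: "m \<in> I \<Longrightarrow> 0 < B"
  and Sm_L1: "m \<in> I \<Longrightarrow> Sm m \<subseteq> L1_plus M"
  using D_model by (auto simp: D_model_def)

lemma S_L1: "t \<in> S \<Longrightarrow> t \<in> L1_plus M"
  using Sm_L1 by (auto simp: S_def)

lemma S_nonempty: "S \<noteq> {}"
  using unbounded[of 0] by (auto simp: S_def)

lemma H_commute: "t \<in> S \<Longrightarrow> u \<in> S \<Longrightarrow> H t u = H u t"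
  using S_L1 by (intro hellinger_fun_commute sigma_finite_measure_axioms) auto

lemma H_triangle: "t \<in> L1_plus M \<Longrightarrow> u \<in> L1_plus M \<Longrightarrow> v \<in> L1_plus M \<Longrightarrow> (H t u)\<^sup>2 \<le> 2 * (H t v)\<^sup>2 + 2 * (H v u)\<^sup>2"
  by (intro hellinger_fun_triangle sigma_finite_measure_axioms)

text \<open>\<open>D_model\<close> speaks of radii \<open>x * \<eta> m\<close> with
  \<open>2 \<le> x\<close> only; the term \<open>4 * (\<eta> m)\<^sup>2\<close> accounts for smaller
  balls. The rate 5/84 is that of \<open>D_le\<close>.\<close>

lemma ball_finite_card:
  assumes m: "m \<in> I" and t: "t \<in> L1_plus M" and r: "0 \<le> r"
  shows "finite {u \<in> Sm m. (H t u)\<^sup>2 < r}"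
    and "real (card {u \<in> Sm m. (H t u)\<^sup>2 < r}) \<le> B * exp (5 / 84 * (r + 4 * (\<eta> m)\<^sup>2))"
proof -
  define x where "x = max 2 (sqrt r / \<eta> m)"
  have x: "2 \<le> x" "sqrt r \<le> x * \<eta> m" using \<eta>_pos[OF m] by (auto simp: x_def pos_divide_le_eq[symmetric])
  have sub: "{u \<in> Sm m. (H t u)\<^sup>2 < r} \<subseteq> {u \<in> Sm m. H t u < x * \<eta> m}"
    using x(2) by (auto dest!: real_less_rsqrt)
  have fin: "finite {u \<in> Sm m. H t u < x * \<eta> m}"
    and card: "real (card {u \<in> Sm m. H t u < x * \<eta> m}) \<le> B * exp (D m * x\<^sup>2)"
    using D_model[OF m] t x(1) by (auto simp: D_model_def)
  show "finite {u \<in> Sm m. (H t u)\<^sup>2 < r}" by (rule finite_subset[OF sub fin])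
  have "D m * x\<^sup>2 \<le> 5 / 84 * (\<eta> m)\<^sup>2 * x\<^sup>2" using D_le[OF m] by (intro mult_right_mono) auto
  moreover have "(\<eta> m)\<^sup>2 * x\<^sup>2 \<le> r + 4 * (\<eta> m)\<^sup>2"
  proof (cases "2 \<le> sqrt r / \<eta> m")
    case True
    then have "\<eta> m * x = sqrt r" using \<eta>_pos[OF m] by (simp add: x_def)
    then have "(\<eta> m)\<^sup>2 * x\<^sup>2 = r" using r by (simp add: power_mult_distrib[symmetric])
    then show ?thesis by simp
  next
    case False
    then show ?thesis using r by (simp add: x_def)
  qed
  ultimately have e: "D m * x\<^sup>2 \<le> 5 / 84 * (r + 4 * (\<eta> m)\<^sup>2)" by simp
  have "real (card {u \<in> Sm m. (H t u)\<^sup>2 < r}) \<le> B * exp (D m * x\<^sup>2)"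
    using card_mono[OF fin sub] card by linarith
  also have "\<dots> \<le> B * exp (5 / 84 * (r + 4 * (\<eta> m)\<^sup>2))"
    using e B_pos[OF m] by (intro mult_left_mono) auto
  finally show "real (card {u \<in> Sm m. (H t u)\<^sup>2 < r}) \<le> \<dots>" .
qed

lemma countable_S: "countable S"
  unfolding S_def
proof (rule countable_UN)
  fix m assume m: "m \<in> I"
  show "countable (Sm m)"
  proof (cases "Sm m = {}")
    case False
    then obtain t where "t \<in> Sm m" by blast
    then have t: "t \<in> L1_plus M" using Sm_L1[OF m] by auto
    have "Sm m = (\<Union>k::nat. {u \<in> Sm m. (H t u)\<^sup>2 < real k})"
      using reals_Archimedean2 by auto
    also have "countable \<dots>"
    proof (rule countable_UN)
      show "countable {u \<in> Sm m. (H t u)\<^sup>2 < real k}" for k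
        by (rule countable_finite[OF ball_finite_card(1)[OF m t]]) simp
    qed simp
    finally show ?thesis .
  qed simp
qed simp

text \<open>Infinitely many radii below \<open>c\<close> would give infinitely many terms of a
  summable family that are bounded away from 0. Consequently the infimum in
  \<open>model_weight\<close> is a minimum.\<close>

lemma finite_low_models: "finite {m \<in> I. \<eta> m \<le> c}"
proof (rule ccontr)
  assume inf: "infinite {m \<in> I. \<eta> m \<le> c}"
  define \<delta> where "\<delta> = exp (- c\<^sup>2 / 84)"
  define f where "f = (\<lambda>m. exp (- (\<eta> m)\<^sup>2 / 84))"
  obtain n :: nat where n: "infsum f I < real n * \<delta>"
    using reals_Archimedean3[of \<delta>] by (auto simp: \<delta>_def)
  obtain F where F: "finite F" "card F = n" "F \<subseteq> {m \<in> I. \<eta> m \<le> c}"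
    using infinite_arbitrarily_large[OF inf] by metis
  have "real n * \<delta> = (\<Sum>m\<in>F. \<delta>)" by (simp add: F)
  also have "\<dots> \<le> (\<Sum>m\<in>F. f m)"
  proof (rule sum_mono)
    fix m assume "m \<in> F"
    then have "0 < \<eta> m" "\<eta> m \<le> c" using F \<eta>_pos by auto
    then have "(\<eta> m)\<^sup>2 \<le> c\<^sup>2" by (intro power_mono) auto
    then show "\<delta> \<le> f m" by (simp add: \<delta>_def f_def)
  qed
  also have "\<dots> \<le> infsum f I"
    using F summable by (intro finite_sum_le_infsum) (auto simp: f_def)
  finally show False using n by simp
qed

lemma weight_le: "m \<in> I \<Longrightarrow> u \<in> Sm m \<Longrightarrow> w u \<le> \<eta> m"
  unfolding w_def model_weight_def
  by (rule cInf_lower) (auto intro!: bdd_belowI[of _ 0] less_imp_le \<eta>_pos)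

lemma weight_attained:
  assumes "u \<in> S"
  obtains m where "m \<in> I" "u \<in> Sm m" "w u = \<eta> m"
proof -
  obtain m0 where m0: "m0 \<in> I" "u \<in> Sm m0" using assms by (auto simp: S_def)
  define F where "F = {m \<in> I. u \<in> Sm m \<and> \<eta> m \<le> \<eta> m0}"
  have F: "finite F" "F \<noteq> {}"
    using m0 finite_low_models[of "\<eta> m0"] by (auto simp: F_def elim: rev_finite_subset)
  define m where "m = arg_min_on \<eta> F"
  have m: "m \<in> F" "\<And>k. k \<in> F \<Longrightarrow> \<eta> m \<le> \<eta> k"
    using F arg_min_if_finite[OF F, of \<eta>] by (auto simp: m_def not_less[symmetric])
  have "w u = \<eta> m"
    unfolding w_def model_weight_def
  proof (rule cInf_eq_minimum)
    fix y assume "y \<in> {\<eta> m |m. m \<in> I \<and> u \<in> Sm m}"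
    then obtain k where k: "k \<in> I" "u \<in> Sm k" "y = \<eta> k" by blast
    show "\<eta> m \<le> y"
    proof (cases "\<eta> k \<le> \<eta> m0")
      case True then show ?thesis using k m(2)[of k] by (simp add: F_def)
    next
      case False then show ?thesis using k m(1) by (simp add: F_def)
    qed
  qed (use m(1) in \<open>auto simp: F_def\<close>)
  then show ?thesis using that m(1) by (auto simp: F_def)
qed

lemma weight_nonneg: "u \<in> S \<Longrightarrow> 0 \<le> w u"
  using weight_attained \<eta>_pos by (metis less_imp_le)

text \<open>The statistic is bounded for a given configuration, so that only finitely many points, those of
  bounded energy, can be preferred to a given one.\<close>

definition energy where "energy u = (w u)\<^sup>2 + (\<integral>x. u x \<partial>M)"

lemma integral_nonneg: "u \<in> L1_plus M \<Longrightarrow> 0 \<le> (\<integral>x. u x \<partial>M)"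
  by (intro integral_nonneg_AE) (auto dest: L1_plusD)

text \<open>The energy bounds both the radius of a model containing the point and the integral of
  the point. So only finitely many models are concerned, and in each of them one ball about a fixed
  point.\<close>

lemma finite_energy: "finite {u \<in> S. energy u \<le> K}"
proof -
  obtain t where t: "t \<in> S" using S_nonempty by blast
  \<comment> \<open>The added 1 turns the bound on the squared distance into a strict one, and the
    maximum keeps \<open>r\<close> nonnegative when \<open>K\<close> is negative.\<close>
  define r where "r = max 0 ((\<integral>x. t x \<partial>M) + K + 1)"
  have "{u \<in> S. energy u \<le> K} \<subseteq> (\<Union>m\<in>{m \<in> I. \<eta> m \<le> sqrt K}. {u \<in> Sm m. (H t u)\<^sup>2 < r})"
  proof
    fix u assume u: "u \<in> {u \<in> S. energy u \<le> K}"
    then have L: "u \<in> L1_plus M" using S_L1 by auto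
    have "u \<in> S" using u by simp
    then obtain m where m: "m \<in> I" "u \<in> Sm m" "w u = \<eta> m" by (rule weight_attained)
    have "(\<eta> m)\<^sup>2 \<le> K" "(\<integral>x. u x \<partial>M) \<le> K"
    proof -
      have "(\<eta> m)\<^sup>2 + (\<integral>x. u x \<partial>M) \<le> K" using u m(3) by (simp add: energy_def)
      then show "(\<eta> m)\<^sup>2 \<le> K" "(\<integral>x. u x \<partial>M) \<le> K"
        using integral_nonneg[OF L] zero_le_power2[of "\<eta> m"] by linarith+
    qed
    moreover from this have "\<eta> m \<le> sqrt K" by (intro real_le_rsqrt)
    moreover have "(H t u)\<^sup>2 \<le> (\<integral>x. t x \<partial>M) + (\<integral>x. u x \<partial>M)"
      using hellinger_fun_le_integrals[OF sigma_finite_measure_axioms S_L1[OF t] L] .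
    ultimately show "u \<in> (\<Union>m\<in>{m \<in> I. \<eta> m \<le> sqrt K}. {u \<in> Sm m. (H t u)\<^sup>2 < r})"
      using m by (auto simp: r_def)
  qed
  then show ?thesis
    by (rule finite_subset) (use finite_low_models ball_finite_card(1) S_L1[OF t] in \<open>auto simp: r_def\<close>)
qed

section \<open>The criterion and its minimizers\<close>

lemma \<psi>_swap: "t \<in> S \<Longrightarrow> u \<in> S \<Longrightarrow> t \<noteq> u \<Longrightarrow> \<psi> u t = \<psi> t u"
  unfolding \<psi>_def by (rule lr_test_swap[OF countable_S])

lemma \<psi>_cases: "\<psi> t u X = t \<or> \<psi> t u X = u"
  by (simp add: \<psi>_def lr_test_def)

text \<open>\<open>lr_threshold\<close> is a quarter of the difference of the energies, and each
  point of \<open>X\<close> contributes at most \<open>ln 3\<close> to the statistic.\<close>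

lemma \<psi>_energy:
  assumes "t \<noteq> u" "\<psi> t u X = u"
  shows "energy u \<le> energy t + 4 * (real (size X) * ln 3)"
  using lr_test_eq_imp[OF assms[unfolded \<psi>_def]] lr_stat_le[of t u X]
  by (simp add: lr_threshold_def energy_def field_simps)

lemma finite_better: "finite {u \<in> S. u \<noteq> t \<and> \<psi> t u X = u}"
  by (rule finite_subset[OF _ finite_energy[of "energy t + 4 * (real (size X) * ln 3)"]])
     (use \<psi>_energy in auto)

lemma crit_ge: "u \<in> S \<Longrightarrow> u \<noteq> t \<Longrightarrow> \<psi> t u X = u \<Longrightarrow> ennreal (H t u) \<le> crit X t"
  unfolding crit_def test_crit_def by (rule Sup_upper) auto

text \<open>A supremum over finitely many competitors is a maximum; the value 0 occurs if there are
  none.\<close>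

lemma crit_cases:
  obtains "crit X t = 0"
  | u where "u \<in> S" "u \<noteq> t" "\<psi> t u X = u" "crit X t = ennreal (H t u)"
proof (cases "{u \<in> S. u \<noteq> t \<and> \<psi> t u X = u} = {}")
  case True
  then have "{ennreal (H t u) |u. u \<in> S \<and> u \<noteq> t \<and> \<psi> t u X = u} = {}" by auto
  then have "crit X t = 0" unfolding crit_def test_crit_def by (simp only:) (simp add: bot_ennreal)
  then show ?thesis by (rule that(1))
next
  case False
  define A where "A = {ennreal (H t u) |u. u \<in> S \<and> u \<noteq> t \<and> \<psi> t u X = u}"
  have "A = (\<lambda>u. ennreal (H t u)) ` {u \<in> S. u \<noteq> t \<and> \<psi> t u X = u}" by (auto simp: A_def)
  then have A: "finite A" "A \<noteq> {}" using finite_better[of t X] False by auto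
  then have "Sup A \<in> A" by (simp add: Max_Sup[symmetric])
  then show ?thesis using that(2) by (auto simp: A_def crit_def test_crit_def)
qed

lemma crit_finite: "\<exists>r\<ge>0. crit X t = ennreal r"
  by (rule crit_cases[of X t]) (auto intro: exI[of _ 0] exI[of _ "H t _"])

text \<open>Two points that are far apart are both preferred to every point of high energy, whose criterion
  is then large; hence the infimum is attained on a finite set.\<close>

lemma minimizer_exists: "\<exists>t\<in>S. \<forall>u\<in>S. crit X t \<le> crit X u"
proof -
  obtain t0 where t0: "t0 \<in> S" using S_nonempty by blast
  obtain r where r: "0 \<le> r" "crit X t0 = ennreal r" using crit_finite by blast
  \<comment> \<open>At this distance the squared triangle inequality leaves one of the two points at
    distance at least \<open>r\<close> from any given point.\<close>
  obtain u1 u2 where u: "u1 \<in> S" "u2 \<in> S" "2 * r \<le> H u1 u2"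
    using unbounded[of "2 * r"] by (auto simp: S_def)
  define K where "K = max (energy u1) (energy u2) + 4 * (real (size X) * ln 3)"
  \<comment> \<open>Including \<open>t0\<close> makes the set nonempty and its minimum at most
    \<open>r\<close>, the value that every point outside reaches.\<close>
  define F where "F = insert t0 {t \<in> S. energy t \<le> K}"
  have F: "finite F" "F \<noteq> {}" "F \<subseteq> S" using finite_energy t0 by (auto simp: F_def)
  define t where "t = arg_min_on (crit X) F"
  have t: "t \<in> F" "\<And>k. k \<in> F \<Longrightarrow> crit X t \<le> crit X k"
    using arg_min_if_finite[OF F(1,2), of "crit X"] by (auto simp: t_def not_less[symmetric])
  have "crit X t \<le> crit X v" if v: "v \<in> S" for v
  proof (cases "v \<in> F")
    case False
    then have K: "K < energy v" using v by (auto simp: F_def)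
    have beats: "ennreal (H v u) \<le> crit X v" if "u \<in> {u1, u2}" for u
    proof -
      have uS: "u \<in> S" "energy u + 4 * (real (size X) * ln 3) < energy v"
        using that u K by (auto simp: K_def)
      have "0 \<le> real (size X) * ln 3" by simp
      then have "energy u < energy v" using uS(2) by linarith
      then have ne: "u \<noteq> v" by auto
      have "\<psi> u v X \<noteq> v" using \<psi>_energy[OF ne, of X] uS(2) by linarith
      then have "\<psi> v u X = u" using \<psi>_cases[of u v X] \<psi>_swap[OF v uS(1)] ne by metis
      then show ?thesis using crit_ge uS(1) ne by blast
    qed
    have "(2 * r)\<^sup>2 \<le> (H u1 u2)\<^sup>2" using u(3) r(1) by (intro power_mono) auto
    also have "\<dots> \<le> 2 * (H u1 v)\<^sup>2 + 2 * (H v u2)\<^sup>2" by (intro H_triangle S_L1 u v)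
    finally have "4 * r\<^sup>2 \<le> 2 * (H v u1)\<^sup>2 + 2 * (H v u2)\<^sup>2"
      using H_commute[OF u(1) v] by (simp add: power_mult_distrib)
    then have "r\<^sup>2 \<le> (H v u1)\<^sup>2 \<or> r\<^sup>2 \<le> (H v u2)\<^sup>2" by linarith
    then have "r \<le> H v u1 \<or> r \<le> H v u2"
      using r(1) by (auto dest!: power2_le_imp_le[OF _ hellinger_fun_nonneg])
    then have "ennreal r \<le> crit X v" using beats ennreal_leI order_trans by blast
    moreover have "crit X t \<le> crit X t0" by (rule t(2)) (simp add: F_def)
    ultimately show ?thesis using r(2) by simp
  qed (rule t(2))
  then show ?thesis using t(1) F(3) by blast
qed

text \<open>The first minimizer in an enumeration of \<open>S\<close>: measurability then reduces to
  countably many comparisons of measurable criteria.\<close>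

definition est where
  "est X = from_nat_into S (LEAST n. \<forall>u\<in>S. crit X (from_nat_into S n) \<le> crit X u)"

lemma est_in_S: "est X \<in> S"
  unfolding est_def by (rule from_nat_into[OF S_nonempty])

lemma est_minimal: "u \<in> S \<Longrightarrow> crit X (est X) \<le> crit X u"
proof -
  obtain t where t: "t \<in> S" "\<forall>u\<in>S. crit X t \<le> crit X u" using minimizer_exists by blast
  then have "\<exists>n. \<forall>u\<in>S. crit X (from_nat_into S n) \<le> crit X u"
    using from_nat_into_surj[OF countable_S t(1)] by metis
  then have "\<forall>u\<in>S. crit X (from_nat_into S (LEAST n. \<forall>u\<in>S. crit X (from_nat_into S n) \<le> crit X u)) \<le> crit X u"
    by (rule LeastI_ex)
  then show "u \<in> S \<Longrightarrow> crit X (est X) \<le> crit X u" by (simp add: est_def)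
qed

lemma measurable_\<psi>:
  assumes "t \<in> S" "u \<in> S" "t \<noteq> u"
  shows "{X \<in> space (config_space M). \<psi> t u X = u} \<in> sets (config_space M)"
  unfolding \<psi>_def using assms S_L1 by (intro measurable_lr_test) (auto dest: L1_plusD)

lemma borel_measurable_crit:
  assumes t: "t \<in> S"
  shows "(\<lambda>X. crit X t) \<in> borel_measurable (config_space M)"
proof -
  let ?A = "\<lambda>u. {X \<in> space (config_space M). \<psi> t u X = u}"
  have "(\<lambda>X. \<Squnion>u\<in>S - {t}. ennreal (H t u) * indicator (?A u) X) \<in> borel_measurable (config_space M)"
    using countable_S measurable_\<psi>[OF t] by (intro borel_measurable_SUP) auto
  moreover have "crit X t = (\<Squnion>u\<in>S - {t}. ennreal (H t u) * indicator (?A u) X)"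
    if X: "X \<in> space (config_space M)" for X
    unfolding crit_def test_crit_def
  proof (rule antisym)
    show "Sup {ennreal (H t u) |u. u \<in> S \<and> u \<noteq> t \<and> \<psi> t u X = u}
        \<le> (\<Squnion>u\<in>S - {t}. ennreal (H t u) * indicator (?A u) X)"
      by (rule Sup_least) (use X in \<open>auto intro!: SUP_upper2\<close>)
    show "(\<Squnion>u\<in>S - {t}. ennreal (H t u) * indicator (?A u) X)
        \<le> Sup {ennreal (H t u) |u. u \<in> S \<and> u \<noteq> t \<and> \<psi> t u X = u}"
      by (rule SUP_least) (auto simp: indicator_def intro!: Sup_upper)
  qed
  ultimately show ?thesis by (simp cong: measurable_cong)
qed

lemma measurable_est: "est \<in> measurable (config_space M) (count_space S)"
proof -
  have nS: "from_nat_into S n \<in> S" for n by (rule from_nat_into[OF S_nonempty])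
  have "Measurable.pred (config_space M) (\<lambda>X. \<forall>u\<in>S. crit X (from_nat_into S n) \<le> crit X u)" for n
  proof -
    have "(\<forall>u\<in>S. P u) \<longleftrightarrow> (\<forall>k. P (from_nat_into S k))" for P
      using nS from_nat_into_surj[OF countable_S] by metis
    then show ?thesis using borel_measurable_crit nS by simp
  qed
  then have "(\<lambda>X. LEAST n. \<forall>u\<in>S. crit X (from_nat_into S n) \<le> crit X u)
      \<in> measurable (config_space M) (count_space UNIV)"
    by (intro measurable_Least)
  moreover have "from_nat_into S \<in> measurable (count_space UNIV) (count_space S)"
    using nS by simp
  ultimately show ?thesis unfolding est_def[abs_def] by (rule measurable_compose)
qed

lemma T_estimator_est: "T_estimator M est"
  unfolding T_estimator_def
proof (intro exI conjI ballI)
  show "model_family M I Sm \<eta>" by (rule model_family)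
  show "test_family M S (model_weight I Sm \<eta>) \<psi>"
    unfolding \<psi>_def w_def using S_L1 countable_S
    by (intro test_family_lr_test finite_measure_axioms) auto
  show "est \<in> measurable (config_space M) (count_space S)" by (rule measurable_est)
  show "test_crit M S \<psi> X (est X) \<le> test_crit M S \<psi> X t" if "t \<in> S" for X t
    using est_minimal[OF that] unfolding crit_def .
qed (simp add: S_def)

section \<open>From the criterion to the risk\<close>

lemma H_est_le_crit:
  assumes t: "t \<in> S"
  shows "ennreal (H t (est X)) \<le> crit X t"
proof (cases "est X = t")
  case True
  have "(H t t)\<^sup>2 = 0"
    using hellinger_fun_power2[OF sigma_finite_measure_axioms S_L1[OF t] S_L1[OF t]] by simp
  then show ?thesis using True by simp
next
  case ne: False
  show ?thesis
  \<comment> \<open>The test between \<open>t\<close> and the estimator has a loser, whose criterion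
    is at least the distance of the two. If the loser is the estimator, its minimality transfers the
    bound to \<open>t\<close>.\<close>
  proof (cases "\<psi> t (est X) X = est X")
    case True
    then show ?thesis using crit_ge est_in_S ne by blast
  next
    case False
    then have "\<psi> t (est X) X = t" using \<psi>_cases by blast
    then have "\<psi> (est X) t X = t" using \<psi>_swap[OF t est_in_S] ne by metis
    then have "ennreal (H (est X) t) \<le> crit X (est X)" using ne t by (intro crit_ge) auto
    also have "\<dots> \<le> crit X t" by (rule est_minimal[OF t])
    finally show ?thesis using H_commute[OF est_in_S t] by simp
  qed
qed

text \<open>The criterion at \<open>t\<close> is the distance to some point preferred to
  \<open>t\<close>. Beyond \<open>y\<close>, the term of this random point is replaced by the sum
  over all far points of \<open>S\<close>, whose expectation can be taken term by term.\<close>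

lemma loss_le:
  assumes t: "t \<in> S" and y: "0 \<le> y"
  shows "ennreal ((H t (est X))\<^sup>2) \<le> ennreal (y\<^sup>2) +
    (\<integral>\<^sup>+u. ennreal ((H t u)\<^sup>2) * of_bool (u \<noteq> t \<and> y \<le> H t u \<and> \<psi> t u X = u) \<partial>count_space S)"
proof (cases "H t (est X) \<le> y")
  case True
  then have "(H t (est X))\<^sup>2 \<le> y\<^sup>2" by (intro power_mono) auto
  then show ?thesis by (intro order_trans[OF ennreal_leI add_increasing2]) auto
next
  case False
  show ?thesis
  proof (rule crit_cases[of X t])
    assume "crit X t = 0"
    then show ?thesis using H_est_le_crit[OF t, of X] False y by (simp add: ennreal_eq_0_iff)
  next
    fix u assume u: "u \<in> S" "u \<noteq> t" "\<psi> t u X = u" "crit X t = ennreal (H t u)"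
    have le: "H t (est X) \<le> H t u"
      using H_est_le_crit[OF t, of X] u(4) by simp
    then have "ennreal ((H t (est X))\<^sup>2) \<le> ennreal ((H t u)\<^sup>2)"
      by (intro ennreal_leI power_mono) auto
    also have "\<dots> = ennreal ((H t u)\<^sup>2) * of_bool (u \<noteq> t \<and> y \<le> H t u \<and> \<psi> t u X = u)"
      using u False le by simp
    also have "\<dots> \<le> (\<integral>\<^sup>+u. ennreal ((H t u)\<^sup>2) * of_bool (u \<noteq> t \<and> y \<le> H t u \<and> \<psi> t u X = u) \<partial>count_space S)"
      by (rule nn_integral_ge_point[OF u(1)])
    finally show ?thesis by (rule add_increasing[OF zero_le])
  qed
qed

text \<open>Slicing by the integer part \<open>k\<close> of the squared distance: the number of
  points grows like \<open>exp (5 / 84 * k)\<close> and the weight decays like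
  \<open>exp (- 13 / 84 * k)\<close>, which leaves a geometric series of ratio
  \<open>exp (- 8 / 84)\<close>. The factor with 20/84 comes from the term
  \<open>4 * (\<eta> m)\<^sup>2\<close> of \<open>ball_finite_card\<close>.\<close>

lemma model_sum_le:
  assumes m: "m \<in> I" and t: "t \<in> L1_plus M"
  shows "(\<integral>\<^sup>+u. ennreal (exp (- 13 / 84 * (H t u)\<^sup>2)) * indicator (Sm m) u \<partial>count_space S)
    \<le> ennreal (B * exp (5 / 84) / (1 - exp (- 8 / 84)) * exp (20 / 84 * (\<eta> m)\<^sup>2))"
proof -
  let ?A = "\<lambda>k::nat. {u \<in> Sm m. (H t u)\<^sup>2 < real k + 1}"
  have A: "?A k \<subseteq> S" for k using m by (auto simp: S_def)
  have "(\<integral>\<^sup>+u. ennreal (exp (- 13 / 84 * (H t u)\<^sup>2)) * indicator (Sm m) u \<partial>count_space S)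
      \<le> (\<integral>\<^sup>+u. (\<Sum>k. ennreal (exp (- 13 / 84 * real k)) * indicator (?A k) u) \<partial>count_space S)"
  proof (rule nn_integral_mono)
    fix u
    define k where "k = nat \<lfloor>(H t u)\<^sup>2\<rfloor>"
    have k: "real k \<le> (H t u)\<^sup>2" "(H t u)\<^sup>2 < real k + 1"
      using zero_le_power2[of "H t u"] by (auto simp: k_def)
    have "ennreal (exp (- 13 / 84 * (H t u)\<^sup>2)) * indicator (Sm m) u
        \<le> ennreal (exp (- 13 / 84 * real k)) * indicator (?A k) u"
      using k by (auto simp: indicator_def intro!: ennreal_leI)
    also have "\<dots> \<le> (\<Sum>k. ennreal (exp (- 13 / 84 * real k)) * indicator (?A k) u)"
      by (rule sum_le_suminf[where I = "{k}", simplified]) auto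
    finally show "ennreal (exp (- 13 / 84 * (H t u)\<^sup>2)) * indicator (Sm m) u \<le> \<dots>" .
  qed
  also have "\<dots> = (\<Sum>k. ennreal (exp (- 13 / 84 * real k)) * emeasure (count_space S) (?A k))"
    using A by (subst nn_integral_suminf) (auto simp: nn_integral_cmult)
  also have "\<dots> \<le> (\<Sum>k. ennreal (B * exp (5 / 84) * exp (20 / 84 * (\<eta> m)\<^sup>2) * exp (- 8 / 84) ^ k))"
  proof (intro suminf_le summableI)
    fix k
    have "emeasure (count_space S) (?A k) = ennreal (real (card (?A k)))"
      using A ball_finite_card(1)[OF m t, of "real k + 1"]
      by (simp add: emeasure_count_space ennreal_of_nat_eq_real_of_nat)
    also have "\<dots> \<le> ennreal (B * exp (5 / 84 * (real k + 1 + 4 * (\<eta> m)\<^sup>2)))"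
      using ball_finite_card(2)[OF m t, of "real k + 1"] by (intro ennreal_leI) auto
    finally have "ennreal (exp (- 13 / 84 * real k)) * emeasure (count_space S) (?A k)
        \<le> ennreal (exp (- 13 / 84 * real k)) * ennreal (B * exp (5 / 84 * (real k + 1 + 4 * (\<eta> m)\<^sup>2)))"
      by (rule mult_left_mono) simp
    also have "\<dots> = ennreal (B * (exp (- 13 / 84 * real k) * exp (5 / 84 * (real k + 1 + 4 * (\<eta> m)\<^sup>2))))"
      using B_pos[OF m] by (simp add: ennreal_mult[symmetric] mult_ac)
    also have "exp (- 13 / 84 * real k) * exp (5 / 84 * (real k + 1 + 4 * (\<eta> m)\<^sup>2))
        = exp (5 / 84) * exp (20 / 84 * (\<eta> m)\<^sup>2) * exp (- 8 / 84) ^ k"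
      by (simp add: exp_add[symmetric] exp_of_nat_mult[symmetric] field_simps)
    finally show "ennreal (exp (- 13 / 84 * real k)) * emeasure (count_space S) (?A k)
        \<le> ennreal (B * exp (5 / 84) * exp (20 / 84 * (\<eta> m)\<^sup>2) * exp (- 8 / 84) ^ k)"
      by (simp add: mult_ac)
  qed
  also have "\<dots> = ennreal (B * exp (5 / 84) * exp (20 / 84 * (\<eta> m)\<^sup>2) * (1 / (1 - exp (- 8 / 84))))"
    using B_pos[OF m] by (intro suminf_ennreal_eq sums_mult geometric_sums) auto
  finally show ?thesis by (simp add: mult_ac)
qed

definition risk_const where "risk_const = 42 * (B * exp (5 / 84) / (1 - exp (- 8 / 84))) * Z"

text \<open>Absorbs the squared distance, as a loss, into 4/84 of the error exponent; 21 is
  84/4.\<close>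

lemma xexp_le: "x * exp (- 4 / 84 * x) \<le> 21" for x :: real
proof -
  have "x / 21 \<le> exp (x / 21)" using exp_ge_add_one_self[of "x / 21"] by linarith
  then have "x \<le> 21 * exp (4 / 84 * x)" by simp
  then have "x * exp (- 4 / 84 * x) \<le> 21 * exp (4 / 84 * x) * exp (- 4 / 84 * x)"
    by (rule mult_right_mono) simp
  also have "\<dots> = 21" by (simp add: exp_add[symmetric] mult.assoc)
  finally show ?thesis .
qed

theorem risk_le:
  assumes s: "s \<in> L1_plus M" and m: "m \<in> I" and t: "t \<in> Sm m"
  shows "(\<integral>\<^sup>+X. ennreal ((H s (est X))\<^sup>2) \<partial>poisson_law (intensity_measure M s))
    \<le> ennreal (34 * (H s t)\<^sup>2 + 21 / 2 * (\<eta> m)\<^sup>2 + risk_const)"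
proof -
  let ?P = "poisson_law (intensity_measure M s)"
  have fin: "finite_measure (intensity_measure M s)" by (rule finite_measure_intensity_measure[OF s])
  interpret P: prob_space ?P by (rule prob_space_poisson_law[OF fin])
  have sP: "sets ?P = sets (config_space M)"
    using config_space_cong[of "intensity_measure M s" M] by (simp add: sets_poisson_law)
  have spP: "space ?P = space (config_space M)" by (rule sets_eq_imp_space_eq[OF sP])
  have tS: "t \<in> S" using m t by (auto simp: S_def)
  note tL = S_L1[OF tS]
  define C0 where "C0 = B * exp (5 / 84) / (1 - exp (- 8 / 84))"
  have C0: "0 \<le> C0" using B_pos[OF m] by (simp add: C0_def)
  \<comment> \<open>For \<open>H t u\<close> beyond \<open>y\<close>, the terms
    \<open>4 * (H s t)\<^sup>2\<close> and \<open>(w t)\<^sup>2 / 4\<close> are at most 1/4 and 4/84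
    of \<open>(H t u)\<^sup>2\<close>. Of the coefficient 1/2 in \<open>lr_test_error\<close> there
    remains 1/2 - 1/4 - 4/84 = 17/84.\<close>
  define y where "y = sqrt (max (16 * (H s t)\<^sup>2) (21 / 4 * (w t)\<^sup>2))"
  have y0: "0 \<le> y" by (simp add: y_def le_max_iff_disj)
  have y2: "y\<^sup>2 = max (16 * (H s t)\<^sup>2) (21 / 4 * (w t)\<^sup>2)" by (simp add: y_def le_max_iff_disj)
  let ?ev = "\<lambda>u X. u \<noteq> t \<and> y \<le> H t u \<and> \<psi> t u X = u"
  let ?G = "\<lambda>u X. ennreal ((H t u)\<^sup>2) * (of_bool (?ev u X) :: ennreal)"
  \<comment> \<open>Of the 17/84, a share of 4/84 goes to \<open>xexp_le\<close> and 13/84 are left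
    for \<open>model_sum_le\<close>. Of the 21/84 on the weight, 20/84 compensate the factor lost in
    \<open>model_sum_le\<close> and 1/84 makes the sum over models converge.\<close>
  let ?f = "\<lambda>u. ennreal (21 * exp (- 13 / 84 * (H t u)\<^sup>2) * exp (- 21 / 84 * (w u)\<^sup>2))"
  have meas: "?G u \<in> borel_measurable ?P" if "u \<in> S" for u
  proof (cases "u = t")
    case False
    then have "{X \<in> space ?P. \<psi> t u X = u} \<in> sets ?P"
      using measurable_\<psi>[OF tS that] by (simp add: sP spP)
    then show ?thesis by measurable
  qed simp
  have each: "(\<integral>\<^sup>+X. ?G u X \<partial>?P) \<le> ?f u" if u: "u \<in> S" for u
  proof (cases "u \<noteq> t \<and> y \<le> H t u")
    case True
    let ?E = "{X \<in> space (config_space M). \<psi> t u X = u}"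
    have "measure ?P ?E \<le> exp (4 * (H s t)\<^sup>2 - (H t u)\<^sup>2 / 2 - ((w u)\<^sup>2 - (w t)\<^sup>2) / 4)"
      using lr_test_error[OF finite_measure_axioms tL S_L1[OF u] _ fin, of S w] True
      by (auto simp: \<psi>_def hellinger_fun_def)
    also have "\<dots> \<le> exp (- 17 / 84 * (H t u)\<^sup>2 - 21 / 84 * (w u)\<^sup>2)"
    proof -
      have "y\<^sup>2 \<le> (H t u)\<^sup>2" using True y0 by (intro power_mono) auto
      then have "16 * (H s t)\<^sup>2 \<le> (H t u)\<^sup>2" "21 / 4 * (w t)\<^sup>2 \<le> (H t u)\<^sup>2" by (auto simp: y2)
      then have "4 * (H s t)\<^sup>2 - (H t u)\<^sup>2 / 2 - ((w u)\<^sup>2 - (w t)\<^sup>2) / 4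
          \<le> - 17 / 84 * (H t u)\<^sup>2 - 21 / 84 * (w u)\<^sup>2"
        by argo
      then show ?thesis by (simp only: exp_le_cancel_iff)
    qed
    finally have E: "measure ?P ?E \<le> exp (- 17 / 84 * (H t u)\<^sup>2 - 21 / 84 * (w u)\<^sup>2)" .
    have "(H t u)\<^sup>2 * measure ?P ?E \<le> (H t u)\<^sup>2 * exp (- 17 / 84 * (H t u)\<^sup>2 - 21 / 84 * (w u)\<^sup>2)"
      using E by (rule mult_left_mono) simp
    also have "\<dots> = (H t u)\<^sup>2 * exp (- 4 / 84 * (H t u)\<^sup>2) * (exp (- 13 / 84 * (H t u)\<^sup>2) * exp (- 21 / 84 * (w u)\<^sup>2))"
      by (simp add: exp_add[symmetric] mult.assoc)
    also have "\<dots> \<le> 21 * (exp (- 13 / 84 * (H t u)\<^sup>2) * exp (- 21 / 84 * (w u)\<^sup>2))"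
      using xexp_le by (rule mult_right_mono) simp
    finally have le: "(H t u)\<^sup>2 * measure ?P ?E \<le> 21 * exp (- 13 / 84 * (H t u)\<^sup>2) * exp (- 21 / 84 * (w u)\<^sup>2)"
      by (simp add: mult.assoc)
    have Es: "?E \<in> sets ?P" using measurable_\<psi>[OF tS u] True by (auto simp: sP)
    have "(\<integral>\<^sup>+X. ?G u X \<partial>?P) = (\<integral>\<^sup>+X. ennreal ((H t u)\<^sup>2) * indicator ?E X \<partial>?P)"
      using True by (intro nn_integral_cong) (auto simp: indicator_def spP)
    also have "\<dots> = ennreal ((H t u)\<^sup>2 * measure ?P ?E)"
      using Es by (simp add: nn_integral_cmult P.emeasure_eq_measure ennreal_mult)
    also have "\<dots> \<le> ?f u" using le by (rule ennreal_leI)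
    finally show ?thesis .
  qed auto
  have "(\<integral>\<^sup>+X. (\<integral>\<^sup>+u. ?G u X \<partial>count_space S) \<partial>?P) = (\<integral>\<^sup>+u. (\<integral>\<^sup>+X. ?G u X \<partial>?P) \<partial>count_space S)"
    by (rule nn_integral_count_space_nn_integral[OF countable_S meas])
  also have "\<dots> \<le> (\<integral>\<^sup>+u. ?f u \<partial>count_space S)"
    by (rule nn_integral_mono) (use each in auto)
  \<comment> \<open>The weight of \<open>u\<close> is the radius of some model containing it, so
    that one term of the inner sum already dominates.\<close>
  also have "\<dots> \<le> (\<integral>\<^sup>+u. (\<integral>\<^sup>+m. ennreal (21 * exp (- 21 / 84 * (\<eta> m)\<^sup>2)) *
      (ennreal (exp (- 13 / 84 * (H t u)\<^sup>2)) * indicator (Sm m) u) \<partial>count_space I) \<partial>count_space S)"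
  proof (rule nn_integral_mono)
    fix u assume "u \<in> space (count_space S)"
    then have "u \<in> S" by simp
    then obtain k where k: "k \<in> I" "u \<in> Sm k" "w u = \<eta> k" by (rule weight_attained)
    have "?f u = ennreal (21 * exp (- 21 / 84 * (\<eta> k)\<^sup>2)) *
      (ennreal (exp (- 13 / 84 * (H t u)\<^sup>2)) * indicator (Sm k) u)"
      using k by (simp add: ennreal_mult[symmetric] mult_ac)
    also have "\<dots> \<le> (\<integral>\<^sup>+m. ennreal (21 * exp (- 21 / 84 * (\<eta> m)\<^sup>2)) *
      (ennreal (exp (- 13 / 84 * (H t u)\<^sup>2)) * indicator (Sm m) u) \<partial>count_space I)"
      by (rule nn_integral_ge_point[OF k(1)])
    finally show "?f u \<le> \<dots>" .
  qed
  also have "\<dots> = (\<integral>\<^sup>+m. (\<integral>\<^sup>+u. ennreal (21 * exp (- 21 / 84 * (\<eta> m)\<^sup>2)) *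
      (ennreal (exp (- 13 / 84 * (H t u)\<^sup>2)) * indicator (Sm m) u) \<partial>count_space S) \<partial>count_space I)"
    by (rule nn_integral_count_space_nn_integral) auto
  also have "\<dots> \<le> (\<integral>\<^sup>+m. ennreal (21 * C0) * ennreal (exp (- (\<eta> m)\<^sup>2 / 84)) \<partial>count_space I)"
  proof (rule nn_integral_mono)
    fix k assume "k \<in> space (count_space I)"
    then have k: "k \<in> I" by simp
    have "(\<integral>\<^sup>+u. ennreal (21 * exp (- 21 / 84 * (\<eta> k)\<^sup>2)) *
        (ennreal (exp (- 13 / 84 * (H t u)\<^sup>2)) * indicator (Sm k) u) \<partial>count_space S)
      = ennreal (21 * exp (- 21 / 84 * (\<eta> k)\<^sup>2)) *
        (\<integral>\<^sup>+u. ennreal (exp (- 13 / 84 * (H t u)\<^sup>2)) * indicator (Sm k) u \<partial>count_space S)"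
      by (rule nn_integral_cmult) simp
    also have "\<dots> \<le> ennreal (21 * exp (- 21 / 84 * (\<eta> k)\<^sup>2)) * ennreal (C0 * exp (20 / 84 * (\<eta> k)\<^sup>2))"
      using model_sum_le[OF k tL] unfolding C0_def by (rule mult_left_mono) simp
    also have "\<dots> = ennreal (21 * C0 * (exp (- 21 / 84 * (\<eta> k)\<^sup>2) * exp (20 / 84 * (\<eta> k)\<^sup>2)))"
      using C0 by (simp add: ennreal_mult[symmetric] mult_ac)
    also have "exp (- 21 / 84 * (\<eta> k)\<^sup>2) * exp (20 / 84 * (\<eta> k)\<^sup>2) = exp (- (\<eta> k)\<^sup>2 / 84)"
      by (simp add: exp_add[symmetric])
    finally show "(\<integral>\<^sup>+u. ennreal (21 * exp (- 21 / 84 * (\<eta> k)\<^sup>2)) *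
        (ennreal (exp (- 13 / 84 * (H t u)\<^sup>2)) * indicator (Sm k) u) \<partial>count_space S)
      \<le> ennreal (21 * C0) * ennreal (exp (- (\<eta> k)\<^sup>2 / 84))"
      using C0 by (simp add: ennreal_mult)
  qed
  also have "\<dots> = ennreal (21 * C0) * (\<integral>\<^sup>+m. ennreal (exp (- (\<eta> m)\<^sup>2 / 84)) \<partial>count_space I)"
    by (rule nn_integral_cmult) simp
  also have "\<dots> \<le> ennreal (21 * C0) * ennreal Z" by (rule mult_left_mono[OF Z(1)]) simp
  also have "\<dots> = ennreal (21 * C0 * Z)" using C0 Z(2) by (simp add: ennreal_mult)
  finally have sum: "(\<integral>\<^sup>+X. (\<integral>\<^sup>+u. ?G u X \<partial>count_space S) \<partial>?P) \<le> ennreal (21 * C0 * Z)" .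
  have mG: "(\<lambda>X. \<integral>\<^sup>+u. ?G u X \<partial>count_space S) \<in> borel_measurable ?P"
    by (rule borel_measurable_nn_integral_count_space[OF countable_S meas])
  have "(\<integral>\<^sup>+X. ennreal ((H s (est X))\<^sup>2) \<partial>?P)
      \<le> (\<integral>\<^sup>+X. ennreal (2 * (H s t)\<^sup>2 + 2 * y\<^sup>2) + 2 * (\<integral>\<^sup>+u. ?G u X \<partial>count_space S) \<partial>?P)"
  proof (rule nn_integral_mono)
    fix X
    have "ennreal ((H s (est X))\<^sup>2) \<le> ennreal (2 * (H s t)\<^sup>2 + 2 * (H t (est X))\<^sup>2)"
      by (intro ennreal_leI H_triangle s tL S_L1 est_in_S)
    also have "\<dots> = ennreal (2 * (H s t)\<^sup>2) + 2 * ennreal ((H t (est X))\<^sup>2)"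
      by (simp add: ennreal_mult)
    also have "\<dots> \<le> ennreal (2 * (H s t)\<^sup>2) + 2 * (ennreal (y\<^sup>2) + (\<integral>\<^sup>+u. ?G u X \<partial>count_space S))"
      using loss_le[OF tS y0, of X] by (intro add_left_mono mult_left_mono) auto
    also have "\<dots> = ennreal (2 * (H s t)\<^sup>2 + 2 * y\<^sup>2) + 2 * (\<integral>\<^sup>+u. ?G u X \<partial>count_space S)"
      by (simp add: distrib_left ennreal_mult add.assoc)
    finally show "ennreal ((H s (est X))\<^sup>2) \<le> \<dots>" .
  qed
  also have "\<dots> = ennreal (2 * (H s t)\<^sup>2 + 2 * y\<^sup>2) + 2 * (\<integral>\<^sup>+X. (\<integral>\<^sup>+u. ?G u X \<partial>count_space S) \<partial>?P)"
    using mG by (subst nn_integral_add) (auto simp: nn_integral_cmult P.emeasure_space_1)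
  also have "\<dots> \<le> ennreal (2 * (H s t)\<^sup>2 + 2 * y\<^sup>2) + 2 * ennreal (21 * C0 * Z)"
    by (intro add_left_mono mult_left_mono sum) simp
  also have "\<dots> = ennreal (2 * (H s t)\<^sup>2 + 2 * y\<^sup>2 + 42 * C0 * Z)"
    using C0 Z(2) by (simp add: ennreal_mult[symmetric] ennreal_plus[symmetric] del: ennreal_plus flip: ennreal_numeral)
  also have "\<dots> \<le> ennreal (34 * (H s t)\<^sup>2 + 21 / 2 * (\<eta> m)\<^sup>2 + risk_const)"
  proof (rule ennreal_leI)
    have "(w t)\<^sup>2 \<le> (\<eta> m)\<^sup>2" using weight_le[OF m t] weight_nonneg[OF tS] by (intro power_mono)
    moreover have "0 \<le> (H s t)\<^sup>2" "0 \<le> (\<eta> m)\<^sup>2" by simp_all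
    ultimately have "y\<^sup>2 \<le> 16 * (H s t)\<^sup>2 + 21 / 4 * (\<eta> m)\<^sup>2"
      unfolding y2 by (intro max.boundedI) linarith+
    then show "2 * (H s t)\<^sup>2 + 2 * y\<^sup>2 + 42 * C0 * Z \<le> 34 * (H s t)\<^sup>2 + 21 / 2 * (\<eta> m)\<^sup>2 + risk_const"
      by (simp add: risk_const_def C0_def)
  qed
  finally show ?thesis .
qed

end

section \<open>Lattice models\<close>

lemma sum_half_power_abs_le:
  assumes "finite (Y :: int set)"
  shows "(\<Sum>d\<in>Y. (1 / 2 :: real) ^ nat \<bar>d\<bar>) \<le> 4"
proof -
  have half: "(\<Sum>d\<in>A. (1 / 2 :: real) ^ nat \<bar>d\<bar>) \<le> 2" if "finite A" "inj_on (\<lambda>d. nat \<bar>d\<bar>) A" for A :: "int set"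
  proof -
    have "(\<Sum>d\<in>A. (1 / 2 :: real) ^ nat \<bar>d\<bar>) = (\<Sum>k\<in>(\<lambda>d. nat \<bar>d\<bar>) ` A. (1 / 2) ^ k)"
      using that by (simp add: sum.reindex)
    also have "\<dots> \<le> (\<Sum>k. (1 / 2) ^ k)"
      using that by (intro sum_le_suminf) (auto intro: summable_geometric)
    also have "\<dots> = 2" by (simp add: suminf_geometric)
    finally show ?thesis .
  qed
  have Y: "Y = {d\<in>Y. 0 \<le> d} \<union> {d\<in>Y. d < 0}" by auto
  have "(\<Sum>d\<in>Y. (1 / 2 :: real) ^ nat \<bar>d\<bar>) = (\<Sum>d\<in>{d\<in>Y. 0 \<le> d}. (1 / 2) ^ nat \<bar>d\<bar>) + (\<Sum>d\<in>{d\<in>Y. d < 0}. (1 / 2) ^ nat \<bar>d\<bar>)"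
    using assms by (subst Y, subst sum.union_disjoint) auto
  also have "\<dots> \<le> 2 + 2"
    by (intro add_mono half) (use assms in \<open>auto simp: inj_on_def\<close>)
  finally show ?thesis by simp
qed

text \<open>What matters is uniformity in the centre: each term is at most 4 times a term of the
  two-sided geometric series about the integer part of \<open>z\<close>.\<close>

lemma sum_gauss_int_le:
  fixes z :: real
  assumes "finite (Y :: int set)"
  shows "(\<Sum>y\<in>Y. exp (- (real_of_int y - z)\<^sup>2)) \<le> 16"
proof -
  have "exp (- (real_of_int y - z)\<^sup>2) \<le> 4 * (1 / 2) ^ nat \<bar>y - \<lfloor>z\<rfloor>\<bar>" for y
  proof -
    define x where "x = \<bar>real_of_int y - z\<bar>"
    define k where "k = nat \<bar>y - \<lfloor>z\<rfloor>\<bar>"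
    have "real_of_int \<bar>y - \<lfloor>z\<rfloor>\<bar> \<le> x + 1" unfolding x_def by linarith
    then have "real k \<le> x + 1" by (simp add: k_def)
    then have "(2 :: real) powr real k \<le> 2 powr (x + 1)" by (intro powr_mono) auto
    then have p: "(2 :: real) ^ k \<le> 2 powr (x + 1)" by (simp add: powr_realpow)
    have "2 powr (x + 1) = 2 * exp (x * ln 2)" by (simp add: powr_def distrib_right exp_add)
    also have "\<dots> \<le> 4 * exp (x\<^sup>2)"
    proof (cases "x \<le> 1")
      case True
      have "x * ln 2 \<le> ln 2" using mult_right_mono[OF True, of "ln 2"] by simp
      then have "exp (x * ln 2) \<le> exp (ln 2)" by (simp only: exp_le_cancel_iff)
      then have "exp (x * ln 2) \<le> 2" by simp
      moreover have "1 \<le> exp (x\<^sup>2)" by simp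
      ultimately show ?thesis by linarith
    next
      case False
      have "x * ln 2 \<le> x * 1" using ln_2_less_1 by (intro mult_left_mono) (auto simp: x_def)
      also have "\<dots> \<le> x\<^sup>2" using False by (simp add: power2_eq_square)
      finally have "exp (x * ln 2) \<le> exp (x\<^sup>2)" by simp
      moreover have "0 < exp (x\<^sup>2)" by simp
      ultimately show ?thesis by linarith
    qed
    finally have "(2 :: real) ^ k \<le> 4 * exp (x\<^sup>2)" using p by linarith
    moreover have "x\<^sup>2 = (real_of_int y - z)\<^sup>2" by (simp add: x_def)
    ultimately show ?thesis
      unfolding k_def[symmetric] by (simp add: exp_minus field_simps power_divide)
  qed
  then have "(\<Sum>y\<in>Y. exp (- (real_of_int y - z)\<^sup>2)) \<le> (\<Sum>y\<in>Y. 4 * (1 / 2) ^ nat \<bar>y - \<lfloor>z\<rfloor>\<bar>)"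
    by (intro sum_mono)
  also have "\<dots> = 4 * (\<Sum>d\<in>(\<lambda>y. y - \<lfloor>z\<rfloor>) ` Y. (1 / 2) ^ nat \<bar>d\<bar>)"
    by (simp add: sum.reindex inj_on_def sum_distrib_left)
  also have "\<dots> \<le> 4 * 4"
    using assms by (intro mult_left_mono sum_half_power_abs_le) auto
  finally show ?thesis by simp
qed

definition support_cost :: "'i set \<Rightarrow> ('i \<Rightarrow> real) \<Rightarrow> ('i \<Rightarrow> int) \<Rightarrow> real" where
  "support_cost F c n = (\<Sum>i\<in>F. if n i \<noteq> 0 then c i else 0)"

text \<open>Chernoff's argument: the conditions are replaced by an exponential weight, the sum of which
  factorizes over the coordinates.\<close>

lemma card_lattice_points:
  fixes z c :: "'i \<Rightarrow> real" and Q \<rho> :: real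
  assumes F: "finite F"
  defines "N \<equiv> {n \<in> F \<rightarrow>\<^sub>E (UNIV :: int set). support_cost F c n \<le> Q \<and> (\<Sum>i\<in>F. (real_of_int (n i) - z i)\<^sup>2) \<le> \<rho>}"
  shows "finite N" "real (card N) \<le> exp (\<rho> + Q + 16 * (\<Sum>i\<in>F. exp (- c i)))"
proof -
  \<comment> \<open>The bound on the squared distance confines each coordinate to an interval, so
    that the sum of the weights extends over a finite box only.\<close>
  define Y where "Y i = {\<lceil>z i - sqrt \<rho>\<rceil>..\<lfloor>z i + sqrt \<rho>\<rfloor>}" for i
  define f where "f i y = exp (- (real_of_int y - z i)\<^sup>2 - (if y \<noteq> 0 then c i else 0))" for i y
  have NY: "N \<subseteq> PiE F Y"
  proof
    fix n assume n: "n \<in> N"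
    have "n i \<in> Y i" if i: "i \<in> F" for i
    proof -
      have "(real_of_int (n i) - z i)\<^sup>2 \<le> (\<Sum>i\<in>F. (real_of_int (n i) - z i)\<^sup>2)"
        using F i by (intro member_le_sum) auto
      also have "\<dots> \<le> \<rho>" using n by (simp add: N_def)
      finally have "\<bar>real_of_int (n i) - z i\<bar> \<le> sqrt \<rho>" by (metis real_sqrt_abs real_sqrt_le_mono)
      then show ?thesis unfolding Y_def by (simp add: ceiling_le_iff le_floor_iff) linarith
    qed
    then show "n \<in> PiE F Y" using n by (auto simp: N_def PiE_iff)
  qed
  have finPi: "finite (PiE F Y)" using F by (intro finite_PiE) (auto simp: Y_def)
  show "finite N" by (rule finite_subset[OF NY finPi])
  have "real (card N) = (\<Sum>n\<in>N. 1)" by simp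
  also have "\<dots> \<le> (\<Sum>n\<in>N. exp (\<rho> + Q) * (\<Prod>i\<in>F. f i (n i)))"
  proof (rule sum_mono)
    fix n assume n: "n \<in> N"
    have "(\<Prod>i\<in>F. f i (n i)) = exp (- (\<Sum>i\<in>F. (real_of_int (n i) - z i)\<^sup>2) - support_cost F c n)"
      unfolding f_def using F by (simp add: exp_sum[symmetric] sum_subtractf sum_negf support_cost_def)
    then have "exp (\<rho> + Q) * (\<Prod>i\<in>F. f i (n i))
        = exp (\<rho> + Q - (\<Sum>i\<in>F. (real_of_int (n i) - z i)\<^sup>2) - support_cost F c n)"
      by (simp add: exp_add[symmetric] algebra_simps)
    moreover have "0 \<le> \<rho> + Q - (\<Sum>i\<in>F. (real_of_int (n i) - z i)\<^sup>2) - support_cost F c n"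
      using n by (simp add: N_def)
    ultimately show "1 \<le> exp (\<rho> + Q) * (\<Prod>i\<in>F. f i (n i))" by simp
  qed
  also have "\<dots> \<le> (\<Sum>n\<in>PiE F Y. exp (\<rho> + Q) * (\<Prod>i\<in>F. f i (n i)))"
    using finPi NY by (intro sum_mono2) (auto simp: f_def intro!: mult_nonneg_nonneg prod_nonneg)
  also have "\<dots> = exp (\<rho> + Q) * (\<Prod>i\<in>F. \<Sum>y\<in>Y i. f i y)"
    using F by (subst prod_sum_PiE) (auto simp: Y_def sum_distrib_left)
  also have "\<dots> \<le> exp (\<rho> + Q) * (\<Prod>i\<in>F. exp (16 * exp (- c i)))"
  proof (intro mult_left_mono prod_mono conjI)
    fix i
    \<comment> \<open>The coordinate 0 carries no cost and is bounded by 1; all others share the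
      factor \<open>exp (- c i)\<close>. Hence each factor of the product is at most
      \<open>1 + 16 * exp (- c i)\<close>.\<close>
    have "f i y \<le> (if y = 0 then 1 else 0) + exp (- c i) * exp (- (real_of_int y - z i)\<^sup>2)" for y
    proof (cases "y = 0")
      case True
      have "f i y \<le> 1" using True by (simp add: f_def)
      then show ?thesis using True by (simp add: add_increasing2)
    next
      case False
      then show ?thesis by (simp add: f_def exp_add[symmetric])
    qed
    then have "(\<Sum>y\<in>Y i. f i y) \<le> (\<Sum>y\<in>Y i. (if y = 0 then 1 else 0) + exp (- c i) * exp (- (real_of_int y - z i)\<^sup>2))"
      by (rule sum_mono)
    also have "\<dots> = (if 0 \<in> Y i then 1 else 0) + exp (- c i) * (\<Sum>y\<in>Y i. exp (- (real_of_int y - z i)\<^sup>2))"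
      by (simp add: sum.distrib sum_distrib_left Y_def)
    also have "\<dots> \<le> 1 + exp (- c i) * 16"
      by (intro add_mono mult_left_mono sum_gauss_int_le) (auto simp: Y_def)
    also have "\<dots> \<le> exp (16 * exp (- c i))"
      using exp_ge_add_one_self[of "16 * exp (- c i)"] by (simp add: mult.commute)
    finally show "(\<Sum>y\<in>Y i. f i y) \<le> exp (16 * exp (- c i))" .
  qed (auto simp: f_def intro: sum_nonneg)
  also have "\<dots> = exp (\<rho> + Q + 16 * (\<Sum>i\<in>F. exp (- c i)))"
    using F by (simp add: exp_sum[symmetric] sum_distrib_left exp_add)
  finally show "real (card N) \<le> exp (\<rho> + Q + 16 * (\<Sum>i\<in>F. exp (- c i)))" .
qed

section \<open>Orthonormal systems\<close>

definition L2 :: "'a measure \<Rightarrow> ('a \<Rightarrow> real) set" where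
  "L2 M = {f \<in> borel_measurable M. integrable M (\<lambda>x. (f x)\<^sup>2)}"

lemma L2_borel [dest]: "f \<in> L2 M \<Longrightarrow> f \<in> borel_measurable M"
  and L2_integrable: "f \<in> L2 M \<Longrightarrow> integrable M (\<lambda>x. (f x)\<^sup>2)"
  by (auto simp: L2_def)

lemma L2_mult_integrable:
  assumes "f \<in> L2 M" "g \<in> L2 M"
  shows "integrable M (\<lambda>x. f x * g x)"
proof (rule Bochner_Integration.integrable_bound)
  note [measurable] = L2_borel[OF assms(1)] L2_borel[OF assms(2)]
  show "integrable M (\<lambda>x. (f x)\<^sup>2 + (g x)\<^sup>2)" using assms by (simp add: L2_integrable)
  show "(\<lambda>x. f x * g x) \<in> borel_measurable M" by measurable
  have "\<bar>a * b\<bar> \<le> a\<^sup>2 + b\<^sup>2" for a b :: real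
  proof -
    have "0 \<le> (\<bar>a\<bar> - \<bar>b\<bar>)\<^sup>2" "0 \<le> a\<^sup>2" "0 \<le> b\<^sup>2" by simp_all
    moreover have "0 \<le> \<bar>a\<bar> * \<bar>b\<bar>" by simp
    ultimately show ?thesis unfolding power2_diff abs_mult power2_abs by linarith
  qed
  then show "AE x in M. norm (f x * g x) \<le> norm ((f x)\<^sup>2 + (g x)\<^sup>2)" by (intro AE_I2) simp
qed

lemma L2_diff: "f \<in> L2 M \<Longrightarrow> g \<in> L2 M \<Longrightarrow> (\<lambda>x. f x - g x) \<in> L2 M"
  by (auto simp: L2_def intro!: integrable_square_diff)

lemma L2_cmult: "f \<in> L2 M \<Longrightarrow> (\<lambda>x. c * f x) \<in> L2 M"
  by (auto simp: L2_def power_mult_distrib)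

lemma L2_zero: "(\<lambda>x. 0) \<in> L2 M"
  by (simp add: L2_def)

lemma L2_add: "f \<in> L2 M \<Longrightarrow> g \<in> L2 M \<Longrightarrow> (\<lambda>x. f x + g x) \<in> L2 M"
  using L2_diff[of f M "\<lambda>x. -1 * g x"] L2_cmult[of g M "-1"] by simp

lemma L2_sum:
  assumes "finite F" "\<And>i. i \<in> F \<Longrightarrow> e i \<in> L2 M"
  shows "(\<lambda>x. \<Sum>i\<in>F. c i * e i x) \<in> L2 M"
  using assms
proof (induction F)
  case (insert i F)
  then have "(\<lambda>x. c i * e i x + (\<Sum>i\<in>F. c i * e i x)) \<in> L2 M"
    by (intro L2_add L2_cmult insert.IH) auto
  then show ?case using insert by simp
qed (simp add: L2_zero)

lemma L2_pos_root: "t \<in> L1_plus M \<Longrightarrow> pos_root t \<in> L2 M"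
  by (auto simp: L2_def integrable_pos_root_power2 intro: borel_measurable_pos_root dest: L1_plusD)

definition orthonormal_on :: "'a measure \<Rightarrow> 'i set \<Rightarrow> ('i \<Rightarrow> 'a \<Rightarrow> real) \<Rightarrow> bool" where
  "orthonormal_on M F e \<longleftrightarrow> (\<forall>i\<in>F. e i \<in> L2 M) \<and>
     (\<forall>i\<in>F. \<forall>j\<in>F. (\<integral>x. e i x * e j x \<partial>M) = (if i = j then 1 else 0))"

lemma integral_diff_lincomb:
  assumes f: "f \<in> L2 M" and F: "finite F" and e: "orthonormal_on M F e"
  shows "(\<integral>x. (f x - (\<Sum>i\<in>F. c i * e i x))\<^sup>2 \<partial>M)
    = (\<integral>x. (f x)\<^sup>2 \<partial>M) - 2 * (\<Sum>i\<in>F. c i * (\<integral>x. f x * e i x \<partial>M)) + (\<Sum>i\<in>F. (c i)\<^sup>2)"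
proof -
  have eL: "i \<in> F \<Longrightarrow> e i \<in> L2 M" for i using e by (simp add: orthonormal_on_def)
  have fe: "i \<in> F \<Longrightarrow> integrable M (\<lambda>x. f x * e i x)" for i by (intro L2_mult_integrable f eL)
  have ee: "i \<in> F \<Longrightarrow> j \<in> F \<Longrightarrow> integrable M (\<lambda>x. e i x * e j x)" for i j by (intro L2_mult_integrable eL)
  have "(f x - (\<Sum>i\<in>F. c i * e i x))\<^sup>2
      = (f x)\<^sup>2 - 2 * (\<Sum>i\<in>F. c i * (f x * e i x)) + (\<Sum>i\<in>F. \<Sum>j\<in>F. c i * c j * (e i x * e j x))" for x
  proof -
    have "f x * (\<Sum>i\<in>F. c i * e i x) = (\<Sum>i\<in>F. c i * (f x * e i x))"
      by (simp add: sum_distrib_left mult_ac)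
    moreover have "(\<Sum>i\<in>F. c i * e i x)\<^sup>2 = (\<Sum>i\<in>F. \<Sum>j\<in>F. c i * c j * (e i x * e j x))"
      by (simp add: power2_eq_square sum_product mult_ac)
    ultimately show ?thesis unfolding power2_diff by (simp only: mult.assoc)
  qed
  then have "(\<integral>x. (f x - (\<Sum>i\<in>F. c i * e i x))\<^sup>2 \<partial>M)
      = (\<integral>x. (f x)\<^sup>2 - 2 * (\<Sum>i\<in>F. c i * (f x * e i x)) + (\<Sum>i\<in>F. \<Sum>j\<in>F. c i * c j * (e i x * e j x)) \<partial>M)"
    by simp
  also have "\<dots> = (\<integral>x. (f x)\<^sup>2 \<partial>M) - 2 * (\<Sum>i\<in>F. c i * (\<integral>x. f x * e i x \<partial>M))
      + (\<Sum>i\<in>F. \<Sum>j\<in>F. c i * c j * (\<integral>x. e i x * e j x \<partial>M))"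
    using fe ee L2_integrable[OF f]
    by (subst Bochner_Integration.integral_add Bochner_Integration.integral_diff; auto)+
  also have "(\<Sum>i\<in>F. \<Sum>j\<in>F. c i * c j * (\<integral>x. e i x * e j x \<partial>M)) = (\<Sum>i\<in>F. (c i)\<^sup>2)"
  proof (rule sum.cong[OF refl])
    fix i assume i: "i \<in> F"
    have "(\<Sum>j\<in>F. c i * c j * (\<integral>x. e i x * e j x \<partial>M)) = (\<Sum>j\<in>F. if i = j then (c i)\<^sup>2 else 0)"
      using e i by (intro sum.cong) (auto simp: orthonormal_on_def power2_eq_square)
    then show "(\<Sum>j\<in>F. c i * c j * (\<integral>x. e i x * e j x \<partial>M)) = (c i)\<^sup>2"
      using F i by simp
  qed
  finally show ?thesis .
qed

text \<open>The coefficients of \<open>f\<close> are those of its orthogonal projection, and a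
  combination of the \<open>e i\<close> is no farther from the projection than from
  \<open>f\<close>. Thus a ball of functions becomes a ball of coefficient vectors.\<close>

lemma bessel:
  assumes f: "f \<in> L2 M" and F: "finite F" and e: "orthonormal_on M F e"
  shows "(\<Sum>i\<in>F. (c i - (\<integral>x. f x * e i x \<partial>M))\<^sup>2) \<le> (\<integral>x. (f x - (\<Sum>i\<in>F. c i * e i x))\<^sup>2 \<partial>M)"
proof -
  define z where "z i = (\<integral>x. f x * e i x \<partial>M)" for i
  have "0 \<le> (\<integral>x. (f x - (\<Sum>i\<in>F. z i * e i x))\<^sup>2 \<partial>M)" by simp
  also have "\<dots> = (\<integral>x. (f x)\<^sup>2 \<partial>M) - (\<Sum>i\<in>F. (z i)\<^sup>2)"
    unfolding integral_diff_lincomb[OF f F e] z_def[symmetric] by (simp add: power2_eq_square)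
  finally have "(\<Sum>i\<in>F. (z i)\<^sup>2) \<le> (\<integral>x. (f x)\<^sup>2 \<partial>M)" by simp
  moreover have "(\<Sum>i\<in>F. (c i - z i)\<^sup>2) = (\<Sum>i\<in>F. (c i)\<^sup>2) - 2 * (\<Sum>i\<in>F. c i * z i) + (\<Sum>i\<in>F. (z i)\<^sup>2)"
    by (simp add: power2_diff sum.distrib sum_subtractf sum_distrib_left mult_ac)
  ultimately show ?thesis
    unfolding integral_diff_lincomb[OF f F e] z_def[symmetric] by simp
qed

lemma integral_lincomb_square:
  assumes F: "finite F" and e: "orthonormal_on M F e"
  shows "(\<integral>x. (\<Sum>i\<in>F. c i * e i x)\<^sup>2 \<partial>M) = (\<Sum>i\<in>F. (c i)\<^sup>2)"
  using integral_diff_lincomb[OF L2_zero F e, of c] by simp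

text \<open>The choice depends on the class only, so that any set of such representatives, in
  particular the union of all models, satisfies \<open>distinct_classes\<close>.\<close>

definition class_rep :: "'a measure \<Rightarrow> ('a \<Rightarrow> real) \<Rightarrow> 'a \<Rightarrow> real" where
  "class_rep M t = (SOME u. u \<in> L1_plus M \<and> (AE x in M. u x = t x))"

lemma class_rep:
  assumes "t \<in> L1_plus M"
  shows "class_rep M t \<in> L1_plus M" "AE x in M. class_rep M t x = t x"
proof -
  have "\<exists>u. u \<in> L1_plus M \<and> (AE x in M. u x = t x)" using assms by (intro exI[of _ t]) simp
  from someI_ex[OF this] show "class_rep M t \<in> L1_plus M" "AE x in M. class_rep M t x = t x"
    by (simp_all add: class_rep_def)
qed

lemma distinct_classes_class_rep:
  assumes "T \<subseteq> class_rep M ` L1_plus M"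
  shows "distinct_classes M T"
  unfolding distinct_classes_def
proof (intro ballI impI)
  fix u v assume "u \<in> T" "v \<in> T" and uv: "AE x in M. u x = v x"
  then obtain t t' where t: "u = class_rep M t" "t \<in> L1_plus M" "v = class_rep M t'" "t' \<in> L1_plus M"
    using assms by blast
  have "AE x in M. t x = t' x"
    using uv class_rep(2)[OF t(2)] class_rep(2)[OF t(4)] unfolding t by eventually_elim simp
  then have "(AE x in M. f x = t x) \<longleftrightarrow> (AE x in M. f x = t' x)" for f
  proof -
    assume tt': "AE x in M. t x = t' x"
    show ?thesis
    proof
      assume "AE x in M. f x = t x" with tt' show "AE x in M. f x = t' x" by eventually_elim simp
    next
      assume "AE x in M. f x = t' x" with tt' show "AE x in M. f x = t x" by eventually_elim simp
    qed
  qed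
  then show "u = v" unfolding t class_rep_def by simp
qed

section \<open>Intensities from functions of any sign\<close>

definition square_pos :: "('a \<Rightarrow> real) \<Rightarrow> 'a \<Rightarrow> real" where
  "square_pos g x = (max (g x) 0)\<^sup>2"

definition neg_part :: "('a \<Rightarrow> real) \<Rightarrow> 'a \<Rightarrow> real" where
  "neg_part g x = max (- g x) 0"

lemma square_pos_L1_plus:
  assumes "g \<in> L2 M"
  shows "square_pos g \<in> L1_plus M"
proof -
  note [measurable] = L2_borel[OF assms]
  have "integrable M (square_pos g)"
  proof (rule Bochner_Integration.integrable_bound[OF L2_integrable[OF assms]])
    show "square_pos g \<in> borel_measurable M" unfolding square_pos_def by measurable
    show "AE x in M. norm (square_pos g x) \<le> norm ((g x)\<^sup>2)"
      by (intro AE_I2) (auto simp: square_pos_def max_def)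
  qed
  then show ?thesis by (simp add: L1_plus_def square_pos_def)
qed

lemma L2_neg_part:
  assumes "g \<in> L2 M"
  shows "neg_part g \<in> L2 M"
proof -
  note [measurable] = L2_borel[OF assms]
  have m: "neg_part g \<in> borel_measurable M" unfolding neg_part_def by measurable
  have "integrable M (\<lambda>x. (neg_part g x)\<^sup>2)"
  proof (rule Bochner_Integration.integrable_bound[OF L2_integrable[OF assms]])
    show "(\<lambda>x. (neg_part g x)\<^sup>2) \<in> borel_measurable M" using m by measurable
    show "AE x in M. norm ((neg_part g x)\<^sup>2) \<le> norm ((g x)\<^sup>2)"
      by (intro AE_I2) (auto simp: neg_part_def max_def)
  qed
  then show ?thesis using m by (simp add: L2_def)
qed

lemma hellinger_class_rep:
  assumes M: "sigma_finite_measure M" and t: "t \<in> L1_plus M" and g: "g \<in> L2 M"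
  shows "2 * (hellinger_fun M t (class_rep M (square_pos g)))\<^sup>2 = (\<integral>x. (pos_root t x - max (g x) 0)\<^sup>2 \<partial>M)"
proof -
  note r = class_rep[OF square_pos_L1_plus[OF g]]
  note [measurable] = L2_borel[OF g] L1_plusD(2)[OF t] L1_plusD(2)[OF r(1)]
  have "(\<integral>x. (pos_root t x - pos_root (class_rep M (square_pos g)) x)\<^sup>2 \<partial>M)
      = (\<integral>x. (pos_root t x - max (g x) 0)\<^sup>2 \<partial>M)"
  proof (rule integral_cong_AE)
    show "AE x in M. (pos_root t x - pos_root (class_rep M (square_pos g)) x)\<^sup>2 = (pos_root t x - max (g x) 0)\<^sup>2"
      using r(2) by eventually_elim (simp add: pos_root_def square_pos_def)
  qed auto
  then show ?thesis using hellinger_fun_power2[OF M t r(1)] by simp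
qed

text \<open>With mesh 12 a squared \<open>L2\<close> distance
  \<open>4 * x\<^sup>2 * \<eta>\<^sup>2\<close> becomes
  \<open>x\<^sup>2 * \<eta>\<^sup>2 / 36\<close> for the integer vectors, which is below the
  admissible exponent \<open>5 / 84 * x\<^sup>2 * \<eta>\<^sup>2\<close>.\<close>

definition lattice_fun :: "('i \<Rightarrow> 'a \<Rightarrow> real) \<Rightarrow> 'i set \<Rightarrow> ('i \<Rightarrow> int) \<Rightarrow> 'a \<Rightarrow> real" where
  "lattice_fun e F n x = (\<Sum>i\<in>F. 12 * real_of_int (n i) * e i x)"

lemma L2_lattice_fun:
  assumes "finite F" "orthonormal_on M F e"
  shows "lattice_fun e F n \<in> L2 M"
  unfolding lattice_fun_def using assms by (intro L2_sum) (auto simp: orthonormal_on_def)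

text \<open>Lattice points with a large negative part are left out: for the others the positive part is close
  to the point, so that taking it does not increase the number of points in a ball much.\<close>

definition lattice_model ::
  "'a measure \<Rightarrow> ('i \<Rightarrow> 'a \<Rightarrow> real) \<Rightarrow> 'i set \<Rightarrow> ('i \<Rightarrow> real) \<Rightarrow> real \<Rightarrow> real \<Rightarrow> ('a \<Rightarrow> real) set" where
  "lattice_model M e F c Q \<eta> = (\<lambda>n. class_rep M (square_pos (lattice_fun e F n))) `
     {n \<in> F \<rightarrow>\<^sub>E UNIV. support_cost F c n \<le> Q \<and> (\<integral>x. (neg_part (lattice_fun e F n) x)\<^sup>2 \<partial>M) \<le> \<eta>\<^sup>2}"

lemma lattice_model_subset:
  assumes "finite F" "orthonormal_on M F e"
  shows "lattice_model M e F c Q \<eta> \<subseteq> class_rep M ` L1_plus M"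
  using square_pos_L1_plus[OF L2_lattice_fun[OF assms]] by (auto simp: lattice_model_def)

text \<open>A Hellinger ball bounds the distance to the positive part; the small negative part
  extends this to the lattice function itself, Bessel's inequality to its integer vector, and
  \<open>card_lattice_points\<close> counts those vectors.\<close>

lemma D_model_lattice_model:
  assumes M: "sigma_finite_measure M" and F: "finite F" and e: "orthonormal_on M F e" and \<eta>: "0 < \<eta>"
    and Q: "8 * (Q + 16 * (\<Sum>i\<in>F. exp (- c i))) \<le> \<eta>\<^sup>2"
  shows "D_model M \<eta> (5 * \<eta>\<^sup>2 / 84) 1 (lattice_model M e F c Q \<eta>)"
  unfolding D_model_def
proof (intro conjI allI impI ballI)
  let ?S = "lattice_model M e F c Q \<eta>"
  note sub = lattice_model_subset[OF F e, of c Q \<eta>]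
  show "?S \<subseteq> L1_plus M" using sub class_rep(1) by blast
  show "distinct_classes M ?S" by (rule distinct_classes_class_rep[OF sub])
  fix x :: real and t assume x: "2 \<le> x" and t: "t \<in> L1_plus M"
  define z where "z i = (\<integral>y. pos_root t y * e i y \<partial>M) / 12" for i
  define N where "N = {n \<in> F \<rightarrow>\<^sub>E (UNIV :: int set). support_cost F c n \<le> Q \<and>
    (\<Sum>i\<in>F. (real_of_int (n i) - z i)\<^sup>2) \<le> x\<^sup>2 * \<eta>\<^sup>2 / 36}"
  have x2: "4 \<le> x\<^sup>2" using power_mono[OF x, of 2] by simp
  note N = card_lattice_points[OF F, where c = c and Q = Q and z = z and \<rho> = "x\<^sup>2 * \<eta>\<^sup>2 / 36", folded N_def]
  have sub: "{u \<in> ?S. hellinger_fun M t u < x * \<eta>} \<subseteq> (\<lambda>n. class_rep M (square_pos (lattice_fun e F n))) ` N"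
  proof
    fix u assume u: "u \<in> {u \<in> ?S. hellinger_fun M t u < x * \<eta>}"
    then obtain n where n: "n \<in> F \<rightarrow>\<^sub>E UNIV" "support_cost F c n \<le> Q"
        "(\<integral>x. (neg_part (lattice_fun e F n) x)\<^sup>2 \<partial>M) \<le> \<eta>\<^sup>2"
      and ueq: "u = class_rep M (square_pos (lattice_fun e F n))"
      by (auto simp: lattice_model_def)
    define g where "g = lattice_fun e F n"
    have g: "g \<in> L2 M" unfolding g_def by (rule L2_lattice_fun[OF F e])
    note [measurable] = L2_borel[OF g]
    have gp: "(\<lambda>y. max (g y) 0) \<in> L2 M"
    proof -
      have "(\<lambda>y. g y + neg_part g y) \<in> L2 M" by (intro L2_add L2_neg_part g)
      moreover have "(\<lambda>y. g y + neg_part g y) = (\<lambda>y. max (g y) 0)" by (auto simp: neg_part_def max_def)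
      ultimately show ?thesis by simp
    qed
    have "(hellinger_fun M t u)\<^sup>2 \<le> (x * \<eta>)\<^sup>2" using u by (intro power_mono) auto
    then have p: "(\<integral>y. (pos_root t y - max (g y) 0)\<^sup>2 \<partial>M) \<le> 2 * (x\<^sup>2 * \<eta>\<^sup>2)"
      unfolding hellinger_class_rep[OF M t g, symmetric] ueq[folded g_def, symmetric] by (simp add: power_mult_distrib)
    have ip: "integrable M (\<lambda>y. (pos_root t y - max (g y) 0)\<^sup>2)" "integrable M (\<lambda>y. (pos_root t y - g y)\<^sup>2)"
      "integrable M (\<lambda>y. (neg_part g y)\<^sup>2)"
      using L2_integrable L2_diff L2_pos_root[OF t] gp g L2_neg_part[OF g] by blast+
    have "(\<integral>y. (pos_root t y - g y)\<^sup>2 \<partial>M)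
        \<le> (\<integral>y. 3 / 2 * (pos_root t y - max (g y) 0)\<^sup>2 + 3 * (neg_part g y)\<^sup>2 \<partial>M)"
    proof (rule integral_mono)
      fix y
      \<comment> \<open>The uneven weights give
        \<open>3 * x\<^sup>2 * \<eta>\<^sup>2 + 3 * \<eta>\<^sup>2\<close>, which stays below
        \<open>4 * x\<^sup>2 * \<eta>\<^sup>2\<close> because \<open>x\<close> is at least 2; equal
        weights would exceed it.\<close>
      have "(a + b)\<^sup>2 \<le> 3 / 2 * a\<^sup>2 + 3 * b\<^sup>2" for a b :: real
      proof -
        have "0 \<le> (a - 2 * b)\<^sup>2 / 2" by simp
        then show ?thesis by (simp add: power2_eq_square field_simps)
      qed
      from this[of "pos_root t y - max (g y) 0" "neg_part g y"]
      show "(pos_root t y - g y)\<^sup>2 \<le> 3 / 2 * (pos_root t y - max (g y) 0)\<^sup>2 + 3 * (neg_part g y)\<^sup>2"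
        by (simp add: neg_part_def max_def split: if_splits)
    qed (use ip in auto)
    also have "\<dots> = 3 / 2 * (\<integral>y. (pos_root t y - max (g y) 0)\<^sup>2 \<partial>M) + 3 * (\<integral>y. (neg_part g y)\<^sup>2 \<partial>M)"
      using ip by simp
    also have "\<dots> \<le> 3 * (x\<^sup>2 * \<eta>\<^sup>2) + 3 * \<eta>\<^sup>2" using p n(3) by (simp add: g_def)
    also have "\<dots> \<le> 4 * (x\<^sup>2 * \<eta>\<^sup>2)"
      using mult_right_mono[OF x2, of "\<eta>\<^sup>2"] zero_le_power2[of \<eta>] by linarith
    finally have d: "(\<integral>y. (pos_root t y - g y)\<^sup>2 \<partial>M) \<le> 4 * (x\<^sup>2 * \<eta>\<^sup>2)" .
    have "144 * (\<Sum>i\<in>F. (real_of_int (n i) - z i)\<^sup>2)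
        = (\<Sum>i\<in>F. (12 * real_of_int (n i) - (\<integral>y. pos_root t y * e i y \<partial>M))\<^sup>2)"
      unfolding z_def sum_distrib_left by (intro sum.cong) (auto simp: power2_eq_square field_simps)
    also have "\<dots> \<le> (\<integral>y. (pos_root t y - g y)\<^sup>2 \<partial>M)"
      unfolding g_def lattice_fun_def by (rule bessel[OF L2_pos_root[OF t] F e])
    finally have "(\<Sum>i\<in>F. (real_of_int (n i) - z i)\<^sup>2) \<le> x\<^sup>2 * \<eta>\<^sup>2 / 36" using d by simp
    then have "n \<in> N" using n by (simp add: N_def)
    then show "u \<in> (\<lambda>n. class_rep M (square_pos (lattice_fun e F n))) ` N" using ueq by blast
  qed
  show "finite {u \<in> ?S. hellinger_fun M t u < x * \<eta>}" by (rule finite_subset[OF sub]) (use N in simp)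
  have "real (card {u \<in> ?S. hellinger_fun M t u < x * \<eta>}) \<le> real (card N)"
    using card_mono[OF _ sub] card_image_le[OF N(1), of "\<lambda>n. class_rep M (square_pos (lattice_fun e F n))"] N(1)
    by fastforce
  also note N(2)
  also have "exp (x\<^sup>2 * \<eta>\<^sup>2 / 36 + Q + 16 * (\<Sum>i\<in>F. exp (- c i))) \<le> exp (5 * \<eta>\<^sup>2 / 84 * x\<^sup>2)"
  proof -
    \<comment> \<open>By \<open>Q\<close> the last two terms of the exponent are at most
      \<open>\<eta>\<^sup>2 / 8\<close>, hence at most
      \<open>x\<^sup>2 * \<eta>\<^sup>2 / 32\<close>, and 1/36 + 1/32 is less than 5/84.\<close>
    have "4 * \<eta>\<^sup>2 \<le> x\<^sup>2 * \<eta>\<^sup>2" using x2 by (rule mult_right_mono) simp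
    then have "x\<^sup>2 * \<eta>\<^sup>2 / 36 + Q + 16 * (\<Sum>i\<in>F. exp (- c i)) \<le> 5 / 84 * (x\<^sup>2 * \<eta>\<^sup>2)"
      using Q zero_le_power2[of \<eta>] by argo
    then show ?thesis by (simp add: mult_ac)
  qed
  finally show "real (card {u \<in> ?S. hellinger_fun M t u < x * \<eta>}) \<le> 1 * exp (5 * \<eta>\<^sup>2 / 84 * x\<^sup>2)" by simp
qed (use \<eta> in auto)

text \<open>As the root of \<open>s\<close> is nonnegative, the negative part of a lattice function
  is at most its distance to the root, and its positive part is at least as close to the root. So a
  good approximation is never among the discarded points.\<close>

lemma lattice_model_approx:
  assumes M: "sigma_finite_measure M" and F: "finite F" and e: "orthonormal_on M F e"
    and s: "s \<in> L1_plus M" and n: "n \<in> F \<rightarrow>\<^sub>E UNIV" "support_cost F c n \<le> Q"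
    and le: "(\<integral>x. (pos_root s x - lattice_fun e F n x)\<^sup>2 \<partial>M) \<le> \<eta>\<^sup>2"
  shows "\<exists>u\<in>lattice_model M e F c Q \<eta>. (hellinger_fun M s u)\<^sup>2 \<le> \<eta>\<^sup>2 / 2"
proof -
  define g where "g = lattice_fun e F n"
  have g: "g \<in> L2 M" unfolding g_def by (rule L2_lattice_fun[OF F e])
  note [measurable] = L2_borel[OF g] L1_plusD(2)[OF s]
  have i: "integrable M (\<lambda>x. (pos_root s x - g x)\<^sup>2)"
    by (intro L2_integrable L2_diff L2_pos_root s g)
  have i': "integrable M (\<lambda>x. (neg_part g x)\<^sup>2)" by (intro L2_integrable L2_neg_part g)
  have ptw: "(neg_part g x)\<^sup>2 \<le> (pos_root s x - g x)\<^sup>2"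
      "(pos_root s x - max (g x) 0)\<^sup>2 \<le> (pos_root s x - g x)\<^sup>2" for x
  proof -
    have "0 \<le> pos_root s x" by simp
    then show "(neg_part g x)\<^sup>2 \<le> (pos_root s x - g x)\<^sup>2"
      "(pos_root s x - max (g x) 0)\<^sup>2 \<le> (pos_root s x - g x)\<^sup>2"
      unfolding abs_le_square_iff[symmetric] neg_part_def by linarith+
  qed
  have "(\<integral>x. (neg_part g x)\<^sup>2 \<partial>M) \<le> \<eta>\<^sup>2"
    by (rule order_trans[OF integral_mono[OF i' i ptw(1)]]) (use le in \<open>simp add: g_def\<close>)
  then have "class_rep M (square_pos g) \<in> lattice_model M e F c Q \<eta>"
    using n by (auto simp: lattice_model_def g_def)
  moreover have "2 * (hellinger_fun M s (class_rep M (square_pos g)))\<^sup>2 \<le> \<eta>\<^sup>2"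
    unfolding hellinger_class_rep[OF M s g]
  proof (rule order_trans[OF integral_mono[OF _ i ptw(2)]])
    show "integrable M (\<lambda>x. (pos_root s x - max (g x) 0)\<^sup>2)"
      by (rule Bochner_Integration.integrable_bound[OF i]) (use ptw(2) in auto)
  qed (use le in \<open>simp add: g_def\<close>)
  ultimately show ?thesis by (intro bexI[of _ "class_rep M (square_pos g)"]) auto
qed

section \<open>Lattice models in a wavelet basis\<close>

lemma prob_space_cube_measure: "prob_space (cube_measure :: (real ^ 'n) measure)"
proof (rule prob_spaceI)
  have "emeasure lborel (cbox (0 :: real ^ 'n) 1) = (\<Prod>b\<in>Basis. ((1 :: real ^ 'n) - 0) \<bullet> b)"
    by (rule emeasure_lborel_cbox) (auto simp: Basis_vec_def inner_axis)
  also have "(\<Prod>b\<in>Basis. ((1 :: real ^ 'n) - 0) \<bullet> b) = 1"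
    by (intro prod.neutral) (auto simp: Basis_vec_def inner_axis)
  finally show "emeasure cube_measure (space (cube_measure :: (real ^ 'n) measure)) = 1"
    by (simp add: cube_measure_def emeasure_restrict_space space_restrict_space)
qed

lemma finite_measure_cube_measure: "finite_measure (cube_measure :: (real ^ 'n) measure)"
  by (rule prob_space.axioms(1)[OF prob_space_cube_measure])

lemma square_integrable_iff: "square_integrable f \<longleftrightarrow> f \<in> L2 cube_measure"
  by (simp add: square_integrable_def L2_def)

definition scales :: "(int \<Rightarrow> 'k set) \<Rightarrow> nat \<Rightarrow> (int \<times> 'k) set" where
  "scales \<Lambda> N = Sigma {-1..int N} \<Lambda>"

text \<open>The factor \<open>l + 1\<close> makes \<open>exp (- level_cost l J (j, k))\<close> at most \<open>2\<close> to the power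
  \<open>- (j - J) (l + 1)\<close>, which is summable against the number \<open>2\<^sup>j\<^sup>l\<close> of indices at level \<open>j\<close>.\<close>

definition level_cost :: "nat \<Rightarrow> nat \<Rightarrow> int \<times> 'k \<Rightarrow> real" where
  "level_cost l J i = real (l + 1) * max 0 (real_of_int (fst i) - real J)"

text \<open>No coefficient above this level can be nonzero if the total cost is at most \<open>2 ^ (J * l)\<close>.\<close>

definition top_scale :: "nat \<Rightarrow> nat \<Rightarrow> nat" where
  "top_scale l J = J + 2 ^ (J * l)"

text \<open>The factor \<open>real r + 1\<close> makes the family summable over the bases as well.
  The constant is 40 * 84, above the largest value asked of it, 2880 in
  \<open>wavelet_models_unbounded\<close>.\<close>

definition model_radius :: "nat \<Rightarrow> real \<Rightarrow> nat \<Rightarrow> nat \<Rightarrow> real" where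
  "model_radius l \<Gamma> r J = sqrt (3360 * (real r + 1) * max \<Gamma> 1 * 2 ^ (J * l))"

lemma model_radius_power2: "(model_radius l \<Gamma> r J)\<^sup>2 = 3360 * (real r + 1) * max \<Gamma> 1 * 2 ^ (J * l)"
  by (simp add: model_radius_def)

lemma model_radius_pos: "0 < model_radius l \<Gamma> r J"
  by (auto simp: model_radius_def)

lemma model_radius_ge: "3360 * (max \<Gamma> 1 * 2 ^ (J * l)) \<le> (model_radius l \<Gamma> r J)\<^sup>2"
proof -
  have "3360 * 1 * (max \<Gamma> 1 * 2 ^ (J * l)) \<le> 3360 * (real r + 1) * (max \<Gamma> 1 * 2 ^ (J * l))"
    by (intro mult_right_mono mult_left_mono) auto
  then show ?thesis by (simp add: model_radius_power2 mult.assoc)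
qed

definition wavelet_model ::
  "(int \<Rightarrow> 'k set) \<Rightarrow> (int \<Rightarrow> 'k \<Rightarrow> real ^ 'n \<Rightarrow> real) \<Rightarrow> nat \<Rightarrow> real \<Rightarrow> (real ^ 'n \<Rightarrow> real) set" where
  "wavelet_model \<Lambda> \<phi> J \<eta> = lattice_model cube_measure (case_prod \<phi>)
     (scales \<Lambda> (top_scale CARD('n) J)) (level_cost CARD('n) J) (2 ^ (J * CARD('n))) \<eta>"

text \<open>Rounding is towards zero and not to the nearest multiple, so that only coefficients of
  size at least 12 receive a nonzero integer and thus a cost.\<close>

definition trunc12 :: "real \<Rightarrow> int" where
  "trunc12 b = (if 0 \<le> b then \<lfloor>b / 12\<rfloor> else \<lceil>b / 12\<rceil>)"

lemma trunc12_error: "\<bar>b - 12 * real_of_int (trunc12 b)\<bar> \<le> 12"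
  unfolding trunc12_def by (auto; linarith)

lemma trunc12_zero: "\<bar>b\<bar> < 12 \<Longrightarrow> trunc12 b = 0"
  unfolding trunc12_def by (auto simp: floor_eq_iff ceiling_eq_iff)

lemma trunc12_error_square: "(b - 12 * real_of_int (trunc12 b))\<^sup>2 \<le> 144"
  using power_mono[OF trunc12_error, of b 2] by simp

text \<open>One quantity controls both the rounding error and the number of nonzero integers. Below
  1 the error is \<open>b\<^sup>2\<close>, smaller than the power because \<open>q \<le> 2\<close>;
  above 1 the power is at least 1.\<close>

lemma trunc12_powr:
  assumes "0 < q" "q \<le> 2"
  shows "(b - 12 * real_of_int (trunc12 b))\<^sup>2 \<le> 144 * \<bar>b\<bar> powr q"
    and "of_bool (trunc12 b \<noteq> 0) \<le> \<bar>b\<bar> powr q"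
proof -
  have ge1: "1 \<le> \<bar>b\<bar> powr q" if "1 \<le> \<bar>b\<bar>"
    using that assms by (intro ge_one_powr_ge_zero) auto
  show "of_bool (trunc12 b \<noteq> 0) \<le> \<bar>b\<bar> powr q"
    using ge1 trunc12_zero[of b] by (cases "\<bar>b\<bar> < 12") auto
  show "(b - 12 * real_of_int (trunc12 b))\<^sup>2 \<le> 144 * \<bar>b\<bar> powr q"
  proof (cases "1 \<le> \<bar>b\<bar>")
    case True
    then show ?thesis using trunc12_error_square[of b] ge1 by linarith
  next
    case False
    have "b\<^sup>2 \<le> \<bar>b\<bar> powr q"
    proof (cases "b = 0")
      case False
      then have "b\<^sup>2 = \<bar>b\<bar> powr 2" by (simp add: powr_numeral)
      also have "\<dots> \<le> \<bar>b\<bar> powr q" using assms \<open>\<not> 1 \<le> \<bar>b\<bar>\<close> False by (intro powr_mono') auto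
      finally show ?thesis .
    qed simp
    moreover have "0 \<le> \<bar>b\<bar> powr q" by simp
    ultimately have "b\<^sup>2 \<le> 144 * \<bar>b\<bar> powr q" by linarith
    then show ?thesis using False by (simp add: trunc12_zero)
  qed
qed

lemma atLeastAtMost_minus_one: "{-1..int N} = insert (-1) (int ` {..N})"
proof -
  have "int ` {..N} = {0..int N}" by (simp add: atMost_atLeast0 image_int_atLeastAtMost)
  then show ?thesis by auto
qed

context
  fixes \<Gamma> :: real and \<Lambda> :: "int \<Rightarrow> 'k set" and \<phi> :: "int \<Rightarrow> 'k \<Rightarrow> real ^ 'n \<Rightarrow> real"
  assumes wb: "wavelet_basis \<Gamma> \<Lambda> \<phi>"
begin

section \<open>Metric dimension of the wavelet models\<close>

lemma finite_level: "-1 \<le> j \<Longrightarrow> finite (\<Lambda> j)"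
  using wb by (simp add: wavelet_basis_def)

lemma finite_scales: "finite (scales \<Lambda> N)"
  unfolding scales_def by (intro finite_SigmaI) (auto simp: finite_level)

lemma card_level: "real (card (\<Lambda> (int j))) \<le> max \<Gamma> 1 * 2 ^ (j * CARD('n))"
proof -
  have "real (card (\<Lambda> (int j))) \<le> \<Gamma> * 2 ^ (j * CARD('n))" using wb by (simp add: wavelet_basis_def)
  also have "\<dots> \<le> max \<Gamma> 1 * 2 ^ (j * CARD('n))" by (intro mult_right_mono) auto
  finally show ?thesis .
qed

lemma card_coarse: "real (card (\<Lambda> (-1))) \<le> max \<Gamma> 1"
proof -
  have "real (card (\<Lambda> (-1))) \<le> \<Gamma>" using wb by (simp add: wavelet_basis_def)
  then show ?thesis by linarith
qed

lemma sum_scales: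
  "(\<Sum>i\<in>scales \<Lambda> N. f i) = (\<Sum>k\<in>\<Lambda> (-1). f (-1, k)) + (\<Sum>j\<le>N. \<Sum>k\<in>\<Lambda> (int j). f (int j, k))"
proof -
  have "(\<Sum>i\<in>scales \<Lambda> N. f i) = (\<Sum>j\<in>{-1..int N}. \<Sum>k\<in>\<Lambda> j. f (j, k))"
    unfolding scales_def by (subst sum.Sigma) (auto simp: finite_level)
  also have "\<dots> = (\<Sum>k\<in>\<Lambda> (-1). f (-1, k)) + (\<Sum>j\<in>int ` {..N}. \<Sum>k\<in>\<Lambda> j. f (j, k))"
    unfolding atLeastAtMost_minus_one by (subst sum.insert) auto
  also have "(\<Sum>j\<in>int ` {..N}. \<Sum>k\<in>\<Lambda> j. f (j, k)) = (\<Sum>j\<le>N. \<Sum>k\<in>\<Lambda> (int j). f (int j, k))"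
    by (subst sum.reindex) auto
  finally show ?thesis .
qed

lemma orthonormal_scales: "orthonormal_on cube_measure (scales \<Lambda> N) (case_prod \<phi>)"
  using wb by (auto simp: orthonormal_on_def scales_def wavelet_basis_def square_integrable_iff)

text \<open>Going away from level \<open>J\<close>, the number of indices decays geometrically
  downwards, and the weighted number does so upwards. The two geometric series give the factor 4,
  level -1 the remaining 1.\<close>

lemma sum_exp_level_cost:
  "(\<Sum>i\<in>scales \<Lambda> N. exp (- level_cost CARD('n) J i)) \<le> 5 * (max \<Gamma> 1 * 2 ^ (J * CARD('n)))"
proof -
  let ?G = "max \<Gamma> 1" and ?l = "CARD('n)"
  have l: "1 \<le> ?l" by (simp add: Suc_le_eq)
  have lev: "(\<Sum>k\<in>\<Lambda> (int j). exp (- level_cost ?l J (int j, k))) \<le> ?G * 2 ^ (J * ?l) * (1 / 2) ^ nat \<bar>int j - int J\<bar>" for j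
  proof -
    have "(\<Sum>k\<in>\<Lambda> (int j). exp (- level_cost ?l J (int j, k)))
        = real (card (\<Lambda> (int j))) * exp (- (real (?l + 1) * max 0 (real j - real J)))"
      by (simp add: level_cost_def)
    also have "\<dots> \<le> ?G * 2 ^ (j * ?l) * exp (- (real (?l + 1) * max 0 (real j - real J)))"
      using card_level by (rule mult_right_mono) simp
    also have "\<dots> \<le> ?G * (2 ^ (J * ?l) * (1 / 2) ^ nat \<bar>int j - int J\<bar>)"
    proof (cases "j \<le> J")
      case True
      define d where "d = J - j"
      have J: "J = j + d" using True by (simp add: d_def)
      have "(2 :: real) ^ d \<le> 2 ^ (d * ?l)" using l by (intro power_increasing) auto
      then have "2 ^ (j * ?l) * (2 :: real) ^ d \<le> 2 ^ (j * ?l) * 2 ^ (d * ?l)" by (rule mult_left_mono) simp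
      then have "(2 :: real) ^ (j * ?l) \<le> 2 ^ (J * ?l) * (1 / 2) ^ d"
        by (simp add: J power_add distrib_right power_divide field_simps)
      moreover have "nat \<bar>int j - int J\<bar> = d" using J by simp
      ultimately show ?thesis using True by (simp add: mult.assoc mult_left_mono)
    next
      case False
      define d where "d = j - J"
      have j: "j = J + d" using False by (simp add: d_def)
      define r where "r = real (?l + 1) * real d"
      have "(2 :: real) ^ (d * (?l + 1)) \<le> exp 1 ^ (d * (?l + 1))"
        using exp_ge_add_one_self[of 1] by (intro power_mono) auto
      also have "\<dots> = exp r" by (simp add: r_def exp_of_nat_mult[symmetric] algebra_simps)
      finally have "(2 :: real) ^ (d * ?l) * exp (- r) \<le> (1 / 2) ^ d"
        by (simp add: exp_minus power_add power_divide field_simps)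
      then have "(2 :: real) ^ (d * ?l) * exp (- (real (?l + 1) * real d)) \<le> (1 / 2) ^ d"
        by (simp only: r_def)
      then have "2 ^ (J * ?l) * ((2 :: real) ^ (d * ?l) * exp (- (real (?l + 1) * real d))) \<le> 2 ^ (J * ?l) * (1 / 2) ^ d"
        by (rule mult_left_mono) simp
      then have "(2 :: real) ^ (j * ?l) * exp (- (real (?l + 1) * max 0 (real j - real J))) \<le> 2 ^ (J * ?l) * (1 / 2) ^ d"
        by (simp add: j power_add distrib_right mult.assoc)
      moreover have "nat \<bar>int j - int J\<bar> = d" using j by simp
      ultimately show ?thesis by (simp only: mult.assoc) (intro mult_left_mono, auto)
    qed
    finally show ?thesis by (simp add: mult.assoc)
  qed
  have "(\<Sum>i\<in>scales \<Lambda> N. exp (- level_cost ?l J i))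
      = real (card (\<Lambda> (-1))) + (\<Sum>j\<le>N. \<Sum>k\<in>\<Lambda> (int j). exp (- level_cost ?l J (int j, k)))"
    unfolding sum_scales by (simp add: level_cost_def)
  also have "\<dots> \<le> ?G * 2 ^ (J * ?l) + (\<Sum>j\<le>N. ?G * 2 ^ (J * ?l) * (1 / 2) ^ nat \<bar>int j - int J\<bar>)"
  proof (intro add_mono sum_mono lev)
    have "?G * 1 \<le> ?G * 2 ^ (J * ?l)" by (intro mult_left_mono) auto
    then show "real (card (\<Lambda> (-1))) \<le> ?G * 2 ^ (J * ?l)"
      using card_coarse by (metis mult.right_neutral order_trans)
  qed
  also have "(\<Sum>j\<le>N. ?G * 2 ^ (J * ?l) * (1 / 2) ^ nat \<bar>int j - int J\<bar>)
      = ?G * 2 ^ (J * ?l) * (\<Sum>d\<in>(\<lambda>j. int j - int J) ` {..N}. (1 / 2) ^ nat \<bar>d\<bar>)"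
    by (simp add: sum.reindex inj_on_def sum_distrib_left)
  also have "\<dots> \<le> ?G * 2 ^ (J * ?l) * 4"
    by (intro mult_left_mono sum_half_power_abs_le) auto
  finally show ?thesis by simp
qed

lemma D_model_wavelet_model:
  "D_model cube_measure (model_radius CARD('n) \<Gamma> r J) (5 * (model_radius CARD('n) \<Gamma> r J)\<^sup>2 / 84) 1
     (wavelet_model \<Lambda> \<phi> J (model_radius CARD('n) \<Gamma> r J))"
  unfolding wavelet_model_def
proof (rule D_model_lattice_model)
  let ?c = "level_cost CARD('n) J" and ?T = "2 ^ (J * CARD('n)) :: real"
  let ?F = "scales \<Lambda> (top_scale CARD('n) J)"
  define G where "G = max \<Gamma> 1 * ?T"
  have "?T \<le> G" "0 \<le> G" by (simp_all add: G_def)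
  moreover have "(\<Sum>i\<in>?F. exp (- ?c i)) \<le> 5 * G" unfolding G_def by (rule sum_exp_level_cost)
  moreover have "3360 * G \<le> (model_radius CARD('n) \<Gamma> r J)\<^sup>2" unfolding G_def by (rule model_radius_ge)
  moreover have "8 * (t + 16 * e) \<le> y" if "t \<le> G" "0 \<le> G" "e \<le> 5 * G" "3360 * G \<le> y" for t e y
    using that by argo
  ultimately show "8 * (?T + 16 * (\<Sum>i\<in>?F. exp (- ?c i))) \<le> (model_radius CARD('n) \<Gamma> r J)\<^sup>2"
    by blast
qed (auto simp: finite_measure.axioms finite_measure_cube_measure finite_scales orthonormal_scales model_radius_pos)

lemma wavelet_model_subset: "wavelet_model \<Lambda> \<phi> J \<eta> \<subseteq> class_rep cube_measure ` L1_plus cube_measure"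
  unfolding wavelet_model_def by (rule lattice_model_subset[OF finite_scales orthonormal_scales])

section \<open>Approximation by lattice points of a wavelet basis\<close>

lemma wavelet_projection_tendsto:
  assumes "f \<in> L2 cube_measure"
  shows "(\<lambda>N. \<integral>x. (f x - (\<Sum>i\<in>scales \<Lambda> N. coeff \<phi> f (fst i) (snd i) * case_prod \<phi> i x))\<^sup>2 \<partial>cube_measure) \<longlonglongrightarrow> 0"
proof -
  have "(\<Sum>i\<in>scales \<Lambda> N. coeff \<phi> f (fst i) (snd i) * case_prod \<phi> i x)
      = (\<Sum>j\<in>{-1..int N}. \<Sum>k\<in>\<Lambda> j. coeff \<phi> f j k * \<phi> j k x)" for N x
    unfolding scales_def by (subst sum.Sigma) (auto simp: finite_level case_prod_beta)
  then show ?thesis using wb assms by (simp add: wavelet_basis_def square_integrable_iff)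
qed

text \<open>The model has the index set \<open>F\<close>, whereas the expansion converges along
  \<open>scales \<Lambda> N\<close>. As \<open>m\<close> vanishes on the indices not common to both,
  its lattice function can be written over either set, and the error splits into projection and
  rounding.\<close>

lemma lattice_error:
  fixes m :: "int \<times> 'k \<Rightarrow> int"
  assumes f: "f \<in> L2 cube_measure" and F: "finite F" "orthonormal_on cube_measure F (case_prod \<phi>)"
    and m: "\<And>i. i \<in> F - scales \<Lambda> N \<Longrightarrow> m i = 0" "\<And>i. i \<in> scales \<Lambda> N - F \<Longrightarrow> m i = 0"
  shows "(\<integral>x. (f x - lattice_fun (case_prod \<phi>) F (restrict m F) x)\<^sup>2 \<partial>cube_measure)
    \<le> 2 * (\<integral>x. (f x - (\<Sum>i\<in>scales \<Lambda> N. coeff \<phi> f (fst i) (snd i) * case_prod \<phi> i x))\<^sup>2 \<partial>cube_measure)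
      + 2 * (\<Sum>i\<in>scales \<Lambda> N. (coeff \<phi> f (fst i) (snd i) - 12 * real_of_int (m i))\<^sup>2)"
proof -
  let ?e = "case_prod \<phi>" and ?A = "scales \<Lambda> N"
  let ?b = "\<lambda>i. coeff \<phi> f (fst i) (snd i)"
  have eq: "lattice_fun ?e F (restrict m F) x = (\<Sum>i\<in>?A. 12 * real_of_int (m i) * ?e i x)" for x
  proof -
    have "lattice_fun ?e F (restrict m F) x = (\<Sum>i\<in>F. 12 * real_of_int (m i) * ?e i x)"
      by (simp add: lattice_fun_def)
    also have "\<dots> = (\<Sum>i\<in>F \<union> ?A. 12 * real_of_int (m i) * ?e i x)"
      using m F finite_scales by (intro sum.mono_neutral_left) auto
    also have "\<dots> = (\<Sum>i\<in>?A. 12 * real_of_int (m i) * ?e i x)"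
      using m F finite_scales by (intro sum.mono_neutral_right) auto
    finally show ?thesis .
  qed
  have eL: "i \<in> ?A \<Longrightarrow> ?e i \<in> L2 cube_measure" for i
    using orthonormal_scales[of N] by (simp add: orthonormal_on_def)
  define P where "P x = (\<Sum>i\<in>?A. ?b i * ?e i x)" for x
  define R where "R x = (\<Sum>i\<in>?A. (?b i - 12 * real_of_int (m i)) * ?e i x)" for x
  have PL: "P \<in> L2 cube_measure" "R \<in> L2 cube_measure"
    unfolding P_def R_def by (intro L2_sum finite_scales eL; assumption)+
  have split: "f x - lattice_fun ?e F (restrict m F) x = (f x - P x) + R x" for x
    unfolding eq P_def R_def by (simp add: left_diff_distrib sum_subtractf)
  have i1: "integrable cube_measure (\<lambda>x. (f x - P x)\<^sup>2)" "integrable cube_measure (\<lambda>x. (R x)\<^sup>2)"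
    using PL f by (auto intro: L2_integrable L2_diff)
  have "integrable cube_measure (\<lambda>x. ((f x - P x) + R x)\<^sup>2)"
    by (intro L2_integrable L2_add L2_diff f PL)
  then have "(\<integral>x. ((f x - P x) + R x)\<^sup>2 \<partial>cube_measure) \<le> (\<integral>x. 2 * (f x - P x)\<^sup>2 + 2 * (R x)\<^sup>2 \<partial>cube_measure)"
    using i1 by (intro integral_mono square_add_le) auto
  also have "\<dots> = 2 * (\<integral>x. (f x - P x)\<^sup>2 \<partial>cube_measure) + 2 * (\<integral>x. (R x)\<^sup>2 \<partial>cube_measure)"
    using i1 by simp
  also have "(\<integral>x. (R x)\<^sup>2 \<partial>cube_measure) = (\<Sum>i\<in>?A. (?b i - 12 * real_of_int (m i))\<^sup>2)"
    unfolding R_def by (rule integral_lincomb_square[OF finite_scales orthonormal_scales])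
  finally show ?thesis unfolding split P_def .
qed

text \<open>Through \<open>trunc12_powr\<close>, hypothesis \<open>A\<close> serves twice: it keeps
  the cost of the rounded coefficients within the budget and bounds their rounding errors above
  level \<open>J\<close>.\<close>

lemma wavelet_model_approx:
  assumes s: "s \<in> L1_plus cube_measure" and q: "0 < q" "q \<le> 2"
    and A: "\<And>N. (\<Sum>j\<in>{J<..N}. real (CARD('n) + 1) * real (j - J) *
        (\<Sum>k\<in>\<Lambda> (int j). \<bar>coeff \<phi> (pos_root s) (int j) k\<bar> powr q)) \<le> 2 ^ (J * CARD('n))"
  shows "\<exists>u\<in>wavelet_model \<Lambda> \<phi> J (model_radius CARD('n) \<Gamma> r J).
    (hellinger_fun cube_measure s u)\<^sup>2 \<le> (model_radius CARD('n) \<Gamma> r J)\<^sup>2 / 2"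
proof -
  let ?l = "CARD('n)" and ?T = "2 ^ (J * CARD('n)) :: real" and ?e = "case_prod \<phi>"
  let ?top = "top_scale CARD('n) J"
  define \<eta> where "\<eta> = model_radius ?l \<Gamma> r J"
  define a where "a = pos_root s"
  define b where "b i = coeff \<phi> a (fst i) (snd i)" for i
  define m where "m i = trunc12 (b i)" for i
  define B where "B j = (\<Sum>k\<in>\<Lambda> (int j). \<bar>b (int j, k)\<bar> powr q)" for j
  define W where "W N = (\<Sum>j\<in>{J<..N}. real (?l + 1) * real (j - J) * B j)" for N
  have W: "W N \<le> ?T" for N using A[of N] by (simp add: W_def B_def b_def a_def)
  have B0: "0 \<le> B j" for j by (simp add: B_def sum_nonneg)
  have mB: "(\<Sum>k\<in>\<Lambda> (int j). of_bool (m (int j, k) \<noteq> 0)) \<le> B j" for j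
    unfolding B_def m_def by (intro sum_mono trunc12_powr q)
  have cost_level: "(\<Sum>k\<in>\<Lambda> (int j). if m (int j, k) \<noteq> 0 then level_cost ?l J (int j, k) else 0)
      = (if J < j then real (?l + 1) * real (j - J) * (\<Sum>k\<in>\<Lambda> (int j). of_bool (m (int j, k) \<noteq> 0)) else 0)" for j
    by (auto simp: level_cost_def sum_distrib_left of_nat_diff of_bool_def intro!: sum.cong sum.neutral)
  have cost: "support_cost (scales \<Lambda> N) (level_cost ?l J) m \<le> ?T" for N
  proof -
    have "support_cost (scales \<Lambda> N) (level_cost ?l J) m
        = (\<Sum>j\<le>N. if J < j then real (?l + 1) * real (j - J) * (\<Sum>k\<in>\<Lambda> (int j). of_bool (m (int j, k) \<noteq> 0)) else 0)"
      unfolding support_cost_def sum_scales cost_level by (auto simp: level_cost_def intro!: sum.neutral)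
    also have "\<dots> \<le> (\<Sum>j\<le>N. if J < j then real (?l + 1) * real (j - J) * B j else 0)"
      using mB by (intro sum_mono) (auto intro!: mult_left_mono)
    also have "\<dots> = W N" unfolding W_def
      by (subst sum.inter_filter[symmetric]) (auto intro!: sum.cong)
    finally show ?thesis using W[of N] by linarith
  qed
  have vanish: "m (int j, k) = 0" if "?top < j" "k \<in> \<Lambda> (int j)" for j k
  proof (rule ccontr)
    assume nz: "m (int j, k) \<noteq> 0"
    have "real (?l + 1) * (real j - real J) = (if m (int j, k) \<noteq> 0 then level_cost ?l J (int j, k) else 0)"
      using nz that(1) by (simp add: level_cost_def top_scale_def)
    also have "\<dots> \<le> support_cost (scales \<Lambda> j) (level_cost ?l J) m"
      unfolding support_cost_def using that(2)
      by (intro member_le_sum[of "(int j, k)" _ "\<lambda>i. if m i \<noteq> 0 then level_cost ?l J i else 0"])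
         (auto simp: finite_scales level_cost_def, simp add: scales_def)
    also have "\<dots> \<le> ?T" by (rule cost)
    finally have le: "real (?l + 1) * (real j - real J) \<le> ?T" .
    have "1 * (real j - real J) \<le> real (?l + 1) * (real j - real J)"
      using that(1) by (intro mult_right_mono) (auto simp: top_scale_def)
    from order_trans[OF this le] have "real j \<le> real J + ?T" by simp
    moreover have "real (J + 2 ^ (J * ?l)) < real j"
      using that(1) unfolding top_scale_def by (simp only: of_nat_less_iff)
    ultimately show False by simp
  qed
  let ?F = "scales \<Lambda> ?top"
  let ?n = "restrict m ?F"
  have n: "?n \<in> ?F \<rightarrow>\<^sub>E UNIV" "support_cost ?F (level_cost ?l J) ?n \<le> ?T"
    using cost[of ?top] by (auto simp: support_cost_def cong: sum.cong)
  have err_sum: "(\<Sum>i\<in>scales \<Lambda> N. (b i - 12 * real_of_int (m i))\<^sup>2) \<le> 144 * (6 * (max \<Gamma> 1 * ?T))" for N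
  proof -
    \<comment> \<open>Up to level \<open>J\<close> the cost is 0, so that the exponentials count
      these indices, each with error at most 144; above \<open>J\<close> the error is charged to the
      power. The sums contribute 5 and 1 to the factor 6.\<close>
    have term_le: "(b i - 12 * real_of_int (m i))\<^sup>2 \<le> 144 * (exp (- level_cost ?l J i)
        + (if int J < fst i then \<bar>b i\<bar> powr q else 0))" for i
    proof (cases "int J < fst i")
      case True
      have "(b i - 12 * real_of_int (m i))\<^sup>2 \<le> 144 * \<bar>b i\<bar> powr q"
        unfolding m_def by (rule trunc12_powr(1)[OF q])
      moreover have "0 \<le> exp (- level_cost ?l J i)" by simp
      ultimately show ?thesis using True by (simp only: if_True distrib_left)
    next
      case False
      then have "level_cost ?l J i = 0" by (simp add: level_cost_def)
      then show ?thesis using False trunc12_error_square[of "b i"] by (simp add: m_def)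
    qed
    have "(\<Sum>i\<in>scales \<Lambda> N. (b i - 12 * real_of_int (m i))\<^sup>2)
        \<le> 144 * ((\<Sum>i\<in>scales \<Lambda> N. exp (- level_cost ?l J i)) + (\<Sum>i\<in>scales \<Lambda> N. if int J < fst i then \<bar>b i\<bar> powr q else 0))"
      unfolding sum.distrib[symmetric] sum_distrib_left by (intro sum_mono term_le)
    also have "(\<Sum>i\<in>scales \<Lambda> N. if int J < fst i then \<bar>b i\<bar> powr q else 0) = (\<Sum>j\<le>N. if J < j then B j else 0)"
      unfolding sum_scales by (auto simp: B_def intro!: sum.cong)
    also have "\<dots> = (\<Sum>j\<in>{J<..N}. B j)"
      by (subst sum.inter_filter[symmetric]) (auto intro!: sum.cong)
    also have "\<dots> \<le> W N" unfolding W_def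
    proof (rule sum_mono)
      fix j assume "j \<in> {J<..N}"
      then have "1 * 1 \<le> real (?l + 1) * real (j - J)" by (intro mult_mono) auto
      from mult_right_mono[OF this B0] show "B j \<le> real (?l + 1) * real (j - J) * B j" by simp
    qed
    finally have "(\<Sum>i\<in>scales \<Lambda> N. (b i - 12 * real_of_int (m i))\<^sup>2)
        \<le> 144 * ((\<Sum>i\<in>scales \<Lambda> N. exp (- level_cost ?l J i)) + W N)"
      by simp
    moreover define G where "G = max \<Gamma> 1 * ?T"
    moreover have "?T \<le> G" by (simp add: G_def)
    moreover have "(\<Sum>i\<in>scales \<Lambda> N. exp (- level_cost ?l J i)) \<le> 5 * G"
      unfolding G_def by (rule sum_exp_level_cost)
    ultimately show ?thesis using W[of N] unfolding G_def[symmetric] by argo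
  qed
  have aL: "a \<in> L2 cube_measure" unfolding a_def by (rule L2_pos_root[OF s])
  \<comment> \<open>Since \<open>m\<close> vanishes above the levels of the model, \<open>N\<close>
    can tend to infinity for a fixed model, which removes the projection error. The rest is 1728 = 2
    * 144 * 6.\<close>
  let ?err = "\<lambda>N. \<integral>x. (a x - (\<Sum>i\<in>scales \<Lambda> N. b i * ?e i x))\<^sup>2 \<partial>cube_measure"
  have "(\<integral>x. (a x - lattice_fun ?e ?F ?n x)\<^sup>2 \<partial>cube_measure) \<le> 2 * ?err N + 1728 * (max \<Gamma> 1 * ?T)"
    if N: "?top \<le> N" for N
  proof -
    have sub: "?F \<subseteq> scales \<Lambda> N" using N by (auto simp: scales_def)
    have z: "m i = 0" if "i \<in> scales \<Lambda> N - ?F" for i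
    proof -
      obtain j k where i: "i = (j, k)" by (cases i)
      have "int ?top < j" "k \<in> \<Lambda> j" using that by (auto simp: scales_def i)
      then show ?thesis using vanish[of "nat j" k] by (simp add: i)
    qed
    have "(\<integral>x. (a x - lattice_fun ?e ?F ?n x)\<^sup>2 \<partial>cube_measure)
      \<le> 2 * ?err N + 2 * (\<Sum>i\<in>scales \<Lambda> N. (b i - 12 * real_of_int (m i))\<^sup>2)"
      unfolding b_def
      by (rule lattice_error[OF aL finite_scales orthonormal_scales]) (use sub z in auto)
    then show ?thesis using err_sum[of N] by linarith
  qed
  moreover have "(\<lambda>N. 2 * ?err N + 1728 * (max \<Gamma> 1 * ?T)) \<longlonglongrightarrow> 2 * 0 + 1728 * (max \<Gamma> 1 * ?T)"
    unfolding b_def by (intro tendsto_intros wavelet_projection_tendsto aL)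
  ultimately have "(\<integral>x. (a x - lattice_fun ?e ?F ?n x)\<^sup>2 \<partial>cube_measure) \<le> 1728 * (max \<Gamma> 1 * ?T)"
    by (intro LIMSEQ_le_const[where X = "\<lambda>N. 2 * ?err N + 1728 * (max \<Gamma> 1 * ?T)"]) auto
  moreover have "0 \<le> max \<Gamma> 1 * ?T" by simp
  ultimately have "(\<integral>x. (pos_root s x - lattice_fun ?e ?F ?n x)\<^sup>2 \<partial>cube_measure) \<le> \<eta>\<^sup>2"
    using model_radius_ge[of \<Gamma> J ?l r] unfolding \<eta>_def a_def by linarith
  from lattice_model_approx[OF _ finite_scales orthonormal_scales s n this]
  show ?thesis unfolding wavelet_model_def \<eta>_def
    by (simp add: finite_measure.axioms finite_measure_cube_measure)
qed

text \<open>The constant intensity with root \<open>4 * \<eta>\<close> has squared distance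
  \<open>8 * \<eta>\<^sup>2\<close> from 0, but at most \<open>\<eta>\<^sup>2 / 2\<close> from some
  point of the model if \<open>J\<close> is large; that point is then far from 0 as well.\<close>

lemma wavelet_models_unbounded:
  "\<exists>J. \<exists>u\<in>wavelet_model \<Lambda> \<phi> J (model_radius CARD('n) \<Gamma> r J). K \<le> (hellinger_fun cube_measure (\<lambda>x. 0) u)\<^sup>2"
proof -
  interpret C: prob_space "cube_measure :: (real ^ 'n) measure" by (rule prob_space_cube_measure)
  let ?l = "CARD('n)" and ?e = "case_prod \<phi>"
  let ?one = "(\<lambda>x. 1) :: real ^ 'n \<Rightarrow> real"
  let ?err = "\<lambda>N. \<integral>x. (?one x - (\<Sum>i\<in>scales \<Lambda> N. coeff \<phi> ?one (fst i) (snd i) * ?e i x))\<^sup>2 \<partial>cube_measure"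
  have "?err \<longlonglongrightarrow> 0" by (rule wavelet_projection_tendsto) (simp add: L2_def)
  \<comment> \<open>For the root \<open>4 * \<eta>\<close> this is a projection error below
    \<open>\<eta>\<^sup>2 / 4\<close>, which \<open>lattice_error\<close> doubles; the other half of
    \<open>\<eta>\<^sup>2\<close> is available for rounding.\<close>
  then have "\<forall>\<^sub>F N in sequentially. ?err N < 1 / 64" by (rule order_tendstoD) simp
  then obtain N0 where N0: "\<And>N. N0 \<le> N \<Longrightarrow> ?err N < 1 / 64" by (auto simp: eventually_sequentially)
  obtain N1 :: nat where N1: "K \<le> real N1" using real_arch_simple by blast
  define J where "J = max N0 N1"
  let ?T = "2 ^ (J * ?l) :: real" and ?top = "top_scale CARD('n) J"
  define \<eta> where "\<eta> = model_radius ?l \<Gamma> r J"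
  have \<eta>0: "0 < \<eta>" unfolding \<eta>_def by (rule model_radius_pos)
  have \<eta>2: "3360 * (max \<Gamma> 1 * ?T) \<le> \<eta>\<^sup>2" unfolding \<eta>_def by (rule model_radius_ge)
  have K: "K \<le> \<eta>\<^sup>2"
  proof -
    have "real J < 2 ^ J" by (rule of_nat_less_two_power)
    also have "\<dots> \<le> ?T" by (intro power_increasing) (auto simp: Suc_le_eq)
    also have "\<dots> \<le> max \<Gamma> 1 * ?T" by simp
    finally have "real J \<le> \<eta>\<^sup>2" using \<eta>2 by linarith
    moreover have "K \<le> real J" using N1 by (simp add: J_def)
    ultimately show ?thesis by linarith
  qed
  define s where "s = (\<lambda>x :: real ^ 'n. (4 * \<eta>)\<^sup>2)"
  have s: "s \<in> L1_plus cube_measure" by (simp add: s_def L1_plus_def)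
  have zero: "(\<lambda>x. 0) \<in> L1_plus (cube_measure :: (real ^ 'n) measure)" by (simp add: L1_plus_def)
  have a: "pos_root s = (\<lambda>x. 4 * \<eta>)"
  proof
    fix x
    have "pos_root s x = sqrt ((4 * \<eta>)\<^sup>2)"
      by (simp only: pos_root_def s_def max_absorb1 zero_le_power2)
    also have "\<dots> = \<bar>4 * \<eta>\<bar>" by (rule real_sqrt_abs)
    finally show "pos_root s x = 4 * \<eta>" using \<eta>0 by simp
  qed
  define b where "b i = coeff \<phi> (pos_root s) (fst i) (snd i)" for i
  have b: "b i = 4 * \<eta> * coeff \<phi> ?one (fst i) (snd i)" for i
    by (simp add: b_def a coeff_def)
  \<comment> \<open>Cutting at level \<open>J\<close> makes the cost 0, so that nothing has to be
    known about the decay of the coefficients of a constant.\<close>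
  define m where "m i = (if fst i \<le> int J then trunc12 (b i) else 0)" for i
  let ?F = "scales \<Lambda> ?top"
  let ?n = "restrict m ?F"
  have n: "?n \<in> ?F \<rightarrow>\<^sub>E UNIV" "support_cost ?F (level_cost ?l J) ?n \<le> ?T"
  proof -
    have "support_cost ?F (level_cost ?l J) ?n = 0"
      unfolding support_cost_def by (rule sum.neutral) (auto simp: m_def level_cost_def)
    then show "support_cost ?F (level_cost ?l J) ?n \<le> ?T" by simp
  qed auto
  have sub: "scales \<Lambda> J \<subseteq> ?F" by (auto simp: scales_def top_scale_def add_increasing2)
  have "(\<integral>x. (pos_root s x - lattice_fun ?e ?F ?n x)\<^sup>2 \<partial>cube_measure)
      \<le> 2 * (\<integral>x. (pos_root s x - (\<Sum>i\<in>scales \<Lambda> J. b i * ?e i x))\<^sup>2 \<partial>cube_measure)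
        + 2 * (\<Sum>i\<in>scales \<Lambda> J. (b i - 12 * real_of_int (m i))\<^sup>2)"
    unfolding b_def
    by (rule lattice_error[OF L2_pos_root[OF s] finite_scales orthonormal_scales])
       (use sub in \<open>auto simp: m_def scales_def\<close>)
  also have "(\<integral>x. (pos_root s x - (\<Sum>i\<in>scales \<Lambda> J. b i * ?e i x))\<^sup>2 \<partial>cube_measure) = 16 * \<eta>\<^sup>2 * ?err J"
  proof -
    have "(pos_root s x - (\<Sum>i\<in>scales \<Lambda> J. b i * ?e i x))\<^sup>2
      = 16 * \<eta>\<^sup>2 * (?one x - (\<Sum>i\<in>scales \<Lambda> J. coeff \<phi> ?one (fst i) (snd i) * ?e i x))\<^sup>2" for x
    proof -
      have "pos_root s x - (\<Sum>i\<in>scales \<Lambda> J. b i * ?e i x)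
        = 4 * \<eta> * (?one x - (\<Sum>i\<in>scales \<Lambda> J. coeff \<phi> ?one (fst i) (snd i) * ?e i x))"
        unfolding a b by (simp add: right_diff_distrib sum_distrib_left mult.assoc)
      then show ?thesis by (simp add: power_mult_distrib)
    qed
    then show ?thesis by simp
  qed
  also have "16 * \<eta>\<^sup>2 * ?err J \<le> 16 * \<eta>\<^sup>2 * (1 / 64)"
    using N0[of J] by (intro mult_left_mono) (auto simp: J_def)
  also have "(\<Sum>i\<in>scales \<Lambda> J. (b i - 12 * real_of_int (m i))\<^sup>2) \<le> (\<Sum>i\<in>scales \<Lambda> J. 144 * exp (- level_cost ?l J i))"
  proof (rule sum_mono)
    fix i assume "i \<in> scales \<Lambda> J"
    then have "fst i \<le> int J" by (auto simp: scales_def)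
    then show "(b i - 12 * real_of_int (m i))\<^sup>2 \<le> 144 * exp (- level_cost ?l J i)"
      using trunc12_error_square[of "b i"] by (simp add: m_def level_cost_def)
  qed
  also have "(\<Sum>i\<in>scales \<Lambda> J. 144 * exp (- level_cost ?l J i)) \<le> 144 * (5 * (max \<Gamma> 1 * ?T))"
    unfolding sum_distrib_left[symmetric] by (intro mult_left_mono sum_exp_level_cost) simp
  finally have "(\<integral>x. (pos_root s x - lattice_fun ?e ?F ?n x)\<^sup>2 \<partial>cube_measure)
      \<le> 2 * (16 * \<eta>\<^sup>2 * (1 / 64)) + 2 * (144 * (5 * (max \<Gamma> 1 * ?T)))"
    by (simp only: mult_left_mono add_left_mono add_right_mono zero_le_numeral)
  then have "(\<integral>x. (pos_root s x - lattice_fun ?e ?F ?n x)\<^sup>2 \<partial>cube_measure) \<le> \<eta>\<^sup>2"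
    using \<eta>2 zero_le_power2[of \<eta>] by argo
  from lattice_model_approx[OF _ finite_scales orthonormal_scales s n this]
  obtain u where u: "u \<in> wavelet_model \<Lambda> \<phi> J \<eta>" "(hellinger_fun cube_measure s u)\<^sup>2 \<le> \<eta>\<^sup>2 / 2"
    unfolding wavelet_model_def by (auto simp: C.sigma_finite_measure_axioms)
  have uL: "u \<in> L1_plus cube_measure" using u(1) wavelet_model_subset class_rep(1) by blast
  have "2 * (hellinger_fun cube_measure (\<lambda>x. 0) s)\<^sup>2 = 16 * \<eta>\<^sup>2"
    using hellinger_fun_power2[OF C.sigma_finite_measure_axioms zero s]
    unfolding a by (simp add: pos_root_def power_mult_distrib C.prob_space)
  moreover have "(hellinger_fun cube_measure (\<lambda>x. 0) s)\<^sup>2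
      \<le> 2 * (hellinger_fun cube_measure (\<lambda>x. 0) u)\<^sup>2 + 2 * (hellinger_fun cube_measure u s)\<^sup>2"
    by (rule hellinger_fun_triangle[OF C.sigma_finite_measure_axioms zero s uL])
  moreover have "hellinger_fun cube_measure u s = hellinger_fun cube_measure s u"
    by (rule hellinger_fun_commute[OF C.sigma_finite_measure_axioms uL s])
  ultimately have "8 * \<eta>\<^sup>2 \<le> 2 * (hellinger_fun cube_measure (\<lambda>x. 0) u)\<^sup>2 + \<eta>\<^sup>2"
    using u(2) by simp
  then have "K \<le> (hellinger_fun cube_measure (\<lambda>x. 0) u)\<^sup>2" using K zero_le_power2[of \<eta>] by linarith
  then show ?thesis using u(1) unfolding \<eta>_def by blast
qed

end

section \<open>Approximation in Besov spaces\<close>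

lemma exp_model_radius_le:
  assumes "1 \<le> l"
  shows "exp (- (model_radius l \<Gamma> r J)\<^sup>2 / 84) \<le> (1 / 2) ^ r * (1 / 2) ^ J"
proof -
  have "real (Suc J) \<le> real (2 ^ J)" using less_exp[of J] by (intro of_nat_mono Suc_leI)
  then have "real J + 1 \<le> 2 ^ J" by simp
  also have "(2 :: real) ^ J \<le> 2 ^ (J * l)" using assms by (intro power_increasing) auto
  finally have J: "real J + 1 \<le> 2 ^ (J * l)" .
  have "real (r + J) \<le> (real r + 1) * (real J + 1)" by (simp add: algebra_simps)
  also have "\<dots> \<le> (real r + 1) * 2 ^ (J * l)" using J by (rule mult_left_mono) simp
  also have "\<dots> = 1 * ((real r + 1) * 2 ^ (J * l))" by simp
  also have "\<dots> \<le> (40 * max \<Gamma> 1) * ((real r + 1) * 2 ^ (J * l))" by (intro mult_right_mono) auto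
  also have "\<dots> = (model_radius l \<Gamma> r J)\<^sup>2 / 84" by (simp add: model_radius_power2)
  finally have "exp (- (model_radius l \<Gamma> r J)\<^sup>2 / 84) \<le> exp (- real (r + J))" by simp
  also have "\<dots> = exp (- 1) ^ (r + J)"
    unfolding exp_of_nat_mult[symmetric] by simp
  also have "\<dots> \<le> (1 / 2) ^ (r + J)"
    using exp_ge_add_one_self[of 1] by (intro power_mono) (auto simp: exp_minus inverse_eq_divide divide_simps)
  finally show ?thesis by (simp add: power_add)
qed

definition index_radius :: "nat \<Rightarrow> (nat \<Rightarrow> real) \<Rightarrow> nat \<Rightarrow> real" where
  "index_radius l \<Gamma> m = (case prod_decode m of (r, J) \<Rightarrow> model_radius l (\<Gamma> r) r J)"

text \<open>The bound in \<open>exp_model_radius_le\<close> does not contain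
  \<open>\<Gamma>\<close>; so the sum, and with it the constant of the risk bound, is the same for
  all sequences of bases.\<close>

lemma sum_exp_index_radius_le:
  assumes l: "1 \<le> l" and F: "finite F"
  shows "(\<Sum>m\<in>F. exp (- (index_radius l \<Gamma> m)\<^sup>2 / 84)) \<le> 4"
proof -
  have half: "(\<Sum>k<n. (1 / 2 :: real) ^ k) \<le> 2" for n
    using sum_le_suminf[of "\<lambda>k. (1 / 2 :: real) ^ k" "{..<n}"] by (simp add: suminf_geometric summable_geometric)
  define A where "A = prod_decode ` F"
  have A: "finite A" using F by (simp add: A_def)
  define n where "n = Suc (Max (insert 0 (fst ` A \<union> snd ` A)))"
  have bd: "k < n" if "k \<in> fst ` A \<union> snd ` A" for k
    using that A unfolding n_def by (intro le_imp_less_Suc Max_ge) auto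
  have sub: "A \<subseteq> {..<n} \<times> {..<n}"
  proof
    fix x assume "x \<in> A"
    then show "x \<in> {..<n} \<times> {..<n}" using bd[of "fst x"] bd[of "snd x"] by (cases x) force
  qed
  have "(\<Sum>m\<in>F. exp (- (index_radius l \<Gamma> m)\<^sup>2 / 84))
      = (\<Sum>(r, J)\<in>A. exp (- (model_radius l (\<Gamma> r) r J)\<^sup>2 / 84))"
    unfolding A_def index_radius_def by (subst sum.reindex) (auto simp: inj_on_def prod_decode_eq case_prod_beta)
  also have "\<dots> \<le> (\<Sum>(r, J)\<in>A. (1 / 2) ^ r * (1 / 2) ^ J)"
    using exp_model_radius_le[OF l] by (intro sum_mono) auto
  also have "\<dots> \<le> (\<Sum>(r, J)\<in>{..<n} \<times> {..<n}. (1 / 2) ^ r * (1 / 2) ^ J)"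
    using sub by (intro sum_mono2) auto
  also have "\<dots> = (\<Sum>r<n. (1 / 2) ^ r) * (\<Sum>J<n. (1 / 2) ^ J)"
    by (simp add: sum.cartesian_product[symmetric] sum_product)
  also have "\<dots> \<le> 2 * 2" using half by (intro mult_mono) (auto intro: sum_nonneg)
  finally show ?thesis by simp
qed

definition index_model ::
  "(nat \<Rightarrow> real) \<Rightarrow> (nat \<Rightarrow> int \<Rightarrow> 'k set) \<Rightarrow> (nat \<Rightarrow> int \<Rightarrow> 'k \<Rightarrow> real ^ 'n \<Rightarrow> real) \<Rightarrow> nat \<Rightarrow> (real ^ 'n \<Rightarrow> real) set"
where
  "index_model \<Gamma> \<Lambda> \<phi> m = (case prod_decode m of (r, J) \<Rightarrow>
     wavelet_model (\<Lambda> r) (\<phi> r) J (model_radius CARD('n) (\<Gamma> r) r J))"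

lemma models_index_model:
  fixes \<phi> :: "nat \<Rightarrow> int \<Rightarrow> 'k \<Rightarrow> real ^ 'n \<Rightarrow> real"
  assumes wb: "\<And>r. wavelet_basis (\<Gamma> r) (\<Lambda> r) (\<phi> r)"
  shows "models cube_measure UNIV (index_model \<Gamma> \<Lambda> \<phi>) (index_radius CARD('n) \<Gamma>)
    (\<lambda>m. 5 * (index_radius CARD('n) \<Gamma> m)\<^sup>2 / 84) 1 4"
proof -
  interpret C: finite_measure "cube_measure :: (real ^ 'n) measure" by (rule finite_measure_cube_measure)
  let ?l = "CARD('n)"
  let ?\<eta> = "index_radius ?l \<Gamma>" and ?S = "index_model \<Gamma> \<Lambda> \<phi>"
  have l: "1 \<le> ?l" by (simp add: Suc_le_eq)
  have sub: "?S m \<subseteq> class_rep cube_measure ` L1_plus cube_measure" for m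
    unfolding index_model_def by (cases "prod_decode m") (simp add: wavelet_model_subset[OF wb])
  have \<eta>: "3360 \<le> (?\<eta> m)\<^sup>2" for m
  proof -
    obtain r J where m: "prod_decode m = (r, J)" by (cases "prod_decode m")
    have "3360 * (1 * 1) \<le> 3360 * (max (\<Gamma> r) 1 * 2 ^ (J * ?l))" by (intro mult_mono) auto
    also have "\<dots> \<le> (?\<eta> m)\<^sup>2" using model_radius_ge by (simp add: index_radius_def m)
    finally show ?thesis by simp
  qed
  show ?thesis
  proof
    show "D_model cube_measure (?\<eta> m) (5 * (?\<eta> m)\<^sup>2 / 84) 1 (?S m)" for m
      by (cases "prod_decode m") (simp add: index_model_def index_radius_def D_model_wavelet_model[OF wb])
    show "1 / 2 \<le> 5 * (?\<eta> m)\<^sup>2 / 84" for m using \<eta>[of m] by simp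
    show "84 * (5 * (?\<eta> m)\<^sup>2 / 84) / 5 \<le> (?\<eta> m)\<^sup>2" for m by simp
    show "(\<lambda>m. exp (- (?\<eta> m)\<^sup>2 / 84)) summable_on UNIV"
      using sum_exp_index_radius_le[OF l] by (intro nonneg_bdd_above_summable_on bdd_aboveI[of _ 4]) auto
    show "(\<integral>\<^sup>+m. ennreal (exp (- (?\<eta> m)\<^sup>2 / 84)) \<partial>count_space UNIV) \<le> ennreal 4"
      unfolding nn_integral_count_space_nat
    proof (rule suminf_le_const[OF summableI])
      show "(\<Sum>m<n. ennreal (exp (- (?\<eta> m)\<^sup>2 / 84))) \<le> ennreal 4" for n
        using sum_exp_index_radius_le[OF l, of "{..<n}"] by (simp add: sum_ennreal ennreal_leI del: ennreal_numeral)
    qed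
    show "distinct_classes cube_measure (\<Union>m\<in>UNIV. ?S m)"
      using sub by (intro distinct_classes_class_rep) blast
    fix K
    have in_S: "wavelet_model (\<Lambda> 0) (\<phi> 0) J (model_radius ?l (\<Gamma> 0) 0 J) = ?S (prod_encode (0, J))" for J
      by (simp add: index_model_def)
    note unb = wavelet_models_unbounded[OF wb[of 0], where r = 0]
    obtain t where t: "t \<in> (\<Union>m. ?S m)"
      using unb[where K = 0] in_S by blast
    \<comment> \<open>So far from 0 that, by the squared triangle inequality, a distance of at least
      \<open>K\<close> from \<open>t\<close> remains.\<close>
    obtain u where u: "u \<in> (\<Union>m. ?S m)" and
      uK: "2 * (hellinger_fun cube_measure (\<lambda>x. 0) t)\<^sup>2 + 2 * K\<^sup>2 \<le> (hellinger_fun cube_measure (\<lambda>x. 0) u)\<^sup>2"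
      using unb[where K = "2 * (hellinger_fun cube_measure (\<lambda>x. 0) t)\<^sup>2 + 2 * K\<^sup>2"] in_S by blast
    have L: "t \<in> L1_plus cube_measure" "u \<in> L1_plus cube_measure"
      using t u sub class_rep(1) by blast+
    have "(hellinger_fun cube_measure (\<lambda>x. 0) u)\<^sup>2
        \<le> 2 * (hellinger_fun cube_measure (\<lambda>x. 0) t)\<^sup>2 + 2 * (hellinger_fun cube_measure t u)\<^sup>2"
      by (rule hellinger_fun_triangle[OF C.sigma_finite_measure_axioms _ L(2,1)]) (simp add: L1_plus_def)
    with uK have "K\<^sup>2 \<le> (hellinger_fun cube_measure t u)\<^sup>2" by linarith
    then have "K \<le> hellinger_fun cube_measure t u" by (rule power2_le_imp_le) simp
    then show "\<exists>t\<in>\<Union>m\<in>UNIV. ?S m. \<exists>u\<in>\<Union>m\<in>UNIV. ?S m. K \<le> hellinger_fun cube_measure t u"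
      using t u by blast
  qed simp
qed

section \<open>Besov coefficients level by level\<close>

lemma square_le_interpolation:
  fixes b \<tau> :: real
  assumes p: "2 \<le> p" and \<tau>: "0 < \<tau>"
  shows "\<bar>b\<bar> powr 2 \<le> \<tau> powr 2 + \<bar>b\<bar> powr p * \<tau> powr (2 - p)"
proof (cases "\<bar>b\<bar> \<le> \<tau>")
  case True
  then have "\<bar>b\<bar> powr 2 \<le> \<tau> powr 2" by (intro powr_mono2) auto
  then show ?thesis by (simp add: add_increasing2)
next
  case False
  then have b: "0 < \<bar>b\<bar>" using \<tau> by linarith
  have "\<bar>b\<bar> powr 2 = \<bar>b\<bar> powr p * \<bar>b\<bar> powr (2 - p)" by (simp add: powr_add[symmetric])
  also have "\<dots> \<le> \<bar>b\<bar> powr p * \<tau> powr (2 - p)"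
    using False p \<tau> by (intro mult_left_mono powr_mono2') auto
  finally show ?thesis by (simp add: add_increasing)
qed

text \<open>If \<open>p \<le> 2\<close>, the Besov bound on the level is only rewritten. If
  \<open>p\<close> exceeds 2, the number of indices of the level allows the passage to squares.
  Either way the decay rate comes out as
  \<open>q * (\<alpha> + real l / 2) - real l\<close>.\<close>

lemma besov_level_sum:
  fixes b :: "'k \<Rightarrow> real" and l j :: nat
  assumes p: "0 < p" and G: "1 \<le> G" and R: "1 \<le> R"
    and card: "real (card L) \<le> G * 2 ^ (j * l)"
    and le: "2 powr (real j * (\<alpha> + real l / 2 - real l / p)) * (\<Sum>k\<in>L. \<bar>b k\<bar> powr p) powr (1 / p) \<le> R"
  defines "q \<equiv> min p 2"
  shows "(\<Sum>k\<in>L. \<bar>b k\<bar> powr q) \<le> (2 * G * R) powr q * 2 powr (- real j * (q * (\<alpha> + real l / 2) - real l))"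
proof -
  define \<delta> where "\<delta> = \<alpha> + real l / 2 - real l / p"
  \<comment> \<open>With \<open>R\<close> written as a power of 2, only linear exponents have to be
    compared.\<close>
  define \<rho> where "\<rho> = log 2 R"
  have R2: "R = 2 powr \<rho>" using R by (simp add: \<rho>_def)
  define \<Sigma> where "\<Sigma> = (\<Sum>k\<in>L. \<bar>b k\<bar> powr p)"
  have \<Sigma>0: "0 \<le> \<Sigma>" by (simp add: \<Sigma>_def sum_nonneg)
  have "\<Sigma> powr (1 / p) = 2 powr (- real j * \<delta>) * (2 powr (real j * \<delta>) * \<Sigma> powr (1 / p))"
    by (simp add: mult.assoc[symmetric] powr_add[symmetric])
  also have "\<dots> \<le> 2 powr (- real j * \<delta>) * R"
    using le unfolding \<delta>_def \<Sigma>_def by (rule mult_left_mono) simp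
  also have "\<dots> = 2 powr (\<rho> - real j * \<delta>)" by (simp add: R2 powr_add[symmetric])
  finally have "(\<Sigma> powr (1 / p)) powr p \<le> (2 powr (\<rho> - real j * \<delta>)) powr p"
    using p by (intro powr_mono2) auto
  then have \<Sigma>: "\<Sigma> \<le> 2 powr (p * (\<rho> - real j * \<delta>))"
    using p \<Sigma>0 by (simp add: powr_powr mult.commute)
  show ?thesis
  proof (cases "p \<le> 2")
    case True
    then have q: "q = p" by (simp add: q_def)
    have "p * (\<rho> - real j * \<delta>) = \<rho> * p + - real j * (p * (\<alpha> + real l / 2) - real l)"
      using p by (simp add: \<delta>_def field_simps)
    then have "\<Sigma> \<le> 2 powr (\<rho> * p) * 2 powr (- real j * (p * (\<alpha> + real l / 2) - real l))"
      using \<Sigma> by (simp only: powr_add)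
    also have "2 powr (\<rho> * p) = R powr p" by (simp only: R2 powr_powr)
    also have "R powr p * 2 powr (- real j * (p * (\<alpha> + real l / 2) - real l)) \<le> (2 * G * R) powr p * 2 powr (- real j * (p * (\<alpha> + real l / 2) - real l))"
    proof (intro mult_right_mono powr_mono2)
      have "1 * R \<le> 2 * G * R" using G R by (intro mult_right_mono) auto
      then show "R \<le> 2 * G * R" by simp
    qed (use p R in auto)
    finally show ?thesis by (simp add: q \<Sigma>_def)
  next
    case False
    then have q: "q = 2" by (simp add: q_def)
    \<comment> \<open>The common size of \<open>2 ^ (j * l)\<close> equal coefficients that attain
      the Besov bound; with it both terms of \<open>square_le_interpolation\<close> sum to the same
      order \<open>?X\<close>.\<close>
    define \<tau> where "\<tau> = 2 powr (\<rho> - real j * (\<alpha> + real l / 2))"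
    have \<tau>: "0 < \<tau>" by (simp add: \<tau>_def)
    let ?X = "2 powr (2 * \<rho> - 2 * real j * \<alpha>)"
    have "(\<Sum>k\<in>L. \<bar>b k\<bar> powr 2) \<le> (\<Sum>k\<in>L. \<tau> powr 2 + \<bar>b k\<bar> powr p * \<tau> powr (2 - p))"
      using False \<tau> by (intro sum_mono square_le_interpolation) auto
    also have "\<dots> = real (card L) * \<tau> powr 2 + \<Sigma> * \<tau> powr (2 - p)"
      by (simp add: sum.distrib sum_distrib_right \<Sigma>_def)
    also have "\<dots> \<le> G * 2 ^ (j * l) * \<tau> powr 2 + 2 powr (p * (\<rho> - real j * \<delta>)) * \<tau> powr (2 - p)"
      using card \<Sigma> by (intro add_mono mult_right_mono) auto
    also have "G * 2 ^ (j * l) * \<tau> powr 2 = G * ?X"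
    proof -
      have "(2 :: real) ^ (j * l) = 2 powr (real j * real l)" by (simp add: powr_realpow[symmetric])
      then have "2 ^ (j * l) * \<tau> powr 2 = 2 powr (real j * real l + (\<rho> - real j * (\<alpha> + real l / 2)) * 2)"
        by (simp add: \<tau>_def powr_powr powr_add)
      also have "real j * real l + (\<rho> - real j * (\<alpha> + real l / 2)) * 2 = 2 * \<rho> - 2 * real j * \<alpha>"
        by (simp add: field_simps)
      finally show ?thesis by simp
    qed
    also have "2 powr (p * (\<rho> - real j * \<delta>)) * \<tau> powr (2 - p) = ?X"
    proof -
      have "2 powr (p * (\<rho> - real j * \<delta>)) * \<tau> powr (2 - p)
        = 2 powr (p * (\<rho> - real j * \<delta>) + (\<rho> - real j * (\<alpha> + real l / 2)) * (2 - p))"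
        by (simp add: \<tau>_def powr_powr powr_add)
      also have "p * (\<rho> - real j * \<delta>) + (\<rho> - real j * (\<alpha> + real l / 2)) * (2 - p) = 2 * \<rho> - 2 * real j * \<alpha>"
        using p by (simp add: \<delta>_def field_simps)
      finally show ?thesis .
    qed
    also have "G * ?X + ?X \<le> (2 * G) powr 2 * ?X"
    proof -
      have "1 * G \<le> G * G" using G by (intro mult_right_mono) auto
      moreover have "(2 * G) powr 2 = 4 * (G * G)" using G by (simp add: power2_eq_square)
      ultimately have "G + 1 \<le> (2 * G) powr 2" using G by linarith
      from mult_right_mono[OF this, of ?X] show ?thesis by (simp add: distrib_right)
    qed
    also have "(2 * G) powr 2 * ?X = (2 * G * R) powr 2 * 2 powr (- real j * (2 * (\<alpha> + real l / 2) - real l))"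
    proof -
      have "(2 * G * R) powr 2 = (2 * G) powr 2 * 2 powr (\<rho> * 2)"
        using G R by (simp add: R2 powr_mult powr_powr)
      moreover have "2 powr (\<rho> * 2) * 2 powr (- real j * (2 * (\<alpha> + real l / 2) - real l)) = ?X"
        unfolding powr_add[symmetric] by (simp add: field_simps)
      ultimately show ?thesis by (simp add: mult.assoc)
    qed
    finally show ?thesis by (simp add: q)
  qed
qed

lemma ex_dyadic_power:
  assumes T: "1 \<le> T" and l: "1 \<le> l"
  shows "\<exists>J. T \<le> 2 ^ (J * l) \<and> 2 ^ (J * l) \<le> 2 ^ l * (T :: real)"
proof -
  obtain n where "T < 2 ^ n" using real_arch_pow[of 2 T] by auto
  also have "(2 :: real) ^ n \<le> 2 ^ (n * l)" using l by (intro power_increasing) auto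
  finally have ex: "\<exists>J. T \<le> 2 ^ (J * l)" using less_imp_le by blast
  define J where "J = (LEAST J. T \<le> 2 ^ (J * l))"
  have J: "T \<le> 2 ^ (J * l)" unfolding J_def by (rule LeastI_ex[OF ex])
  have "2 ^ (J * l) \<le> 2 ^ l * T"
  proof (cases J)
    case 0
    have "1 * 1 \<le> 2 ^ l * T" using T by (intro mult_mono) auto
    then show ?thesis by (simp add: 0)
  next
    case (Suc i)
    then have "\<not> T \<le> 2 ^ (i * l)" using not_less_Least[of i "\<lambda>J. T \<le> 2 ^ (J * l)"] by (simp add: J_def[symmetric])
    then show ?thesis by (simp add: Suc power_add)
  qed
  then show ?thesis using J by blast
qed

definition scale_const :: "nat \<Rightarrow> real \<Rightarrow> real" where
  "scale_const l \<kappa> = real (l + 1) / (1 - 2 powr (- \<kappa>))\<^sup>2"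

lemma scale_const_ge_1:
  assumes "0 < \<kappa>"
  shows "1 \<le> scale_const l \<kappa>"
proof -
  have x: "0 < 2 powr (- \<kappa>)" "2 powr (- \<kappa>) < 1" using assms by (auto simp: powr_less_one)
  have "(1 - 2 powr (- \<kappa>))\<^sup>2 \<le> 1" using x by (intro power_le_one) auto
  moreover have "0 < (1 - 2 powr (- \<kappa>))\<^sup>2" using x by (intro zero_less_power) auto
  ultimately show ?thesis by (simp add: scale_const_def pos_le_divide_eq)
qed

text \<open>Here \<open>scale_const\<close> comes from \<open>\<Sum>\<^sub>i (i + 1) x\<^sup>i = 1 / (1 - x)\<^sup>2\<close> at \<open>x = 2 powr - \<kappa>\<close>.\<close>

lemma weighted_level_sum:
  fixes A :: "nat \<Rightarrow> real" and l :: nat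
  assumes l: "1 \<le> l" and \<kappa>: "0 < \<kappa>" and Q: "1 \<le> Q"
    and A: "\<And>j. A j \<le> Q powr q * 2 powr (- real j * \<kappa>)"
    and \<kappa>_eq: "\<kappa> = q * (\<alpha> + real l / 2) - real l" and \<alpha>: "0 < \<alpha>"
    and J: "scale_const l \<kappa> * Q powr (2 * real l / (2 * \<alpha> + real l)) \<le> 2 ^ (J * l)"
  shows "(\<Sum>j\<in>{J<..N}. real (l + 1) * real (j - J) * A j) \<le> 2 ^ (J * l)"
proof -
  define C where "C = scale_const l \<kappa>"
  define \<theta> where "\<theta> = 2 * real l / (2 * \<alpha> + real l)"
  \<comment> \<open>Chosen so that \<open>\<theta> * e = q\<close> and
    \<open>?T powr e = ?T * 2 powr (real J * \<kappa>)\<close>: raising the assumption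
    \<open>J\<close> to this power turns it into a bound on \<open>Q powr q\<close>.\<close>
  define e where "e = 1 + \<kappa> / real l"
  define x where "x = 2 powr (- \<kappa>)"
  let ?T = "2 ^ (J * l) :: real"
  have C: "1 \<le> C" unfolding C_def by (rule scale_const_ge_1[OF \<kappa>])
  have x: "0 < x" "x < 1" using \<kappa> by (auto simp: x_def powr_less_one)
  have e1: "1 \<le> e" using \<kappa> by (simp add: e_def)
  have "\<theta> * e = q"
  proof -
    have "e = q * (2 * \<alpha> + real l) / (2 * real l)" using l by (simp add: e_def \<kappa>_eq field_simps)
    then show ?thesis using l \<alpha> by (simp add: \<theta>_def)
  qed
  then have "C powr e * Q powr q = (C * Q powr \<theta>) powr e"
    using C by (simp add: powr_mult powr_powr)
  also have "\<dots> \<le> ?T powr e"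
    using J C e1 by (intro powr_mono2) (auto simp: C_def \<theta>_def)
  also have "\<dots> = ?T * 2 powr (real J * \<kappa>)"
  proof -
    have T: "?T = 2 powr (real J * real l)" by (simp add: powr_realpow[symmetric])
    have "real J * real l * e = real J * real l + real J * \<kappa>" using l by (simp add: e_def field_simps)
    then show ?thesis unfolding T by (simp add: powr_powr powr_add[symmetric])
  qed
  finally have "C powr e * Q powr q \<le> ?T * 2 powr (real J * \<kappa>)" .
  \<comment> \<open>One factor \<open>C\<close> is retained; it pays for the sum of the series at
    the end.\<close>
  moreover have "C * Q powr q \<le> C powr e * Q powr q"
    using C e1 powr_mono[of 1 e C] by (intro mult_right_mono) auto
  ultimately have CQ: "C * Q powr q \<le> ?T * 2 powr (real J * \<kappa>)" by linarith
  have level: "C * A j \<le> ?T * x ^ (j - J)" if "J < j" for j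
  proof -
    have "C * A j \<le> C * (Q powr q * 2 powr (- real j * \<kappa>))"
      using C A by (intro mult_left_mono) auto
    also have "\<dots> \<le> ?T * 2 powr (real J * \<kappa>) * 2 powr (- real j * \<kappa>)"
      using CQ unfolding mult.assoc[symmetric] by (rule mult_right_mono) simp
    also have "\<dots> = ?T * x ^ (j - J)"
    proof -
      have "x ^ (j - J) = x powr real (j - J)" using x by (simp add: powr_realpow)
      also have "\<dots> = 2 powr (real J * \<kappa> + - real j * \<kappa>)"
        using that by (simp add: x_def powr_powr of_nat_diff algebra_simps)
      finally have "x ^ (j - J) = 2 powr (real J * \<kappa>) * 2 powr (- real j * \<kappa>)" by (simp only: powr_add)
      then show ?thesis by (simp only: mult.assoc)
    qed
    finally show ?thesis .
  qed
  have sums: "(\<lambda>i. real (Suc i) * x ^ i) sums (1 / (1 - x)\<^sup>2)"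
    using geometric_deriv_sums[of x] x by simp
  have "C * (\<Sum>j\<in>{J<..N}. real (l + 1) * real (j - J) * A j)
      = (\<Sum>j\<in>{J<..N}. real (l + 1) * real (j - J) * (C * A j))"
    by (simp add: sum_distrib_left mult_ac)
  also have "\<dots> \<le> (\<Sum>j\<in>{J<..N}. real (l + 1) * real (j - J) * (?T * x ^ (j - J)))"
    using level by (intro sum_mono mult_left_mono) auto
  \<comment> \<open>Replacing \<open>j - J\<close> by its successor gives the terms of the
    derivative of the geometric series.\<close>
  also have "\<dots> \<le> (\<Sum>j\<in>{J<..N}. real (l + 1) * ?T * (real (Suc (j - J)) * x ^ (j - J)))"
    using x by (intro sum_mono) (simp add: mult_ac mult_left_mono mult_right_mono)
  also have "\<dots> = real (l + 1) * ?T * (\<Sum>i\<in>(\<lambda>j. j - J) ` {J<..N}. real (Suc i) * x ^ i)"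
    by (subst sum.reindex) (auto simp: inj_on_def sum_distrib_left)
  also have "\<dots> \<le> real (l + 1) * ?T * (1 / (1 - x)\<^sup>2)"
    using sums x unfolding sums_unique[OF sums]
    by (intro mult_left_mono sum_le_suminf) (auto simp: sums_iff)
  also have "\<dots> = C * ?T" by (simp add: C_def scale_const_def x_def)
  finally show ?thesis using C by simp
qed

lemma besov_seminorm_level:
  assumes fin: "besov_seminorm \<Lambda> \<phi> \<alpha> p f < \<infinity>"
  shows "2 powr (real j * (\<alpha> + real CARD('n) / 2 - real CARD('n) / p)) *
      (\<Sum>k\<in>\<Lambda> (int j). \<bar>coeff \<phi> (f :: real ^ 'n \<Rightarrow> real) (int j) k\<bar> powr p) powr (1 / p)
    \<le> max (enn2real (besov_seminorm \<Lambda> \<phi> \<alpha> p f)) 1" (is "?x \<le> _")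
proof -
  have "ennreal ?x \<le> besov_seminorm \<Lambda> \<phi> \<alpha> p f"
    unfolding besov_seminorm_def by (rule SUP_upper) simp
  also have "\<dots> = ennreal (enn2real (besov_seminorm \<Lambda> \<phi> \<alpha> p f))" using fin by simp
  finally have "?x \<le> enn2real (besov_seminorm \<Lambda> \<phi> \<alpha> p f)" by (simp del: ennreal_enn2real)
  then show ?thesis by simp
qed

text \<open>The level \<open>J\<close> is taken, up to one step, as low as the budget of
  \<open>weighted_level_sum\<close> permits; this gives the upper bound on
  \<open>2 ^ (J * CARD('n))\<close>, the order of the risk.\<close>

lemma besov_approx:
  fixes \<phi> :: "int \<Rightarrow> 'k \<Rightarrow> real ^ 'n \<Rightarrow> real" and r :: nat
  assumes wb: "wavelet_basis \<Gamma> \<Lambda> \<phi>" and s: "s \<in> L1_plus cube_measure"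
    and p: "0 < p" and \<alpha>: "real CARD('n) * max (1 / p - 1 / 2) 0 < \<alpha>"
    and fin: "besov_seminorm \<Lambda> \<phi> \<alpha> p (\<lambda>x. sqrt (s x)) < \<infinity>"
  defines "R \<equiv> max (enn2real (besov_seminorm \<Lambda> \<phi> \<alpha> p (\<lambda>x. sqrt (s x)))) 1"
    and "\<theta> \<equiv> 2 * real CARD('n) / (2 * \<alpha> + real CARD('n))"
    and "\<kappa> \<equiv> min p 2 * (\<alpha> + real CARD('n) / 2) - real CARD('n)"
  shows "\<exists>J. \<exists>u\<in>wavelet_model \<Lambda> \<phi> J (model_radius CARD('n) \<Gamma> r J).
    (hellinger_fun cube_measure s u)\<^sup>2 \<le> (model_radius CARD('n) \<Gamma> r J)\<^sup>2 / 2 \<and>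
    2 ^ (J * CARD('n)) \<le> 2 ^ CARD('n) * (scale_const CARD('n) \<kappa> * (2 * max \<Gamma> 1 * R) powr \<theta>)"
proof -
  let ?l = "CARD('n)" and ?G = "max \<Gamma> 1"
  define q where "q = min p 2"
  have l: "1 \<le> ?l" by (simp add: Suc_le_eq)
  have q: "0 < q" "q \<le> 2" using p by (auto simp: q_def)
  have "0 \<le> real ?l * max (1 / p - 1 / 2) 0" by (intro mult_nonneg_nonneg) auto
  then have \<alpha>0: "0 < \<alpha>" using \<alpha> by linarith
  \<comment> \<open>For \<open>p \<le> 2\<close> this number is \<open>p\<close> times the gap in
    the assumption on \<open>\<alpha>\<close>; for larger \<open>p\<close> it is
    \<open>2 * \<alpha>\<close>.\<close>
  have \<kappa>: "0 < \<kappa>"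
  proof (cases "p \<le> 2")
    case True
    then have "max (1 / p - 1 / 2) 0 = 1 / p - 1 / 2" using p by (simp add: field_simps)
    then have "0 < p * (\<alpha> - real ?l * (1 / p - 1 / 2))" using \<alpha> p by simp
    also have "\<dots> = \<kappa>" using p True by (simp add: \<kappa>_def field_simps)
    finally show ?thesis .
  next
    case False
    then show ?thesis using \<alpha>0 by (simp add: \<kappa>_def)
  qed
  have R: "1 \<le> R" by (simp add: R_def)
  define Q where "Q = 2 * ?G * R"
  have "1 * 1 \<le> (2 * ?G) * R" using R by (intro mult_mono) auto
  then have Q: "1 \<le> Q" by (simp add: Q_def)
  have \<theta>: "0 \<le> \<theta>" using \<alpha>0 by (simp add: \<theta>_def)
  have "1 * 1 \<le> scale_const ?l \<kappa> * Q powr \<theta>"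
    using scale_const_ge_1[OF \<kappa>, of ?l] Q \<theta> by (intro mult_mono ge_one_powr_ge_zero) auto
  then obtain J where J: "scale_const ?l \<kappa> * Q powr \<theta> \<le> 2 ^ (J * ?l)"
      "2 ^ (J * ?l) \<le> 2 ^ ?l * (scale_const ?l \<kappa> * Q powr \<theta>)"
    using ex_dyadic_power[OF _ l] by auto
  have coeff_eq: "coeff \<phi> (pos_root s) (int j) k = coeff \<phi> (\<lambda>x. sqrt (s x)) (int j) k"
    if k: "k \<in> \<Lambda> (int j)" for j k
    unfolding coeff_def
  proof (rule integral_cong_AE)
    have "square_integrable (\<phi> (int j) k)" using wb k by (simp add: wavelet_basis_def)
    then have [measurable]: "\<phi> (int j) k \<in> borel_measurable cube_measure" by (simp add: square_integrable_def)
    note [measurable] = L1_plusD(2)[OF s]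
    show "(\<lambda>x. pos_root s x * \<phi> (int j) k x) \<in> borel_measurable cube_measure"
      "(\<lambda>x. sqrt (s x) * \<phi> (int j) k x) \<in> borel_measurable cube_measure" by measurable
    show "AE x in cube_measure. pos_root s x * \<phi> (int j) k x = sqrt (s x) * \<phi> (int j) k x"
      using L1_plusD(3)[OF s] by eventually_elim (simp add: pos_root_def)
  qed
  have level: "(\<Sum>k\<in>\<Lambda> (int j). \<bar>coeff \<phi> (pos_root s) (int j) k\<bar> powr q) \<le> Q powr q * 2 powr (- real j * \<kappa>)" for j
  proof -
    have "(\<Sum>k\<in>\<Lambda> (int j). \<bar>coeff \<phi> (pos_root s) (int j) k\<bar> powr q)
        = (\<Sum>k\<in>\<Lambda> (int j). \<bar>coeff \<phi> (\<lambda>x. sqrt (s x)) (int j) k\<bar> powr q)"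
      by (intro sum.cong refl) (simp add: coeff_eq)
    also have "\<dots> \<le> Q powr q * 2 powr (- real j * \<kappa>)"
      unfolding q_def Q_def \<kappa>_def
      by (rule besov_level_sum[OF p _ R card_level[OF wb] besov_seminorm_level[OF fin, folded R_def]]) simp
    finally show ?thesis .
  qed
  have "\<exists>u\<in>wavelet_model \<Lambda> \<phi> J (model_radius ?l \<Gamma> r J).
    (hellinger_fun cube_measure s u)\<^sup>2 \<le> (model_radius ?l \<Gamma> r J)\<^sup>2 / 2"
    by (rule wavelet_model_approx[OF wb s q], rule weighted_level_sum[OF l \<kappa> Q level _ \<alpha>0])
       (use J(1) in \<open>simp_all add: \<kappa>_def q_def \<theta>_def\<close>)
  then show ?thesis using J(2) unfolding Q_def by blast
qed

theorem theorem4: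
  fixes \<Gamma> :: "nat \<Rightarrow> real"
  shows "\<exists>C :: real \<Rightarrow> real \<Rightarrow> real.
    \<forall>(\<Lambda> :: nat \<Rightarrow> int \<Rightarrow> 'k set) (\<phi> :: nat \<Rightarrow> int \<Rightarrow> 'k \<Rightarrow> real ^ 'n \<Rightarrow> real).
      (\<forall>r. wavelet_basis (\<Gamma> r) (\<Lambda> r) (\<phi> r)) \<longrightarrow>
      (\<exists>est :: (real ^ 'n) multiset \<Rightarrow> real ^ 'n \<Rightarrow> real.
         T_estimator cube_measure est \<and>
         (\<forall>\<alpha> p s.
            0 < p \<longrightarrow>
            real CARD('n) * max (1 / p - 1 / 2) 0 < \<alpha> \<longrightarrow>
            characterizes_besov (\<Lambda> (nat \<lfloor>\<alpha>\<rfloor>)) (\<phi> (nat \<lfloor>\<alpha>\<rfloor>)) \<alpha> p \<longrightarrow>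
            s \<in> L1_plus cube_measure \<longrightarrow>
            (\<lambda>x. sqrt (s x)) \<in> besov_space \<alpha> p \<longrightarrow>
            (\<integral>\<^sup>+X. ennreal ((hellinger_fun cube_measure s (est X))\<^sup>2)
                \<partial>poisson_law (intensity_measure cube_measure s))
              \<le> ennreal (C \<alpha> p *
                   (max (enn2real (besov_seminorm (\<Lambda> (nat \<lfloor>\<alpha>\<rfloor>)) (\<phi> (nat \<lfloor>\<alpha>\<rfloor>)) \<alpha> p (\<lambda>x. sqrt (s x)))) 1)
                     powr (2 * real CARD('n) / (2 * \<alpha> + real CARD('n))))))"
proof -
  let ?l = "CARD('n)"
  define \<theta> where "\<theta> \<alpha> = 2 * real ?l / (2 * \<alpha> + real ?l)" for \<alpha> :: real
  define \<kappa> where "\<kappa> \<alpha> p = min p 2 * (\<alpha> + real ?l / 2) - real ?l" for \<alpha> p :: real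
  \<comment> \<open>The constant depends on the bounds \<open>B = 1\<close> and \<open>Z = 4\<close>
    only and can therefore be fixed before the bases are given.\<close>
  define c where "c = models.risk_const 1 4"
  define C where "C \<alpha> p = 28 * (3360 * (real (nat \<lfloor>\<alpha>\<rfloor>) + 1) * max (\<Gamma> (nat \<lfloor>\<alpha>\<rfloor>)) 1 *
    (2 ^ ?l * (scale_const ?l (\<kappa> \<alpha> p) * (2 * max (\<Gamma> (nat \<lfloor>\<alpha>\<rfloor>)) 1) powr \<theta> \<alpha>))) + c" for \<alpha> p :: real
  show ?thesis
  proof (rule exI[of _ C], intro allI impI)
    fix \<Lambda> :: "nat \<Rightarrow> int \<Rightarrow> 'k set" and \<phi> :: "nat \<Rightarrow> int \<Rightarrow> 'k \<Rightarrow> real ^ 'n \<Rightarrow> real"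
    assume wb: "\<forall>r. wavelet_basis (\<Gamma> r) (\<Lambda> r) (\<phi> r)"
    interpret models cube_measure UNIV "index_model \<Gamma> \<Lambda> \<phi>" "index_radius ?l \<Gamma>"
      "\<lambda>m. 5 * (index_radius ?l \<Gamma> m)\<^sup>2 / 84" 1 4
      using wb by (intro models_index_model) blast
    have c0: "0 \<le> c" by (simp add: c_def risk_const_def)
    show "\<exists>est :: (real ^ 'n) multiset \<Rightarrow> real ^ 'n \<Rightarrow> real.
         T_estimator cube_measure est \<and>
         (\<forall>\<alpha> p s.
            0 < p \<longrightarrow>
            real CARD('n) * max (1 / p - 1 / 2) 0 < \<alpha> \<longrightarrow>
            characterizes_besov (\<Lambda> (nat \<lfloor>\<alpha>\<rfloor>)) (\<phi> (nat \<lfloor>\<alpha>\<rfloor>)) \<alpha> p \<longrightarrow>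
            s \<in> L1_plus cube_measure \<longrightarrow>
            (\<lambda>x. sqrt (s x)) \<in> besov_space \<alpha> p \<longrightarrow>
            (\<integral>\<^sup>+X. ennreal ((hellinger_fun cube_measure s (est X))\<^sup>2)
                \<partial>poisson_law (intensity_measure cube_measure s))
              \<le> ennreal (C \<alpha> p *
                   (max (enn2real (besov_seminorm (\<Lambda> (nat \<lfloor>\<alpha>\<rfloor>)) (\<phi> (nat \<lfloor>\<alpha>\<rfloor>)) \<alpha> p (\<lambda>x. sqrt (s x)))) 1)
                     powr (2 * real CARD('n) / (2 * \<alpha> + real CARD('n)))))"
    proof (intro exI[of _ est] conjI allI impI T_estimator_est)
      fix \<alpha> p :: real and s :: "real ^ 'n \<Rightarrow> real"
      \<comment> \<open>Only the analysis selects a basis: the estimator uses the models of all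
        bases, and those of index \<open>r\<close> suffice to bound its risk at smoothness
        \<open>\<alpha>\<close>.\<close>
      define r where "r = nat \<lfloor>\<alpha>\<rfloor>"
      assume p: "0 < p" and \<alpha>: "real ?l * max (1 / p - 1 / 2) 0 < \<alpha>"
        and char: "characterizes_besov (\<Lambda> (nat \<lfloor>\<alpha>\<rfloor>)) (\<phi> (nat \<lfloor>\<alpha>\<rfloor>)) \<alpha> p"
        and s: "s \<in> L1_plus cube_measure" and bes: "(\<lambda>x. sqrt (s x)) \<in> besov_space \<alpha> p"
      have "square_integrable (\<lambda>x. sqrt (s x))"
      proof -
        note [measurable] = L1_plusD(2)[OF s]
        \<comment> \<open>Valid for negative \<open>y\<close> too, where \<open>sqrt\<close> is odd;
          \<open>s\<close> may be negative on a null set.\<close>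
        have "(sqrt y)\<^sup>2 = \<bar>y\<bar>" for y :: real
          using real_sqrt_pow2[of "\<bar>y\<bar>"] real_sqrt_minus[of y] by (cases "0 \<le> y") auto
        then show ?thesis using L1_plusD(1)[OF s] by (simp add: square_integrable_def)
      qed
      then have fin: "besov_seminorm (\<Lambda> r) (\<phi> r) \<alpha> p (\<lambda>x. sqrt (s x)) < \<infinity>"
        using char bes by (simp add: characterizes_besov_def r_def)
      define R where "R = max (enn2real (besov_seminorm (\<Lambda> r) (\<phi> r) \<alpha> p (\<lambda>x. sqrt (s x)))) 1"
      define G where "G = max (\<Gamma> r) 1"
      have R: "1 \<le> R" by (simp add: R_def)
      have "0 \<le> real ?l * max (1 / p - 1 / 2) 0" by (intro mult_nonneg_nonneg) auto
      then have "0 < \<alpha>" using \<alpha> by linarith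
      then have \<theta>0: "0 \<le> \<theta> \<alpha>" by (simp add: \<theta>_def)
      have R\<theta>: "1 \<le> R powr \<theta> \<alpha>" using R \<theta>0 by (rule ge_one_powr_ge_zero)
      obtain J u where u: "u \<in> wavelet_model (\<Lambda> r) (\<phi> r) J (model_radius ?l (\<Gamma> r) r J)"
          "(H s u)\<^sup>2 \<le> (model_radius ?l (\<Gamma> r) r J)\<^sup>2 / 2"
          "2 ^ (J * ?l) \<le> 2 ^ ?l * (scale_const ?l (\<kappa> \<alpha> p) * (2 * G * R) powr \<theta> \<alpha>)"
        using besov_approx[OF wb[rule_format, of r] s p \<alpha> fin, of r]
        unfolding R_def G_def \<theta>_def \<kappa>_def by blast
      define \<eta> where "\<eta> = model_radius ?l (\<Gamma> r) r J"
      have m: "u \<in> index_model \<Gamma> \<Lambda> \<phi> (prod_encode (r, J))" "index_radius ?l \<Gamma> (prod_encode (r, J)) = \<eta>"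
        using u(1) by (simp_all add: index_model_def index_radius_def \<eta>_def)
      have \<eta>: "\<eta>\<^sup>2 \<le> 3360 * (real r + 1) * G * (2 ^ ?l * (scale_const ?l (\<kappa> \<alpha> p) * (2 * G) powr \<theta> \<alpha>)) * R powr \<theta> \<alpha>"
      proof -
        have "\<eta>\<^sup>2 = 3360 * (real r + 1) * G * 2 ^ (J * ?l)" by (simp add: \<eta>_def model_radius_power2 G_def)
        also have "\<dots> \<le> 3360 * (real r + 1) * G * (2 ^ ?l * (scale_const ?l (\<kappa> \<alpha> p) * (2 * G * R) powr \<theta> \<alpha>))"
          using u(3) by (rule mult_left_mono) (simp add: G_def)
        also have "(2 * G * R) powr \<theta> \<alpha> = (2 * G) powr \<theta> \<alpha> * R powr \<theta> \<alpha>"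
          using R by (simp add: powr_mult G_def)
        finally show ?thesis by (simp add: mult_ac)
      qed
      have "(\<integral>\<^sup>+X. ennreal ((H s (est X))\<^sup>2) \<partial>poisson_law (intensity_measure cube_measure s))
          \<le> ennreal (34 * (H s u)\<^sup>2 + 21 / 2 * \<eta>\<^sup>2 + c)"
        using risk_le[OF s UNIV_I m(1)] unfolding m(2) c_def .
      also have "\<dots> \<le> ennreal (C \<alpha> p * R powr \<theta> \<alpha>)"
      proof (rule ennreal_leI)
        \<comment> \<open>34/2 + 21/2 = 27.5, rounded up to 28.\<close>
        have "34 * (H s u)\<^sup>2 + 21 / 2 * \<eta>\<^sup>2 + c \<le> 28 * \<eta>\<^sup>2 + c"
          using u(2) zero_le_power2[of \<eta>] unfolding \<eta>_def[symmetric] by linarith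
        also have "c \<le> c * R powr \<theta> \<alpha>" using mult_left_mono[OF R\<theta> c0] by simp
        finally show "34 * (H s u)\<^sup>2 + 21 / 2 * \<eta>\<^sup>2 + c \<le> C \<alpha> p * R powr \<theta> \<alpha>"
          using \<eta> by (simp add: C_def r_def[symmetric] G_def[symmetric] distrib_right)
      qed
      finally show "(\<integral>\<^sup>+X. ennreal ((H s (est X))\<^sup>2) \<partial>poisson_law (intensity_measure cube_measure s))
          \<le> ennreal (C \<alpha> p *
              (max (enn2real (besov_seminorm (\<Lambda> (nat \<lfloor>\<alpha>\<rfloor>)) (\<phi> (nat \<lfloor>\<alpha>\<rfloor>)) \<alpha> p (\<lambda>x. sqrt (s x)))) 1)
                powr (2 * real ?l / (2 * \<alpha> + real ?l)))"
        unfolding R_def \<theta>_def r_def .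
    qed
  qed
qed

end
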